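(* Let $m\ge1$ and suppose that $\sigma_kN+b_k>-1$, $\sigma_k\ge0$ and $\tau_k>0$ for $k=1,\dots,m$. For $u\in\mathbb{C}$ with $0<|u|<1$ let $\zeta_m(u)$ be the largest real root of the algebraic equation in $x$ $$|u|^2\prod_{k=1}^m\big(\sigma_k-\sigma_m+\tau_k+x|u|^2\big)-\prod_{k=1}^m\big(\sigma_k-\sigma_m+x|u|^2\big)=0,$$ let $$\rho=\frac1{|u|}\,\frac1{\sqrt{\sum_{k=1}^m\Big(\frac1{\sigma_k-\sigma_m+|u|^2\zeta_m(u)}-\frac1{\sigma_k-\sigma_m+\tau_k+|u|^2\zeta_m(u)}\Big)}},$$ and introduce rescaled variables $z_k=u+\frac{v_k}{\rho\sqrt N}$, $k=1,\dots,n$. Put $$r_{\mathrm{in}}=\sqrt{\frac{\sigma_1\cdots\sigma_m}{(\sigma_1+\tau_1)\cdots(\sigma_m+\tau_m)}},\qquad r_{\mathrm{out}}=\sqrt{\frac{(1+\sigma_1)\cdots(1+\sigma_m)}{(1+\sigma_1+\tau_1)\cdots(1+\sigma_m+\tau_m)}}.$$ Then the following hold uniformly for $v_1,\dots,v_n$ in any compact subset of $\mathbb{C}$. (1) Bulk limit. For $r_{\mathrm{in}}<|u|<r_{\mathrm{out}}$, $$\lim_{N\to\infty}N^{-n}\rho^{-2n}R_{N,n}(z_1,\dots,z_n)=\det\Big(\frac1\pi e^{-\frac12(|v_k|^2+|v_j|^2-2v_k\overline{v_j})}\Big)_{1\le k,j\le n}.$$ (2) Inner edge. For $\sigma_1,\dots,\sigma_m>0$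 and $u=r_{\mathrm{in}}e^{i\phi}$ with $0\le\phi<2\pi$, $$\lim_{N\to\infty}N^{-n}\rho^{-2n}R_{N,n}(z_1,\dots,z_n)=\det\Big(\frac1{2\pi}e^{-\frac12(|v_k|^2+|v_j|^2-2v_k\overline{v_j})}\,\mathrm{erfc}\Big(-\frac{e^{i\phi}\overline{v_j}+v_ke^{-i\phi}}{\sqrt2}\Big)\Big)_{1\le k,j\le n}.$$ (3) Outer edge. For $u=r_{\mathrm{out}}e^{i\phi}$ with $0\le\phi<2\pi$, $$\lim_{N\to\infty}N^{-n}\rho^{-2n}R_{N,n}(z_1,\dots,z_n)=\det\Big(\frac1{2\pi}e^{-\frac12(|v_k|^2+|v_j|^2-2v_k\overline{v_j})}\,\mathrm{erfc}\Big(\frac{e^{i\phi}\overline{v_j}+v_ke^{-i\phi}}{\sqrt2}\Big)\Big)_{1\le k,j\le n}.$$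
   Context: The parameters $\sigma_k,\tau_k,b_k$ are real and fixed. $R_{N,n}(z_1,\dots,z_n)=\det\big(K_N(z_j,z_k)\big)_{1\le j,k\le n}$ (for $|z_j|<1$) are the eigenvalue correlation functions for products of $m$ independent truncated unitary matrices, where $K_N(z,z')=\sqrt{w_m(z)w_m(\overline{z'})}\,T_N(z,z')$, $$T_N(z,z')=\prod_{k=1}^m\frac{\Gamma(\sigma_kN+b_k+1)}{\Gamma((\sigma_k+\tau_k)N+b_k+2)}\sum_{l=0}^{N-1}\prod_{k=1}^m\frac{\Gamma((\sigma_k+\tau_k)N+b_k+l+2)}{\Gamma(\sigma_kN+b_k+l+1)}(z\overline{z'})^l,$$ $$w_m(z)=\frac{2^{m-1}|z|^{2\sigma_mN+2b_m}}{\pi}\prod_{k=1}^m\frac{\Gamma((\sigma_k+\tau_k)N+b_k+2)}{\Gamma(\sigma_kN+b_k+1)\Gamma(\tau_kN+1)}\int_{[0,1]^{m-1}}e^{-Np(r)}q(r)\,d^{m-1}r,$$ $$p(r)=-\sum_{k=1}^{m-1}\big(2(\sigma_k-\sigma_m)\ln r_k+\tau_k\ln(1-r_k^2)_+\big)-\tau_m\ln\Big(1-\frac{|z|^2}{\prod_{k=1}^{m-1}r_k^2}\Big)_+,\qquad q(r)=\prod_{k=1}^{m-1}r_k^{2(b_k-b_m)-1}.$$ Here $x_+=\max(x,0)$ and $\ln0=-\infty$ (so the integrand vanishes there); for $m=1$ the integral is read as $(1-|z|^2)_+^{\tau_1N}$. $\mathrm{erfc}=1-\mathrm{erf}$ is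 the (entire) complementary error function. *)

theory Defs
  imports "HOL-Complex_Analysis.Complex_Analysis"
begin

text \<open>
  The parameters are functions \<open>\<sigma>, \<tau>, b :: nat \<Rightarrow> real\<close> of which only the values at
  \<open>1, \<dots>, m\<close> are used. Points of \<open>[0,1]\<^sup>m\<^sup>-\<^sup>1\<close> are functions on the index set \<open>{1..<m}\<close>, integrated
  against the product of Lebesgue measures.
\<close>

definition phase_p ::
    "nat \<Rightarrow> (nat \<Rightarrow> real) \<Rightarrow> (nat \<Rightarrow> real) \<Rightarrow> complex \<Rightarrow> (nat \<Rightarrow> real) \<Rightarrow> real" where
  "phase_p m \<sigma> \<tau> z r =
     - (\<Sum>k\<in>{1..<m}. 2 * (\<sigma> k - \<sigma> m) * ln (r k) + \<tau> k * ln (1 - (r k)\<^sup>2))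
     - \<tau> m * ln (1 - (cmod z)\<^sup>2 / (\<Prod>k\<in>{1..<m}. (r k)\<^sup>2))"

definition amplitude_q :: "nat \<Rightarrow> (nat \<Rightarrow> real) \<Rightarrow> (nat \<Rightarrow> real) \<Rightarrow> real" where
  "amplitude_q m b r = (\<Prod>k\<in>{1..<m}. r k powr (2 * (b k - b m) - 1))"

text \<open>
  The case distinction implements the convention \<open>ln 0 = -\<infinity>\<close> for the positive parts occurring in
  \<open>p\<close>: the integrand vanishes unless every argument of a logarithm in \<open>p\<close> is positive
  (whereas \<open>ln 0 = 0\<close> in Isabelle/HOL, and \<open>x / 0 = 0\<close>).
\<close>

definition weight_integrand ::
    "nat \<Rightarrow> (nat \<Rightarrow> real) \<Rightarrow> (nat \<Rightarrow> real) \<Rightarrow> (nat \<Rightarrow> real) \<Rightarrow> nat \<Rightarrow> complex \<Rightarrow> (nat \<Rightarrow> real) \<Rightarrow> real" where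
  "weight_integrand m \<sigma> \<tau> b N z r =
     (if (\<forall>k\<in>{1..<m}. 0 < r k \<and> 0 < 1 - (r k)\<^sup>2) \<and>
         0 < 1 - (cmod z)\<^sup>2 / (\<Prod>k\<in>{1..<m}. (r k)\<^sup>2)
      then exp (- real N * phase_p m \<sigma> \<tau> z r) * amplitude_q m b r
      else 0)"

text \<open>
  For \<open>m = 1\<close> the index set \<open>{1..<m}\<close> is empty, the product measure is the unit mass at a single
  point, and the integral below is \<open>(1 - |z|\<^sup>2)\<^sub>+\<close> to the power \<open>\<tau>\<^sub>1 N\<close>.
\<close>

definition weight_w ::
    "nat \<Rightarrow> (nat \<Rightarrow> real) \<Rightarrow> (nat \<Rightarrow> real) \<Rightarrow> (nat \<Rightarrow> real) \<Rightarrow> nat \<Rightarrow> complex \<Rightarrow> real" where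
  "weight_w m \<sigma> \<tau> b N z =
     2 ^ (m - 1) * cmod z powr (2 * \<sigma> m * real N + 2 * b m) / pi *
     (\<Prod>k\<in>{1..m}. Gamma ((\<sigma> k + \<tau> k) * real N + b k + 2) /
        (Gamma (\<sigma> k * real N + b k + 1) * Gamma (\<tau> k * real N + 1))) *
     (LINT r : PiE {1..<m} (\<lambda>_. {0..1}) | PiM {1..<m} (\<lambda>_. lborel).
        weight_integrand m \<sigma> \<tau> b N z r)"

definition kernel_T ::
    "nat \<Rightarrow> (nat \<Rightarrow> real) \<Rightarrow> (nat \<Rightarrow> real) \<Rightarrow> (nat \<Rightarrow> real) \<Rightarrow> nat \<Rightarrow> complex \<Rightarrow> complex \<Rightarrow> complex" where
  "kernel_T m \<sigma> \<tau> b N z z' =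
     complex_of_real (\<Prod>k\<in>{1..m}. Gamma (\<sigma> k * real N + b k + 1) /
        Gamma ((\<sigma> k + \<tau> k) * real N + b k + 2)) *
     (\<Sum>l<N. complex_of_real (\<Prod>k\<in>{1..m}. Gamma ((\<sigma> k + \<tau> k) * real N + b k + real l + 2) /
        Gamma (\<sigma> k * real N + b k + real l + 1)) * (z * cnj z') ^ l)"

definition kernel_K ::
    "nat \<Rightarrow> (nat \<Rightarrow> real) \<Rightarrow> (nat \<Rightarrow> real) \<Rightarrow> (nat \<Rightarrow> real) \<Rightarrow> nat \<Rightarrow> complex \<Rightarrow> complex \<Rightarrow> complex" where
  "kernel_K m \<sigma> \<tau> b N z z' =
     complex_of_real (sqrt (weight_w m \<sigma> \<tau> b N z * weight_w m \<sigma> \<tau> b N (cnj z'))) *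
     kernel_T m \<sigma> \<tau> b N z z'"

definition corr_R ::
    "nat \<Rightarrow> (nat \<Rightarrow> real) \<Rightarrow> (nat \<Rightarrow> real) \<Rightarrow> (nat \<Rightarrow> real) \<Rightarrow> nat \<Rightarrow> complex ^ 'n \<Rightarrow> complex" where
  "corr_R m \<sigma> \<tau> b N z = det (\<chi> j k. kernel_K m \<sigma> \<tau> b N (z $ j) (z $ k))"

definition zeta_root ::
    "nat \<Rightarrow> (nat \<Rightarrow> real) \<Rightarrow> (nat \<Rightarrow> real) \<Rightarrow> complex \<Rightarrow> real" where
  "zeta_root m \<sigma> \<tau> u = (GREATEST x.
     (cmod u)\<^sup>2 * (\<Prod>k\<in>{1..m}. \<sigma> k - \<sigma> m + \<tau> k + x * (cmod u)\<^sup>2)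
       - (\<Prod>k\<in>{1..m}. \<sigma> k - \<sigma> m + x * (cmod u)\<^sup>2) = 0)"

definition rho_scale ::
    "nat \<Rightarrow> (nat \<Rightarrow> real) \<Rightarrow> (nat \<Rightarrow> real) \<Rightarrow> complex \<Rightarrow> real" where
  "rho_scale m \<sigma> \<tau> u = 1 / cmod u * (1 / sqrt (\<Sum>k\<in>{1..m}.
     1 / (\<sigma> k - \<sigma> m + (cmod u)\<^sup>2 * zeta_root m \<sigma> \<tau> u)
     - 1 / (\<sigma> k - \<sigma> m + \<tau> k + (cmod u)\<^sup>2 * zeta_root m \<sigma> \<tau> u)))"

definition r_in :: "nat \<Rightarrow> (nat \<Rightarrow> real) \<Rightarrow> (nat \<Rightarrow> real) \<Rightarrow> real" where
  "r_in m \<sigma> \<tau> = sqrt ((\<Prod>k\<in>{1..m}. \<sigma> k) / (\<Prod>k\<in>{1..m}. \<sigma> k + \<tau> k))"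

definition r_out :: "nat \<Rightarrow> (nat \<Rightarrow> real) \<Rightarrow> (nat \<Rightarrow> real) \<Rightarrow> real" where
  "r_out m \<sigma> \<tau> = sqrt ((\<Prod>k\<in>{1..m}. 1 + \<sigma> k) / (\<Prod>k\<in>{1..m}. 1 + \<sigma> k + \<tau> k))"

definition cerf :: "complex \<Rightarrow> complex" where
  "cerf z = complex_of_real (2 / sqrt pi) * contour_integral (linepath 0 z) (\<lambda>t. exp (- t\<^sup>2))"

definition cerfc :: "complex \<Rightarrow> complex" where
  "cerfc z = 1 - cerf z"

definition gauss_factor :: "complex \<Rightarrow> complex \<Rightarrow> complex" where
  "gauss_factor v w = exp (- (1/2) *
     (complex_of_real ((cmod v)\<^sup>2) + complex_of_real ((cmod w)\<^sup>2) - 2 * v * cnj w))"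

definition rescaled_corr ::
    "nat \<Rightarrow> (nat \<Rightarrow> real) \<Rightarrow> (nat \<Rightarrow> real) \<Rightarrow> (nat \<Rightarrow> real) \<Rightarrow> complex \<Rightarrow> nat \<Rightarrow> complex ^ 'n \<Rightarrow> complex" where
  "rescaled_corr m \<sigma> \<tau> b u N v =
     corr_R m \<sigma> \<tau> b N
       (\<chi> k. u + v $ k / complex_of_real (rho_scale m \<sigma> \<tau> u * sqrt (real N))) /
     complex_of_real (real N ^ CARD('n) * rho_scale m \<sigma> \<tau> u ^ (2 * CARD('n)))"

end

theory Submission
  imports Defs "HOL-Probability.Probability" "HOL-Real_Asymp.Real_Asymp"
begin

text \<open>
  Taking \<open>s\<^sub>k = r\<^sub>k\<^sup>2\<close>, the weight is a multiplicative convolution of the functions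
  \<open>s\<^sup>\<sigma>\<^sup>N\<^sup>+\<^sup>b (1 - s)\<^sup>\<tau>\<^sup>N\<close>, and the coefficients of the power series \<open>T\<^sub>N\<close> are reciprocals of
  products of their moments (Beta functions). Both are governed by the same one-dimensional Laplace
  asymptotics. Let \<open>t \<in> [0,1]\<close> solve \<open>\<Prod>(\<sigma>\<^sub>k + t) = |u|\<^sup>2 \<Prod>(\<sigma>\<^sub>k + \<tau>\<^sub>k + t)\<close>, so that
  \<open>|u|\<^sup>2 \<zeta>\<^sub>m(u) = \<sigma>\<^sub>m + t\<close>. After multiplication by \<open>s\<^sup>t\<^sup>N\<close> each factor peaks at
  \<open>(\<sigma>\<^sub>k + t) / (\<sigma>\<^sub>k + \<tau>\<^sub>k + t)\<close>; on the scale \<open>1 / \<surd>N\<close> in \<open>ln s\<close> it tends to a centred normal density of variance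
  \<open>1 / (\<sigma>\<^sub>k + t) - 1 / (\<sigma>\<^sub>k + \<tau>\<^sub>k + t)\<close> and is dominated by every exponential \<open>e\<^sup>-\<^sup>R\<^sup>|\<^sup>x\<^sup>|\<close>. Dominated
  convergence then gives the weight (a convolution of normal densities), the moments, and the sum over
  \<open>l = tN + y\<surd>N\<close>, which becomes a Gaussian integral over \<open>y\<close>. The range of \<open>y\<close> is the whole line in
  the bulk and a half line at the edges \<open>t = 0\<close> and \<open>t = 1\<close>, which is where erfc comes from. The
  kernel itself converges only up to unimodular factors \<open>c\<^sub>j / c\<^sub>k\<close>, and these cancel in the determinant.
\<close>

section \<open>Laplace asymptotics of a tilted Beta density\<close>

text \<open>No asymptotics of Gamma functions enter. Weight and coefficients are tilted by the same
  t, so the large factors (values of the Beta densities at their peaks, powers of |u|) occur in the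
  weight and, inverted, in the coefficients, and cancel in an identity that is exact for each large
  N. It is available because points are written as u exp(a / sqrt N): then |z|^2 and the powers in
  the sum are exact exponentials in a. Only quantities of order one are left for the limit. The
  obstacle is the sum: it runs over all l < N, whereas Laplace asymptotics reach only l - tN of
  order sqrt N. The far terms are dominated through a lower bound on the moments, uniform in l and
  of size exp(R |y|) with R at choice; it comes from the mass that a profile keeps in a fixed window
  near R or -R. The majorants exp(-R |x|) are not Gaussian because, as ln s tends to -infinity, a
  Beta density decays only exponentially in ln s. The unimodular factors have two sources: the phase
  of the tN-th power of z cnj z', and an imaginary part left over when the limiting exponent is
  brought to the form of the Gaussian factor.\<close>

lemma nn_integral_exp_substitution:
  fixes f :: "real \<Rightarrow> ennreal" and A c :: real
  assumes [measurable]: "f \<in> borel_measurable borel" and A: "A > 0" and c: "c > 0"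
  shows "(\<integral>\<^sup>+ s. f s * indicator {0<..} s \<partial>lborel) =
    (\<integral>\<^sup>+ x. f (A * exp (c * x)) * ennreal (A * (c * exp (c * x))) \<partial>lborel)"
proof -
  define g where "g x = A * exp (c * x)" for x
  \<comment> \<open>On compact intervals this is ordinary substitution. Both sides then increase to
    the full integrals, so no integrability of f is required.\<close>
  have step: "(\<integral>\<^sup>+ s. f s * indicator {g (- real (Suc n))..g (real (Suc n))} s \<partial>lborel) =
      (\<integral>\<^sup>+ x. f (g x) * ennreal (A * (c * exp (c * x))) * indicator {- real (Suc n)..real (Suc n)} x \<partial>lborel)" for n
    unfolding g_def
    by (rule nn_integral_substitution_aux)
       (use A c in \<open>auto intro!: derivative_eq_intros continuous_intros\<close>)
  have "(\<lambda>n. \<integral>\<^sup>+ s. f s * indicator {g (- real (Suc n))..g (real (Suc n))} s \<partial>lborel)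
      \<longlonglongrightarrow> (\<integral>\<^sup>+ s. f s * indicator {0<..} s \<partial>lborel)"
  proof (rule nn_integral_LIMSEQ)
    show "incseq (\<lambda>n s. f s * indicator {g (- real (Suc n))..g (real (Suc n))} s)"
    proof (intro incseq_SucI le_funI mult_left_mono)
      fix n s
      have "g (- real (Suc (Suc n))) \<le> g (- real (Suc n))" "g (real (Suc n)) \<le> g (real (Suc (Suc n)))"
        using A c by (simp_all add: g_def)
      then show "(indicator {g (- real (Suc n))..g (real (Suc n))} s :: ennreal)
          \<le> indicator {g (- real (Suc (Suc n)))..g (real (Suc (Suc n)))} s"
        by (auto simp: indicator_def)
    qed auto
    show "(\<lambda>n. f s * indicator {g (- real (Suc n))..g (real (Suc n))} s) \<longlonglongrightarrow> f s * indicator {0<..} s" for s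
    proof (cases "s > 0")
      case True
      define y where "y = ln (s / A) / c"
      have sy: "s = g y" unfolding g_def y_def using A c True by simp
      have "\<forall>\<^sub>F n in sequentially. \<bar>y\<bar> \<le> real (Suc n)" by real_asymp
      then have "\<forall>\<^sub>F n in sequentially. s \<in> {g (- real (Suc n))..g (real (Suc n))}"
        by eventually_elim (use A c in \<open>auto simp: sy g_def\<close>)
      then have "\<forall>\<^sub>F n in sequentially. f s * indicator {g (- real (Suc n))..g (real (Suc n))} s = f s * indicator {0<..} s"
        by eventually_elim (use True in auto)
      then show ?thesis by (rule tendsto_eventually)
    next
      case False
      then have "s \<notin> {g (- real (Suc n))..g (real (Suc n))}" for n
        using A unfolding g_def by (auto simp: not_le intro: le_less_trans[of s 0])
      then show ?thesis using False by simp
    qed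
  qed auto
  moreover have "(\<lambda>n. \<integral>\<^sup>+ x. f (g x) * ennreal (A * (c * exp (c * x))) * indicator {- real (Suc n)..real (Suc n)} x \<partial>lborel)
      \<longlonglongrightarrow> (\<integral>\<^sup>+ x. f (g x) * ennreal (A * (c * exp (c * x))) \<partial>lborel)"
  proof (rule nn_integral_LIMSEQ)
    show "incseq (\<lambda>n x. f (g x) * ennreal (A * (c * exp (c * x))) * indicator {- real (Suc n)..real (Suc n)} x)"
      by (auto simp: incseq_def le_fun_def indicator_def mult_left_mono)
    show "(\<lambda>n. f (g x) * ennreal (A * (c * exp (c * x))) * indicator {- real (Suc n)..real (Suc n)} x)
        \<longlonglongrightarrow> f (g x) * ennreal (A * (c * exp (c * x)))" for x
    proof -
      have "\<forall>\<^sub>F n in sequentially. \<bar>x\<bar> \<le> real (Suc n)" by real_asymp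
      then show ?thesis
        by (intro tendsto_eventually, eventually_elim) (auto simp: abs_le_iff)
    qed
  qed (auto simp: g_def)
  ultimately show ?thesis
    unfolding step unfolding g_def by (rule LIMSEQ_unique)
qed

text \<open>The difference 1/p - 1/(p + \<tau>), which is minus the reciprocal of the second
  derivative of \<open>saddle_phase p \<tau>\<close> at 0.\<close>

definition saddle_var :: "real \<Rightarrow> real \<Rightarrow> real" where
  "saddle_var p \<tau> = \<tau> / (p * (p + \<tau>))"

text \<open>The logarithm of s^p (1 - s)^\<tau> at s = e^h p/(p + \<tau>), minus its value at h = 0;
  there 1 - s is \<tau>/(p + \<tau>) times the argument of \<open>ln\<close>. Value and first
  derivative vanish at h = 0.\<close>

definition saddle_phase :: "real \<Rightarrow> real \<Rightarrow> real \<Rightarrow> real" where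
  "saddle_phase p \<tau> h = p * h + \<tau> * ln (1 - p / \<tau> * (exp h - 1))"

text \<open>
  The function \<open>s \<mapsto> s\<^sup>p\<^sup>N\<^sup>+\<^sup>b (1 - s)\<^sup>\<tau>\<^sup>N\<close> at \<open>s = p / (p + \<tau>) \<sqdot> e\<^sup>x\<^sup>/\<^sup>\<surd>\<^sup>N\<close>, divided by
  \<open>profile_const\<close> below.
\<close>

definition profile :: "real \<Rightarrow> real \<Rightarrow> real \<Rightarrow> nat \<Rightarrow> real \<Rightarrow> real" where
  "profile p \<tau> b N x =
     (if 0 < 1 - p / \<tau> * (exp (x / sqrt N) - 1)
      then exp (real N * saddle_phase p \<tau> (x / sqrt N) + b * (x / sqrt N)) / sqrt (2 * pi * saddle_var p \<tau>)
      else 0)"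

lemma saddle_var_pos: "p > 0 \<Longrightarrow> \<tau> > 0 \<Longrightarrow> saddle_var p \<tau> > 0"
  by (simp add: saddle_var_def)

lemma profile_measurable [measurable]: "profile p \<tau> b N \<in> borel_measurable borel"
  unfolding profile_def saddle_phase_def by measurable

lemma profile_nonneg:
  assumes "p > 0" "\<tau> > 0"
  shows "profile p \<tau> b N x \<ge> 0"
  using saddle_var_pos[OF assms] by (simp add: profile_def)

section \<open>Decay of the phase away from the peak\<close>

lemma ln_one_minus_le:
  fixes w :: real
  assumes "0 \<le> w" "w < 1"
  shows "ln (1 - w) \<le> - w - w\<^sup>2 / 2"
proof -
  let ?f = "\<lambda>w::real. - w - w\<^sup>2 / 2 - ln (1 - w)"
  have "?f 0 \<le> ?f w"
  proof (rule DERIV_nonneg_imp_nondecreasing[OF assms(1)])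
    fix x :: real assume x: "0 \<le> x" "x \<le> w"
    have "(?f has_real_derivative (- 1 - x + 1 / (1 - x))) (at x)"
      using x assms by (auto intro!: derivative_eq_intros)
    moreover have "- 1 - x + 1 / (1 - x) = x\<^sup>2 / (1 - x)"
      using x assms by (simp add: field_simps power2_eq_square)
    moreover have "x\<^sup>2 / (1 - x) \<ge> 0" using x assms by simp
    ultimately show "\<exists>y. (?f has_real_derivative y) (at x) \<and> 0 \<le> y" by auto
  qed
  then show ?thesis by simp
qed

text \<open>A bound 1 - a + C a^2 with C > 0 cannot hold for all a, since e^-a - 1 + a grows
  linearly; a^2 / (2 + 2a) is quadratic at 0 and linear at infinity. After clearing the denominator,
  the difference of the two sides has derivative 2a (1 - e^-a).\<close>

lemma exp_minus_lower:
  fixes a :: real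
  assumes "a \<ge> 0"
  shows "1 - a + a\<^sup>2 / (2 + 2 * a) \<le> exp (- a)"
proof -
  let ?f = "\<lambda>a::real. 2 * (1 + a) * exp (- a) - 2 + a\<^sup>2"
  have "?f 0 \<le> ?f a"
  proof (rule DERIV_nonneg_imp_nondecreasing[OF assms])
    fix x :: real assume x: "0 \<le> x"
    have "(?f has_real_derivative (2 * x * (1 - exp (- x)))) (at x)"
      by (auto intro!: derivative_eq_intros simp: algebra_simps)
    moreover have "2 * x * (1 - exp (- x)) \<ge> 0" using x by simp
    ultimately show "\<exists>y. (?f has_real_derivative y) (at x) \<and> 0 \<le> y" by blast
  qed
  then have "2 - a\<^sup>2 \<le> exp (- a) * (2 + 2 * a)" by (simp add: algebra_simps)
  moreover have "1 - a + a\<^sup>2 / (2 + 2 * a) = (2 - a\<^sup>2) / (2 + 2 * a)"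
    using assms by (simp add: field_simps power2_eq_square)
  ultimately show ?thesis using assms by (simp add: pos_divide_le_eq)
qed

lemma saddle_phase_upper_right:
  assumes "p > 0" "\<tau> > 0" "h \<ge> 0" "0 < 1 - p / \<tau> * (exp h - 1)"
  shows "saddle_phase p \<tau> h \<le> - (p / 2) * h\<^sup>2"
proof -
  define w where "w = p / \<tau> * (exp h - 1)"
  have w: "0 \<le> w" "w < 1" using assms unfolding w_def by auto
  have e: "exp h - 1 \<ge> h + h\<^sup>2 / 2"
    using exp_lower_Taylor_quadratic[OF assms(3)] by simp
  have "saddle_phase p \<tau> h \<le> p * h + \<tau> * (- w)"
    unfolding saddle_phase_def w_def[symmetric]
    using ln_one_minus_le[OF w] assms zero_le_power2[of w] by (intro add_left_mono mult_left_mono) linarith+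
  also have "\<dots> = p * (h - (exp h - 1))" using assms by (simp add: w_def algebra_simps)
  also have "\<dots> \<le> p * (- (h\<^sup>2 / 2))" using e assms by (intro mult_left_mono) auto
  finally show ?thesis by simp
qed

text \<open>The logarithm is bounded by its tangent. The remaining loss p (e^-a - 1 + a) is only
  linear for large a, because near s = 0 the power s^p is an exponential in ln s.\<close>

lemma saddle_phase_upper_left:
  assumes "p > 0" "\<tau> > 0" "a \<ge> 0"
  shows "saddle_phase p \<tau> (- a) \<le> - p * (a\<^sup>2 / (2 + 2 * a))"
proof -
  define w where "w = p / \<tau> * (exp (- a) - 1)"
  have w: "w \<le> 0" using assms unfolding w_def by (intro mult_nonneg_nonpos) auto
  have "ln (1 - w) \<le> - w" using w ln_le_minus_one[of "1 - w"] by simp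
  then have "saddle_phase p \<tau> (- a) \<le> p * (- a) + \<tau> * (- w)"
    unfolding saddle_phase_def w_def[symmetric] using assms by (intro add_left_mono mult_left_mono) auto
  also have "\<dots> = p * (1 - a - exp (- a))" using assms by (simp add: w_def algebra_simps)
  also have "\<dots> \<le> p * (- (a\<^sup>2 / (2 + 2 * a)))"
    using exp_minus_lower[OF assms(3)] assms by (intro mult_left_mono) auto
  finally show ?thesis by simp
qed

text \<open>On the scale x = h sqrt N both one-sided bounds fall below a line of any prescribed
  slope in |x|. On the left the slope for large |x| is of order sqrt N, which is why sqrt N has to
  exceed a multiple of R.\<close>

lemma saddle_phase_dominated:
  assumes p: "p > 0" and \<tau>: "\<tau> > 0" and R: "R \<ge> 0" and N: "sqrt (real N) \<ge> 4 * R" "N > 0"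
    and dom: "0 < 1 - p / \<tau> * (exp (x / sqrt N) - 1)"
  shows "real N * saddle_phase p \<tau> (x / sqrt N) \<le> p * (R\<^sup>2 - R * \<bar>x\<bar>)"
proof (cases "x \<ge> 0")
  case True
  have "real N * saddle_phase p \<tau> (x / sqrt N) \<le> real N * (- (p / 2) * (x / sqrt N)\<^sup>2)"
    using saddle_phase_upper_right[OF p \<tau> _ dom] True N by (intro mult_left_mono) auto
  also have "\<dots> = p * (- (x\<^sup>2 / 2))" using N by (simp add: power_divide)
  also have "\<dots> \<le> p * (R\<^sup>2 - R * \<bar>x\<bar>)"
  proof -
    have "0 \<le> (x - R)\<^sup>2 + R\<^sup>2" by simp
    then have "- (x\<^sup>2 / 2) \<le> R\<^sup>2 - R * x" by (simp add: power2_diff algebra_simps)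
    from mult_left_mono[OF this, of p] show ?thesis using p True by simp
  qed
  finally show ?thesis .
next
  case False
  define a where "a = - x"
  define q where "q = 1 / sqrt (real N)"
  have a: "a > 0" "\<bar>x\<bar> = a" "x / sqrt N = - (a * q)" using False by (auto simp: a_def q_def)
  have q: "q > 0" "real N * q\<^sup>2 = 1" "4 * R * q \<le> 1"
    using N by (auto simp: q_def power_divide field_simps)
  have "real N * saddle_phase p \<tau> (x / sqrt N) \<le> real N * (- p * ((a * q)\<^sup>2 / (2 + 2 * (a * q))))"
    unfolding a(3) using saddle_phase_upper_left[OF p \<tau>, of "a * q"] a q by (intro mult_left_mono) auto
  also have "\<dots> = p * (- ((real N * q\<^sup>2) * a\<^sup>2 / (2 + 2 * (a * q))))"
    by (simp add: power_mult_distrib)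
  also have "\<dots> = p * (- (a\<^sup>2 / (2 + 2 * (a * q))))" unfolding q by simp
  also have "\<dots> \<le> p * (R\<^sup>2 - R * \<bar>x\<bar>)"
  proof -
    \<comment> \<open>With 4 R q \<le> 1 the cross term 2 (R q) a^2 is at most a^2 / 2, and what
      remains is (a - 2R)^2 \<ge> 0.\<close>
    have "(R * a - R\<^sup>2) * (2 + 2 * (a * q)) = 2 * R * a + 2 * (R * q) * a\<^sup>2 - 2 * R\<^sup>2 - 2 * R\<^sup>2 * a * q"
      by (simp add: algebra_simps power2_eq_square)
    also have "\<dots> \<le> 2 * R * a + a\<^sup>2 / 2 - 2 * R\<^sup>2"
    proof -
      have "2 * (R * q) * a\<^sup>2 \<le> 1 / 2 * a\<^sup>2" using q by (intro mult_right_mono) auto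
      moreover have "2 * R\<^sup>2 * a * q \<ge> 0" using a q by simp
      ultimately show ?thesis by linarith
    qed
    also have "\<dots> \<le> a\<^sup>2"
    proof -
      have "0 \<le> (a - 2 * R)\<^sup>2" by simp
      then show ?thesis by (simp add: power2_diff algebra_simps)
    qed
    finally have "R * a - R\<^sup>2 \<le> a\<^sup>2 / (2 + 2 * (a * q))"
      using a q by (subst pos_le_divide_eq) (auto intro: add_pos_pos)
    then show ?thesis using p a by (intro mult_left_mono) auto
  qed
  finally show ?thesis .
qed

lemma profile_dominated:
  assumes p: "p > 0" and \<tau>: "\<tau> > 0" and R: "R \<ge> 0"
  shows "\<exists>D>0. \<forall>\<^sub>F N in sequentially. \<forall>x. profile p \<tau> b N x \<le> D * exp (- R * \<bar>x\<bar>)"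
proof -
  \<comment> \<open>The slope R of the conclusion plus |b| for the factor exp(b x / sqrt N); the
    division undoes the factor p in the bound on the phase.\<close>
  define R' where "R' = (R + \<bar>b\<bar>) / p"
  have R': "R' \<ge> 0" using p R by (simp add: R'_def)
  define D where "D = exp (p * R'\<^sup>2) / sqrt (2 * pi * saddle_var p \<tau>)"
  have D: "D > 0" using saddle_var_pos[OF p \<tau>] by (simp add: D_def)
  have "\<forall>\<^sub>F N in sequentially. sqrt (real N) \<ge> 4 * R'" by real_asymp
  moreover have "\<forall>\<^sub>F N::nat in sequentially. N > 0" by (rule eventually_gt_at_top)
  ultimately have "\<forall>\<^sub>F N in sequentially. \<forall>x. profile p \<tau> b N x \<le> D * exp (- R * \<bar>x\<bar>)"
  proof eventually_elim
    case (elim N)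
    show ?case
    proof
      fix x
      show "profile p \<tau> b N x \<le> D * exp (- R * \<bar>x\<bar>)"
      proof (cases "0 < 1 - p / \<tau> * (exp (x / sqrt N) - 1)")
        case False
        then show ?thesis using D by (simp add: profile_def)
      next
        case True
        have "b * (x / sqrt N) \<le> \<bar>b\<bar> * \<bar>x\<bar>"
        proof -
          have "b * (x / sqrt N) \<le> \<bar>b\<bar> * (\<bar>x\<bar> / sqrt N)"
            using abs_ge_self[of "b * (x / sqrt N)"] by (simp add: abs_mult abs_divide)
          also have "\<dots> \<le> \<bar>b\<bar> * \<bar>x\<bar>"
            using elim by (intro mult_left_mono) (auto simp: divide_le_eq mult_le_cancel_left1)
          finally show ?thesis .
        qed
        moreover have "real N * saddle_phase p \<tau> (x / sqrt N) \<le> p * (R'\<^sup>2 - R' * \<bar>x\<bar>)"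
          using saddle_phase_dominated[OF p \<tau> R' elim True] .
        moreover have "p * (R'\<^sup>2 - R' * \<bar>x\<bar>) = p * R'\<^sup>2 - R * \<bar>x\<bar> - \<bar>b\<bar> * \<bar>x\<bar>"
          using p by (simp add: R'_def field_simps)
        ultimately have "real N * saddle_phase p \<tau> (x / sqrt N) + b * (x / sqrt N) \<le> p * R'\<^sup>2 - R * \<bar>x\<bar>"
          by linarith
        then have "exp (real N * saddle_phase p \<tau> (x / sqrt N) + b * (x / sqrt N)) \<le> exp (p * R'\<^sup>2) * exp (- R * \<bar>x\<bar>)"
          by (simp flip: exp_add)
        then show ?thesis
          using True saddle_var_pos[OF p \<tau>] by (simp add: profile_def D_def divide_right_mono)
      qed
    qed
  qed
  with D show ?thesis by blast
qed

text \<open>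
  Convergence along all sequences \<open>x\<^sub>n \<longlonglongrightarrow> x\<close>: it is preserved by dominated convergence, and on
  compact sets it amounts to uniform convergence.
\<close>

definition continuously_converges ::
    "(nat \<Rightarrow> 'a::topological_space \<Rightarrow> 'b::topological_space) \<Rightarrow> ('a \<Rightarrow> 'b) \<Rightarrow> bool" where
  "continuously_converges F f \<longleftrightarrow> (\<forall>X x. X \<longlonglongrightarrow> x \<longrightarrow> (\<lambda>n. F n (X n)) \<longlonglongrightarrow> f x)"

section \<open>Gaussian limit at the peak\<close>

lemma saddle_phase_quadratic:
  assumes p: "p > 0" and \<tau>: "\<tau> > 0"
  shows "((\<lambda>h. saddle_phase p \<tau> h / h\<^sup>2) \<longlongrightarrow> - 1 / (2 * saddle_var p \<tau>)) (at 0)"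
proof -
  have "((\<lambda>h. saddle_phase p \<tau> h / h\<^sup>2) \<longlongrightarrow> - 1 / (2 * saddle_var p \<tau>)) (at_right 0)"
    unfolding saddle_phase_def saddle_var_def using p \<tau>
    by (real_asymp simp: field_simps)
  moreover have "((\<lambda>h. saddle_phase p \<tau> h / h\<^sup>2) \<longlongrightarrow> - 1 / (2 * saddle_var p \<tau>)) (at_left 0)"
    unfolding saddle_phase_def saddle_var_def using p \<tau>
    by (real_asymp simp: field_simps)
  ultimately show ?thesis by (simp add: filterlim_at_split)
qed

lemma profile_continuously_converges:
  assumes p: "p > 0" and \<tau>: "\<tau> > 0"
  shows "continuously_converges (profile p \<tau> b) (normal_density 0 (sqrt (saddle_var p \<tau>)))"
  unfolding continuously_converges_def
proof (intro allI impI)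
  fix X :: "nat \<Rightarrow> real" and x assume X: "X \<longlonglongrightarrow> x"
  let ?V = "saddle_var p \<tau>"
  have V: "?V > 0" by (rule saddle_var_pos[OF p \<tau>])
  define h where "h N = X N / sqrt (real N)" for N
  \<comment> \<open>The quotient of the phase by h^2, extended continuously to h = 0, so that N
    times the phase equals (X N)^2 q (h N) also at indices with X N = 0.\<close>
  define q where "q h = (if h = 0 then - 1 / (2 * ?V) else saddle_phase p \<tau> h / h\<^sup>2)" for h
  have "(q \<longlongrightarrow> - 1 / (2 * ?V)) (at 0)"
    by (rule Lim_transform_eventually[OF saddle_phase_quadratic[OF p \<tau>]])
       (auto simp: eventually_at q_def intro: exI[of _ 1])
  then have q: "isCont q 0" by (simp add: isCont_def q_def)
  have h0: "h \<longlonglongrightarrow> 0"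
  proof -
    have "(\<lambda>N. X N * (1 / sqrt (real N))) \<longlonglongrightarrow> x * 0"
      by (intro tendsto_mult X) real_asymp
    then show ?thesis by (simp add: h_def[abs_def])
  qed
  have "(\<lambda>N. (X N)\<^sup>2 * q (h N)) \<longlonglongrightarrow> x\<^sup>2 * q 0"
    by (intro tendsto_intros X isCont_tendsto_compose[OF q] h0)
  moreover have "\<forall>\<^sub>F N in sequentially. (X N)\<^sup>2 * q (h N) = real N * saddle_phase p \<tau> (h N)"
    using eventually_gt_at_top[of 0]
  proof eventually_elim
    case (elim N)
    then show ?case
      by (cases "X N = 0") (auto simp: q_def h_def saddle_phase_def power_divide)
  qed
  ultimately have 1: "(\<lambda>N. real N * saddle_phase p \<tau> (h N)) \<longlonglongrightarrow> x\<^sup>2 * q 0"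
    by (rule Lim_transform_eventually)
  have 2: "(\<lambda>N. exp (real N * saddle_phase p \<tau> (h N) + b * h N) / sqrt (2 * pi * ?V))
      \<longlonglongrightarrow> exp (x\<^sup>2 * q 0 + b * 0) / sqrt (2 * pi * ?V)"
    by (intro tendsto_intros 1 h0) (use V in auto)
  have "(\<lambda>N. 1 - p / \<tau> * (exp (h N) - 1)) \<longlonglongrightarrow> 1 - p / \<tau> * (exp 0 - 1)"
    by (intro tendsto_intros h0)
  then have "\<forall>\<^sub>F N in sequentially. 0 < 1 - p / \<tau> * (exp (h N) - 1)"
    by (intro order_tendstoD) auto
  then have "\<forall>\<^sub>F N in sequentially. exp (real N * saddle_phase p \<tau> (h N) + b * h N) / sqrt (2 * pi * ?V)
      = profile p \<tau> b N (X N)"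
    by eventually_elim (simp add: profile_def h_def)
  with 2 have "(\<lambda>N. profile p \<tau> b N (X N)) \<longlonglongrightarrow> exp (x\<^sup>2 * q 0 + b * 0) / sqrt (2 * pi * ?V)"
    by (rule Lim_transform_eventually)
  moreover have "exp (x\<^sup>2 * q 0 + b * 0) / sqrt (2 * pi * ?V) = normal_density 0 (sqrt ?V) x"
    using V by (simp add: normal_density_def q_def)
  ultimately show "(\<lambda>N. profile p \<tau> b N (X N)) \<longlonglongrightarrow> normal_density 0 (sqrt ?V) x" by simp
qed

section \<open>Convolutions and moments\<close>

text \<open>On the negative axis c e^(cx) dx corresponds to Lebesgue measure on (0,1] under s =
  e^(cx); reflection handles the positive axis.\<close>

lemma integrable_exp_abs:
  fixes c :: real
  assumes c: "c > 0"
  shows "integrable lborel (\<lambda>x. exp (- c * \<bar>x\<bar>))"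
proof -
  let ?h = "\<lambda>x::real. indicator {..0} x * exp (c * x)"
  have "(\<integral>\<^sup>+ x. ennreal (indicator {..0} x * (c * exp (c * x))) \<partial>lborel) =
      (\<integral>\<^sup>+ x. indicator {..1} (1 * exp (c * x)) * ennreal (1 * (c * exp (c * x))) \<partial>lborel)"
    using c by (intro nn_integral_cong) (auto simp: indicator_def mult_le_0_iff zero_le_mult_iff)
  also have "\<dots> = (\<integral>\<^sup>+ s. indicator {..1::real} s * indicator {0<..} s \<partial>lborel)"
    using nn_integral_exp_substitution[of "indicator {..1}" 1 c, symmetric] c by simp
  also have "\<dots> = (\<integral>\<^sup>+ s. indicator {0<..1::real} s \<partial>lborel)"
    by (intro nn_integral_cong) (auto simp: indicator_def)
  also have "\<dots> < \<infinity>" by simp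
  finally have "integrable lborel (\<lambda>x. indicator {..0} x * (c * exp (c * x)))"
    using c by (intro integrableI_bounded) (auto simp: abs_mult)
  then have "integrable lborel (\<lambda>x. (1 / c) * (indicator {..0} x * (c * exp (c * x))))"
    by (rule integrable_mult_right)
  then have h: "integrable lborel ?h" using c by (simp add: mult_ac)
  then have "integrable lborel (\<lambda>x. ?h (0 + (- 1) * x))"
    by (rule lborel_integrable_real_affine) simp
  from Bochner_Integration.integrable_add[OF h this] show ?thesis
    by (rule Bochner_Integration.integrable_bound) (auto simp: indicator_def)
qed

text \<open>Asymptotic bounds hold only from some index on; a shift of the sequence removes the
  finitely many exceptions without changing the limit.\<close>

lemma dominated_convergence_eventually:
  fixes s :: "nat \<Rightarrow> 'a \<Rightarrow> 'b::{banach, second_countable_topology}" and w :: "'a \<Rightarrow> real"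
  assumes s: "\<And>n. s n \<in> borel_measurable M" and w: "integrable M w"
    and lim: "\<And>x. (\<lambda>n. s n x) \<longlonglongrightarrow> f x"
    and bound: "\<forall>\<^sub>F n in sequentially. \<forall>x. norm (s n x) \<le> w x"
  shows "integrable M f" and "(\<lambda>n. integral\<^sup>L M (s n)) \<longlonglongrightarrow> integral\<^sup>L M f"
proof -
  obtain n0 where n0: "\<And>n x. n \<ge> n0 \<Longrightarrow> norm (s n x) \<le> w x"
    using bound unfolding eventually_sequentially by blast
  have f: "f \<in> borel_measurable M"
    by (rule borel_measurable_LIMSEQ_metric[OF s lim])
  have lim': "AE x in M. (\<lambda>n. s (n + n0) x) \<longlonglongrightarrow> f x"
    by (intro AE_I2 LIMSEQ_ignore_initial_segment[OF lim])
  have b: "AE x in M. norm (s (n + n0) x) \<le> w x" for n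
    using n0[of "n + n0"] by simp
  show "integrable M f"
    by (rule integrable_dominated_convergence[OF f s w lim' b])
  have "(\<lambda>n. integral\<^sup>L M (s (n + n0))) \<longlonglongrightarrow> integral\<^sup>L M f"
    by (rule integral_dominated_convergence[OF f s w lim' b])
  then show "(\<lambda>n. integral\<^sup>L M (s n)) \<longlonglongrightarrow> integral\<^sup>L M f"
    by (rule LIMSEQ_offset)
qed

lemma continuously_convergesD:
  "continuously_converges F f \<Longrightarrow> X \<longlonglongrightarrow> x \<Longrightarrow> (\<lambda>n. F n (X n)) \<longlonglongrightarrow> f x"
  by (simp add: continuously_converges_def)

text \<open>For fixed y the points X n - y converge again, so continuous convergence of
  \<open>F\<close> passes under the integral and is inherited by the convolution; for
  \<open>G\<close>, pointwise convergence and an integrable majorant suffice. The second claim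
  supplies the boundedness with which the result can serve as \<open>F\<close> again.\<close>

lemma convolution_continuously_converges:
  fixes F G :: "nat \<Rightarrow> real \<Rightarrow> real"
  assumes [measurable]: "\<And>n. F n \<in> borel_measurable borel" "\<And>n. G n \<in> borel_measurable borel"
    and F: "continuously_converges F f" and G: "\<And>y. (\<lambda>n. G n y) \<longlonglongrightarrow> g y"
    and Fb: "\<forall>\<^sub>F n in sequentially. \<forall>x. \<bar>F n x\<bar> \<le> C"
    and Gb: "\<forall>\<^sub>F n in sequentially. \<forall>y. \<bar>G n y\<bar> \<le> D * exp (- \<bar>y\<bar>)"
  shows "continuously_converges (\<lambda>n x. \<integral>y. G n y * F n (x - y) \<partial>lborel) (\<lambda>x. \<integral>y. g y * f (x - y) \<partial>lborel)"
    and "\<forall>\<^sub>F n in sequentially. \<forall>x. integrable lborel (\<lambda>y. G n y * F n (x - y)) \<and>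
           \<bar>\<integral>y. G n y * F n (x - y) \<partial>lborel\<bar> \<le> (\<integral>y. D * exp (- \<bar>y\<bar>) * C \<partial>lborel)"
proof -
  have w: "integrable lborel (\<lambda>y. D * exp (- \<bar>y\<bar>) * C)"
    using integrable_exp_abs[of 1] by simp
  have bound: "\<forall>\<^sub>F n in sequentially. \<forall>x y. norm (G n y * F n (x - y)) \<le> D * exp (- \<bar>y\<bar>) * C"
    using Fb Gb
  proof eventually_elim
    case (elim n)
    then show ?case
      by (auto simp: abs_mult intro!: mult_mono intro: order_trans[OF abs_ge_zero])
  qed
  show "continuously_converges (\<lambda>n x. \<integral>y. G n y * F n (x - y) \<partial>lborel) (\<lambda>x. \<integral>y. g y * f (x - y) \<partial>lborel)"
    unfolding continuously_converges_def
  proof (intro allI impI)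
    fix X :: "nat \<Rightarrow> real" and x assume X: "X \<longlonglongrightarrow> x"
    show "(\<lambda>n. \<integral>y. G n y * F n (X n - y) \<partial>lborel) \<longlonglongrightarrow> (\<integral>y. g y * f (x - y) \<partial>lborel)"
    proof (rule dominated_convergence_eventually(2)[OF _ w])
      show "(\<lambda>n. G n y * F n (X n - y)) \<longlonglongrightarrow> g y * f (x - y)" for y
        by (intro tendsto_mult G continuously_convergesD[OF F] tendsto_intros X)
      show "\<forall>\<^sub>F n in sequentially. \<forall>y. norm (G n y * F n (X n - y)) \<le> D * exp (- \<bar>y\<bar>) * C"
        using bound by eventually_elim auto
    qed measurable
  qed
  show "\<forall>\<^sub>F n in sequentially. \<forall>x. integrable lborel (\<lambda>y. G n y * F n (x - y)) \<and>
           \<bar>\<integral>y. G n y * F n (x - y) \<partial>lborel\<bar> \<le> (\<integral>y. D * exp (- \<bar>y\<bar>) * C \<partial>lborel)"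
    using bound
  proof eventually_elim
    case (elim n)
    show ?case
    proof
      fix x
      have i: "integrable lborel (\<lambda>y. G n y * F n (x - y))"
        by (rule Bochner_Integration.integrable_bound[OF w])
           (use elim in \<open>auto intro: order_trans[OF _ abs_ge_self]\<close>)
      moreover have "\<bar>\<integral>y. G n y * F n (x - y) \<partial>lborel\<bar> \<le> (\<integral>y. D * exp (- \<bar>y\<bar>) * C \<partial>lborel)"
        using Bochner_Integration.integral_norm_bound_integral[OF i w] elim by simp
      ultimately show "integrable lborel (\<lambda>y. G n y * F n (x - y)) \<and>
           \<bar>\<integral>y. G n y * F n (x - y) \<partial>lborel\<bar> \<le> (\<integral>y. D * exp (- \<bar>y\<bar>) * C \<partial>lborel)" by blast
    qed
  qed
qed

lemma normal_density_convolution: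
  assumes "V > 0" "W > 0"
  shows "(\<integral>y. normal_density 0 (sqrt W) y * normal_density 0 (sqrt V) (x - y) \<partial>lborel)
       = normal_density 0 (sqrt (V + W)) x"
proof -
  have "(\<integral>\<^sup>+y. ennreal (normal_density 0 (sqrt V) (x - y) * normal_density 0 (sqrt W) y) \<partial>lborel)
      = ennreal (normal_density 0 (sqrt (V + W)) x)"
    using fun_cong[OF conv_normal_density_zero_mean[of "sqrt V" "sqrt W"]] assms by simp
  then have "(\<integral>y. normal_density 0 (sqrt V) (x - y) * normal_density 0 (sqrt W) y \<partial>lborel)
      = normal_density 0 (sqrt (V + W)) x"
    by (subst integral_eq_nn_integral) auto
  then show ?thesis by (simp add: mult.commute)
qed

lemma normal_density_moment:
  assumes "V > 0"
  shows "(\<integral>x. normal_density 0 (sqrt V) x * exp (l * x) \<partial>lborel) = exp (V * l\<^sup>2 / 2)"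
proof -
  have "normal_density 0 (sqrt V) x * exp (l * x) = exp (V * l\<^sup>2 / 2) * normal_density (V * l) (sqrt V) x" for x
  proof -
    have "- (x\<^sup>2) / (2 * V) + l * x = V * l\<^sup>2 / 2 + - (x - V * l)\<^sup>2 / (2 * V)"
      using assms by (simp add: field_simps power2_eq_square)
    then have "exp (- (x\<^sup>2) / (2 * V)) * exp (l * x) = exp (V * l\<^sup>2 / 2) * exp (- (x - V * l)\<^sup>2 / (2 * V))"
      by (simp only: exp_add[symmetric])
    then show ?thesis
      using assms by (simp add: normal_density_def)
  qed
  then show ?thesis using assms by simp
qed

section \<open>Moment generating functions of the profiles\<close>

definition profile_mgf :: "real \<Rightarrow> real \<Rightarrow> real \<Rightarrow> nat \<Rightarrow> real \<Rightarrow> real" where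
  "profile_mgf p \<tau> b N l = (\<integral>x. profile p \<tau> b N x * exp (l * x) \<partial>lborel)"

lemma profile_pointwise:
  assumes "p > 0" "\<tau> > 0"
  shows "(\<lambda>N. profile p \<tau> b N x) \<longlonglongrightarrow> normal_density 0 (sqrt (saddle_var p \<tau>)) x"
  by (rule continuously_convergesD[OF profile_continuously_converges[OF assms]]) simp

lemma profile_mgf_continuously_converges:
  assumes p: "p > 0" and \<tau>: "\<tau> > 0"
  shows "continuously_converges (profile_mgf p \<tau> b) (\<lambda>l. exp (saddle_var p \<tau> * l\<^sup>2 / 2))"
  unfolding continuously_converges_def
proof (intro allI impI)
  fix L :: "nat \<Rightarrow> real" and l assume L: "L \<longlonglongrightarrow> l"
  let ?V = "saddle_var p \<tau>"
  \<comment> \<open>Eventually |L N| < K, and a majorant of slope K + 1 leaves exp(- |x|) after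
    multiplication by exp(L N x).\<close>
  define K where "K = \<bar>l\<bar> + 1"
  have K: "K > 0" by (simp add: K_def)
  have "(\<lambda>N. \<bar>L N\<bar>) \<longlonglongrightarrow> \<bar>l\<bar>" using L by (rule tendsto_rabs)
  then have LK: "\<forall>\<^sub>F N in sequentially. \<bar>L N\<bar> < K" by (rule order_tendstoD) (simp add: K_def)
  obtain D where D: "D > 0" "\<forall>\<^sub>F N in sequentially. \<forall>x. profile p \<tau> b N x \<le> D * exp (- (K + 1) * \<bar>x\<bar>)"
    using profile_dominated[OF p \<tau>, of "K + 1" b] K by auto
  have "(\<lambda>N. \<integral>x. profile p \<tau> b N x * exp (L N * x) \<partial>lborel)
      \<longlonglongrightarrow> (\<integral>x. normal_density 0 (sqrt ?V) x * exp (l * x) \<partial>lborel)"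
  proof (rule dominated_convergence_eventually(2))
    show "integrable lborel (\<lambda>x. D * exp (- 1 * \<bar>x\<bar>))"
      using integrable_exp_abs[of 1] by simp
    show "(\<lambda>N. profile p \<tau> b N x * exp (L N * x)) \<longlonglongrightarrow> normal_density 0 (sqrt ?V) x * exp (l * x)" for x
      by (intro tendsto_intros L profile_pointwise[OF p \<tau>])
    show "\<forall>\<^sub>F N in sequentially. \<forall>x. norm (profile p \<tau> b N x * exp (L N * x)) \<le> D * exp (- 1 * \<bar>x\<bar>)"
      using D(2) LK
    proof eventually_elim
      case (elim N)
      show ?case
      proof
        fix x
        have "L N * x \<le> K * \<bar>x\<bar>"
          using abs_ge_self[of "L N * x"] elim(2) mult_right_mono[of "\<bar>L N\<bar>" K "\<bar>x\<bar>"] by (simp add: abs_mult)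
        then have "profile p \<tau> b N x * exp (L N * x) \<le> (D * exp (- (K + 1) * \<bar>x\<bar>)) * exp (K * \<bar>x\<bar>)"
          using elim(1) D(1) by (intro mult_mono) auto
        also have "\<dots> = D * exp (- 1 * \<bar>x\<bar>)" by (simp add: exp_add[symmetric] algebra_simps)
        finally show "norm (profile p \<tau> b N x * exp (L N * x)) \<le> D * exp (- 1 * \<bar>x\<bar>)"
          using profile_nonneg[OF p \<tau>] by (simp add: abs_mult)
      qed
    qed
  qed measurable
  then show "(\<lambda>N. profile_mgf p \<tau> b N (L N)) \<longlonglongrightarrow> exp (?V * l\<^sup>2 / 2)"
    by (simp add: profile_mgf_def normal_density_moment saddle_var_pos[OF p \<tau>])
qed

text \<open>The limiting normal density has positive mass on the window, and half of that mass is a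
  lower bound for large N. The freedom in a is used to place the window where exp(l x) is
  large.\<close>

lemma profile_mass_lower:
  assumes p: "p > 0" and \<tau>: "\<tau> > 0"
  shows "\<exists>c>0. \<forall>\<^sub>F N in sequentially.
    integrable lborel (\<lambda>x. indicator {a..a + 1} x * profile p \<tau> b N x) \<and>
    c \<le> (\<integral>x. indicator {a..a + 1} x * profile p \<tau> b N x \<partial>lborel)"
proof -
  let ?V = "saddle_var p \<tau>" and ?I = "\<lambda>x. indicator {a..a + 1} x :: real"
  have V: "?V > 0" by (rule saddle_var_pos[OF p \<tau>])
  obtain D where D: "D > 0" "\<forall>\<^sub>F N in sequentially. \<forall>x. profile p \<tau> b N x \<le> D * exp (- 1 * \<bar>x\<bar>)"
    using profile_dominated[OF p \<tau>, of 1 b] by auto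
  have w: "integrable lborel (\<lambda>x. D * exp (- 1 * \<bar>x\<bar>))"
    using integrable_exp_abs[of 1] by simp
  have b: "\<forall>\<^sub>F N in sequentially. \<forall>x. norm (?I x * profile p \<tau> b N x) \<le> D * exp (- 1 * \<bar>x\<bar>)"
    using D(2) by eventually_elim (use D(1) profile_nonneg[OF p \<tau>] in \<open>auto simp: indicator_def\<close>)
  have lim: "(\<lambda>N. ?I x * profile p \<tau> b N x) \<longlonglongrightarrow> ?I x * normal_density 0 (sqrt ?V) x" for x
    by (intro tendsto_intros profile_pointwise[OF p \<tau>])
  have meas: "(\<lambda>x. ?I x * profile p \<tau> b N x) \<in> borel_measurable lborel" for N by measurable
  define c where "c = (\<integral>x. ?I x * normal_density 0 (sqrt ?V) x \<partial>lborel)"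
  have conv: "(\<lambda>N. \<integral>x. ?I x * profile p \<tau> b N x \<partial>lborel) \<longlonglongrightarrow> c"
    unfolding c_def by (rule dominated_convergence_eventually(2)[OF meas w lim b])
  have int: "integrable lborel (\<lambda>x. ?I x * normal_density 0 (sqrt ?V) x)"
    by (rule dominated_convergence_eventually(1)[OF meas w lim b])
  have "c > 0"
  proof -
    have "c \<noteq> 0"
    proof
      assume "c = 0"
      then have "AE x in lborel. ?I x * normal_density 0 (sqrt ?V) x = 0"
        unfolding c_def using integral_nonneg_eq_0_iff_AE[OF int] by auto
      then have "AE x in lborel. x \<notin> {a..a + 1}"
        by eventually_elim (use V normal_density_pos[of "sqrt ?V" 0] in \<open>auto simp: less_le\<close>)
      then have "emeasure lborel {a..a + 1} = 0"
        by (subst (asm) AE_iff_measurable[where N = "{a..a + 1}"]) auto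
      then show False by simp
    qed
    moreover have "c \<ge> 0" unfolding c_def by (intro integral_nonneg_AE) auto
    ultimately show ?thesis by simp
  qed
  have l: "\<forall>\<^sub>F N in sequentially. c / 2 < (\<integral>x. ?I x * profile p \<tau> b N x \<partial>lborel)"
    using conv \<open>c > 0\<close> by (intro order_tendstoD) auto
  have i: "\<forall>\<^sub>F N in sequentially. integrable lborel (\<lambda>x. ?I x * profile p \<tau> b N x)"
    using b by eventually_elim (rule Bochner_Integration.integrable_bound[OF w meas], use D(1) in auto)
  from l i have "\<forall>\<^sub>F N in sequentially. integrable lborel (\<lambda>x. ?I x * profile p \<tau> b N x) \<and>
      c / 2 \<le> (\<integral>x. ?I x * profile p \<tau> b N x \<partial>lborel)"
    by eventually_elim auto
  with \<open>c > 0\<close> show ?thesis by (intro exI[of _ "c / 2"]) auto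
qed

text \<open>Restricting the integral to [R, R + 1] for l \<ge> 0 and to [-R - 1, -R] for l < 0 gives
  l x \<ge> R |l| on the window. The threshold for N does not depend on l, as the estimate is
  applied to all terms of a sum at once. Integrability is a premise because a Bochner integral takes
  the default value 0 when the integrand is not integrable.\<close>

lemma profile_mgf_lower:
  assumes p: "p > 0" and \<tau>: "\<tau> > 0" and R: "R \<ge> 0"
  shows "\<exists>c>0. \<forall>\<^sub>F N in sequentially. \<forall>l. integrable lborel (\<lambda>x. profile p \<tau> b N x * exp (l * x)) \<longrightarrow>
           c * exp (R * \<bar>l\<bar>) \<le> profile_mgf p \<tau> b N l"
proof -
  obtain c1 where c1: "c1 > 0" "\<forall>\<^sub>F N in sequentially.
      integrable lborel (\<lambda>x. indicator {R..R + 1} x * profile p \<tau> b N x) \<and>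
      c1 \<le> (\<integral>x. indicator {R..R + 1} x * profile p \<tau> b N x \<partial>lborel)"
    using profile_mass_lower[OF p \<tau>] by blast
  obtain c2 where c2: "c2 > 0" "\<forall>\<^sub>F N in sequentially.
      integrable lborel (\<lambda>x. indicator {(- R - 1)..(- R - 1) + 1} x * profile p \<tau> b N x) \<and>
      c2 \<le> (\<integral>x. indicator {(- R - 1)..(- R - 1) + 1} x * profile p \<tau> b N x \<partial>lborel)"
    using profile_mass_lower[OF p \<tau>] by blast
  have "\<forall>\<^sub>F N in sequentially. \<forall>l. integrable lborel (\<lambda>x. profile p \<tau> b N x * exp (l * x)) \<longrightarrow>
           min c1 c2 * exp (R * \<bar>l\<bar>) \<le> profile_mgf p \<tau> b N l"
    using c1(2) c2(2)
  proof eventually_elim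
    case (elim N)
    have aux: "(\<integral>x. indicator A x * profile p \<tau> b N x \<partial>lborel) * exp (R * \<bar>l\<bar>) \<le> profile_mgf p \<tau> b N l"
      if A: "\<And>x. x \<in> A \<Longrightarrow> R * \<bar>l\<bar> \<le> l * x"
        and i: "integrable lborel (\<lambda>x. indicator A x * profile p \<tau> b N x)"
        and j: "integrable lborel (\<lambda>x. profile p \<tau> b N x * exp (l * x))" for A l
    proof -
      have "(\<integral>x. indicator A x * profile p \<tau> b N x * exp (R * \<bar>l\<bar>) \<partial>lborel) \<le> profile_mgf p \<tau> b N l"
        unfolding profile_mgf_def
        by (rule integral_mono[OF _ j])
           (use i profile_nonneg[OF p \<tau>] A in \<open>auto simp: indicator_def intro!: mult_left_mono\<close>)
      then show ?thesis by simp
    qed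
    show ?case
    proof (intro allI impI)
      fix l assume j: "integrable lborel (\<lambda>x. profile p \<tau> b N x * exp (l * x))"
      show "min c1 c2 * exp (R * \<bar>l\<bar>) \<le> profile_mgf p \<tau> b N l"
      proof (cases "l \<ge> 0")
        case True
        have "min c1 c2 * exp (R * \<bar>l\<bar>)
            \<le> (\<integral>x. indicator {R..R + 1} x * profile p \<tau> b N x \<partial>lborel) * exp (R * \<bar>l\<bar>)"
          using elim(1) by (intro mult_right_mono) auto
        also have "\<dots> \<le> profile_mgf p \<tau> b N l"
          using True elim(1) j by (intro aux) (auto simp: mult.commute intro: mult_right_mono)
        finally show ?thesis .
      next
        case False
        have "min c1 c2 * exp (R * \<bar>l\<bar>)
            \<le> (\<integral>x. indicator {(- R - 1)..(- R - 1) + 1} x * profile p \<tau> b N x \<partial>lborel) * exp (R * \<bar>l\<bar>)"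
          using elim(2) by (intro mult_right_mono) auto
        also have "\<dots> \<le> profile_mgf p \<tau> b N l"
        proof (intro aux)
          fix x assume "x \<in> {(- R - 1)..(- R - 1) + 1}"
          then have "l * (- R) \<le> l * x" using False by (intro mult_left_mono_neg) auto
          then show "R * \<bar>l\<bar> \<le> l * x" using False by (simp add: mult.commute)
        qed (use elim(2) j in auto)
        finally show ?thesis .
      qed
    qed
  qed
  with c1(1) c2(1) show ?thesis by (intro exI[of _ "min c1 c2"]) auto
qed

section \<open>Beta integrals as moments of a profile\<close>

definition saddle_pt :: "real \<Rightarrow> real \<Rightarrow> real" where
  "saddle_pt p \<tau> = p / (p + \<tau>)"

text \<open>The value of s^(pN + b) (1 - s)^(\<tau> N) at s = \<open>saddle_pt p \<tau>\<close>,
  times the normalisation that makes the profile tend to a probability density.\<close>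

definition profile_const :: "real \<Rightarrow> real \<Rightarrow> real \<Rightarrow> nat \<Rightarrow> real" where
  "profile_const p \<tau> b N = sqrt (2 * pi * saddle_var p \<tau>) *
     saddle_pt p \<tau> powr (p * N + b) * (1 - saddle_pt p \<tau>) powr (\<tau> * N)"

lemma saddle_pt_bounds:
  assumes "p > 0" "\<tau> > 0"
  shows "0 < saddle_pt p \<tau>" "saddle_pt p \<tau> < 1"
  using assms by (auto simp: saddle_pt_def)

lemma profile_const_pos:
  assumes "p > 0" "\<tau> > 0"
  shows "profile_const p \<tau> b N > 0"
  using assms saddle_pt_bounds[OF assms] saddle_var_pos[OF assms] by (simp add: profile_const_def)

text \<open>With s the saddle point, 1 - w = (1 - s) r, where r is the argument of the logarithm in
  \<open>saddle_phase\<close>. Hence the identity is exact, and the two case distinctions agree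
  since w < 1 iff r > 0.\<close>

lemma beta_density_eq_profile:
  assumes p: "p > 0" and \<tau>: "\<tau> > 0" and N: "N > 0"
    and w: "w = saddle_pt p \<tau> * exp (x / sqrt N)"
  shows "(if w < 1 then w powr (p * N + b) * (1 - w) powr (\<tau> * N) else 0) = profile_const p \<tau> b N * profile p \<tau> b N x"
proof -
  define s h where "s = saddle_pt p \<tau>" and "h = x / sqrt (real N)"
  define r where "r = 1 - p / \<tau> * (exp h - 1)"
  have s: "0 < s" "s < 1" using saddle_pt_bounds[OF p \<tau>] by (auto simp: s_def)
  have ps: "p / \<tau> * (1 - s) = s" "1 - s = \<tau> / (p + \<tau>)"
    using p \<tau> by (auto simp: s_def saddle_pt_def field_simps)
  have "(1 - s) * (1 - q * e) = (1 - s) - q * (1 - s) * e" for q e :: real by (simp add: algebra_simps)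
  then have "(1 - s) * r = (1 - s) - p / \<tau> * (1 - s) * (exp h - 1)" by (simp only: r_def)
  also have "\<dots> = (1 - s) - s * (exp h - 1)" by (simp only: ps(1))
  also have "\<dots> = 1 - s * exp h" by (simp add: algebra_simps)
  finally have eq: "1 - w = (1 - s) * r" by (simp add: w s_def h_def)
  have iff: "w < 1 \<longleftrightarrow> r > 0"
    using eq s by (metis diff_gt_0_iff_gt zero_less_mult_pos mult_pos_pos)
  show ?thesis
  proof (cases "r > 0")
    case True
    have "w powr (p * N + b) = s powr (p * N + b) * exp ((p * N + b) * h)"
      using s by (simp add: w s_def[symmetric] h_def[symmetric] powr_mult exp_powr_real mult.commute)
    moreover have "(1 - w) powr (\<tau> * N) = (1 - s) powr (\<tau> * N) * exp (\<tau> * N * ln r)"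
    proof -
      have "ln ((1 - s) * r) = ln (1 - s) + ln r" using s True by (intro ln_mult_pos) auto
      then show ?thesis unfolding eq using s True by (simp add: powr_def exp_add[symmetric] distrib_left)
    qed
    moreover have "exp (real N * saddle_phase p \<tau> h + b * h) = exp ((p * N + b) * h) * exp (\<tau> * N * ln r)"
    proof -
      have "saddle_phase p \<tau> h = p * h + \<tau> * ln r" by (simp only: saddle_phase_def r_def)
      then show ?thesis by (simp add: exp_add[symmetric] algebra_simps)
    qed
    moreover have "profile p \<tau> b N x =
        exp (real N * saddle_phase p \<tau> h + b * h) / sqrt (2 * pi * saddle_var p \<tau>)"
      using True by (simp only: profile_def h_def r_def if_True)
    ultimately show ?thesis
      using True iff saddle_var_pos[OF p \<tau>] by (simp add: profile_const_def s_def[symmetric])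
  next
    case False
    then have "profile p \<tau> b N x = 0" by (simp only: profile_def h_def r_def if_False)
    then show ?thesis using iff False by simp
  qed
qed

text \<open>Substitute w = s exp(x / sqrt N) in the Beta integral. The Jacobian w / sqrt N raises
  the exponent of w by one, which is the origin of \<open>sqrt N * y + 1\<close> and of the shift by
  1 / sqrt N in \<open>l\<close>. Finiteness of the Beta integral gives integrability, and its
  positivity that of the moment.\<close>

lemma profile_moment_Beta:
  assumes p: "p > 0" and \<tau>: "\<tau> > 0" and N: "N > 0" and y: "p * N + b + sqrt N * y + 1 > 0"
  defines "l \<equiv> y + 1 / sqrt N"
  shows "integrable lborel (\<lambda>x. profile p \<tau> b N x * exp (l * x))"
    and "Beta (p * N + b + sqrt N * y + 1) (\<tau> * N + 1) =
      profile_const p \<tau> b N * saddle_pt p \<tau> powr (sqrt N * y + 1) / sqrt N * profile_mgf p \<tau> b N l"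
    and "profile_mgf p \<tau> b N l > 0"
proof -
  define s where "s = saddle_pt p \<tau>"
  define \<kappa> where "\<kappa> = profile_const p \<tau> b N * s powr (sqrt N * y + 1) / sqrt N"
  have s: "0 < s" "s < 1" using saddle_pt_bounds[OF p \<tau>] by (auto simp: s_def)
  have \<kappa>: "\<kappa> > 0" using profile_const_pos[OF p \<tau>] s N by (simp add: \<kappa>_def)
  define A where "A = p * N + b + sqrt N * y"
  define f where "f w = indicator {0<..<1} w * (w powr A * (1 - w) powr (\<tau> * N))" for w :: real
  have fm: "f \<in> borel_measurable borel" unfolding f_def by measurable
  have f_nonneg: "f w \<ge> 0" for w by (simp add: f_def)
  have B: "((\<lambda>w. w powr A * (1 - w) powr (\<tau> * N)) has_integral Beta (A + 1) (\<tau> * N + 1)) {0<..<1}"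
    using has_integral_Beta_real[of "A + 1" "\<tau> * N + 1"] y \<tau> N
    by (simp add: A_def has_integral_Icc_iff_Ioo add_pos_pos)
  have "(f has_integral Beta (A + 1) (\<tau> * N + 1)) UNIV"
    using has_integral_restrict_UNIV[THEN iffD2, OF B]
    by (rule has_integral_eq[rotated]) (auto simp: f_def indicator_def)
  then have "(\<integral>\<^sup>+ w. ennreal (f w) \<partial>lborel) = ennreal (Beta (A + 1) (\<tau> * N + 1))"
    by (intro nn_integral_has_integral_lborel) (auto simp: fm f_nonneg)
  moreover have "(\<integral>\<^sup>+ w. ennreal (f w) \<partial>lborel) = (\<integral>\<^sup>+ w. ennreal (f w) * indicator {0<..} w \<partial>lborel)"
    by (intro nn_integral_cong) (auto simp: f_def indicator_def)
  moreover have "\<dots> = (\<integral>\<^sup>+ x. ennreal (f (s * exp (1 / sqrt N * x))) *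
      ennreal (s * (1 / sqrt N * exp (1 / sqrt N * x))) \<partial>lborel)"
    by (rule nn_integral_exp_substitution) (use s N in \<open>auto simp: f_def\<close>)
  moreover have "\<dots> = (\<integral>\<^sup>+ x. ennreal (\<kappa> * (profile p \<tau> b N x * exp (l * x))) \<partial>lborel)"
  proof (intro nn_integral_cong)
    fix x
    define w where "w = s * exp (x / sqrt N)"
    have w: "w > 0" using s by (simp add: w_def)
    have "f w * w = (if w < 1 then w powr (p * N + b) * (1 - w) powr (\<tau> * N) else 0) * w powr (sqrt N * y + 1)"
      using w by (auto simp: f_def A_def powr_add)
    also have "\<dots> = profile_const p \<tau> b N * profile p \<tau> b N x * w powr (sqrt N * y + 1)"
      by (subst beta_density_eq_profile[OF p \<tau> N]) (auto simp: w_def s_def)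
    also have "w powr (sqrt N * y + 1) = s powr (sqrt N * y + 1) * exp (l * x)"
    proof -
      have "(x / sqrt N) * (sqrt N * y + 1) = l * x"
        using N by (simp add: l_def field_simps)
      then show ?thesis using s by (simp add: w_def powr_mult exp_powr_real)
    qed
    finally have "f w * (w / sqrt N) = \<kappa> * (profile p \<tau> b N x * exp (l * x))"
      by (simp add: \<kappa>_def)
    moreover have "ennreal (f w) * ennreal (w / sqrt N) = ennreal (f w * (w / sqrt N))"
      by (rule ennreal_mult[symmetric]) (use w in \<open>auto simp: f_def\<close>)
    ultimately show "ennreal (f (s * exp (1 / sqrt N * x))) * ennreal (s * (1 / sqrt N * exp (1 / sqrt N * x)))
        = ennreal (\<kappa> * (profile p \<tau> b N x * exp (l * x)))"
      by (simp add: w_def)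
  qed
  ultimately have nn: "(\<integral>\<^sup>+ x. ennreal (\<kappa> * (profile p \<tau> b N x * exp (l * x))) \<partial>lborel) = ennreal (Beta (A + 1) (\<tau> * N + 1))"
    by metis
  have Bpos: "Beta (A + 1) (\<tau> * N + 1) > 0"
  proof -
    have "A + 1 > 0" "\<tau> * N + 1 > 0" using y \<tau> by (auto simp: A_def intro: add_nonneg_pos)
    then show ?thesis unfolding Beta_def by (intro divide_pos_pos mult_pos_pos Gamma_real_pos) auto
  qed
  have nonneg: "0 \<le> \<kappa> * (profile p \<tau> b N x * exp (l * x))" for x
    using \<kappa> profile_nonneg[OF p \<tau>] by simp
  have hb: "has_bochner_integral lborel (\<lambda>x. \<kappa> * (profile p \<tau> b N x * exp (l * x))) (Beta (A + 1) (\<tau> * N + 1))"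
    by (rule has_bochner_integral_nn_integral) (use nn nonneg Bpos in auto)
  from has_bochner_integral_mult_right[OF this, of "1 / \<kappa>"]
  have hb': "has_bochner_integral lborel (\<lambda>x. profile p \<tau> b N x * exp (l * x)) (Beta (A + 1) (\<tau> * N + 1) / \<kappa>)"
    using \<kappa> by simp
  then show "integrable lborel (\<lambda>x. profile p \<tau> b N x * exp (l * x))" by (rule integrable.intros)
  have m: "profile_mgf p \<tau> b N l = Beta (A + 1) (\<tau> * N + 1) / \<kappa>"
    unfolding profile_mgf_def using hb' by (rule has_bochner_integral_integral_eq)
  then show "profile_mgf p \<tau> b N l > 0" using Bpos \<kappa> by simp
  show "Beta (p * N + b + sqrt N * y + 1) (\<tau> * N + 1) =
      profile_const p \<tau> b N * saddle_pt p \<tau> powr (sqrt N * y + 1) / sqrt N * profile_mgf p \<tau> b N l"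
    using m \<kappa> unfolding \<kappa>_def[unfolded s_def, symmetric] by (simp add: A_def)
qed

section \<open>The weight as an iterated convolution\<close>

primrec conv_iter :: "(nat \<Rightarrow> real \<Rightarrow> real) \<Rightarrow> (real \<Rightarrow> real) \<Rightarrow> nat \<Rightarrow> real \<Rightarrow> real" where
  "conv_iter g f 0 = f"
| "conv_iter g f (Suc j) = (\<lambda>x. \<integral>y. g (Suc j) y * conv_iter g f j (x - y) \<partial>lborel)"

lemma conv_iter_measurable:
  assumes [measurable]: "\<And>k. g k \<in> borel_measurable borel" "f \<in> borel_measurable borel"
  shows "conv_iter g f j \<in> borel_measurable borel"
proof (induction j)
  case (Suc j)
  note [measurable] = Suc
  show ?case by simp
qed simp

lemma conv_iter_nonneg:
  assumes "\<And>k x. g k x \<ge> 0" "\<And>x. f x \<ge> 0"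
  shows "conv_iter g f j x \<ge> 0"
  by (induction j arbitrary: x) (auto intro!: integral_nonneg_AE mult_nonneg_nonneg assms)

text \<open>The claims are proved together: convergence and boundedness of one convolution are the
  hypotheses for the next. Integrability is recorded for every x because it later identifies the
  Bochner convolution with a nonnegative integral.\<close>

lemma conv_iter_profile_asymptotics:
  fixes p \<tau> b :: "nat \<Rightarrow> real"
  assumes p: "\<And>k. p k > 0" and \<tau>: "\<And>k. \<tau> k > 0"
  defines "C \<equiv> (\<lambda>j N. conv_iter (\<lambda>k. profile (p k) (\<tau> k) (b k) N) (profile (p 0) (\<tau> 0) (b 0) N) j)"
  shows "continuously_converges (C j) (normal_density 0 (sqrt (\<Sum>k\<le>j. saddle_var (p k) (\<tau> k))))
    \<and> (\<exists>B. \<forall>\<^sub>F N in sequentially. \<forall>x. \<bar>C j N x\<bar> \<le> B)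
    \<and> (\<forall>\<^sub>F N in sequentially. \<forall>x. integrable lborel (\<lambda>y. profile (p (Suc j)) (\<tau> (Suc j)) (b (Suc j)) N y * C j N (x - y)))"
proof (induction j)
  case 0
  obtain D where D: "D > 0" "\<forall>\<^sub>F N in sequentially. \<forall>x. profile (p 0) (\<tau> 0) (b 0) N x \<le> D * exp (- 0 * \<bar>x\<bar>)"
    using profile_dominated[OF p[of 0] \<tau>[of 0], of 0 "b 0"] by auto
  have Bd: "\<forall>\<^sub>F N in sequentially. \<forall>x. \<bar>C 0 N x\<bar> \<le> D"
    using D(2) by eventually_elim (use profile_nonneg[OF p \<tau>] in \<open>auto simp: C_def\<close>)
  obtain D' where D': "\<forall>\<^sub>F N in sequentially. \<forall>x. profile (p 1) (\<tau> 1) (b 1) N x \<le> D' * exp (- 1 * \<bar>x\<bar>)"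
    using profile_dominated[OF p[of 1] \<tau>[of 1], of 1 "b 1"] by auto
  have Gb: "\<forall>\<^sub>F N in sequentially. \<forall>x. \<bar>profile (p 1) (\<tau> 1) (b 1) N x\<bar> \<le> D' * exp (- \<bar>x\<bar>)"
    using D' by eventually_elim (use profile_nonneg[OF p \<tau>] in auto)
  have cc: "continuously_converges (C 0) (normal_density 0 (sqrt (saddle_var (p 0) (\<tau> 0))))"
    using profile_continuously_converges[OF p[of 0] \<tau>[of 0], of "b 0"] by (simp add: C_def[abs_def] continuously_converges_def)
  have meas: "C 0 N \<in> borel_measurable borel" for N
    by (simp add: C_def)
  have "\<forall>\<^sub>F N in sequentially. \<forall>x. integrable lborel (\<lambda>y. profile (p 1) (\<tau> 1) (b 1) N y * C 0 N (x - y))"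
    using convolution_continuously_converges(2)[OF meas profile_measurable cc profile_pointwise[OF p[of 1] \<tau>[of 1]] Bd Gb]
    by eventually_elim auto
  then show ?case using cc Bd by auto
next
  case (Suc j)
  let ?V = "\<Sum>k\<le>j. saddle_var (p k) (\<tau> k)" and ?k = "Suc j"
  have V: "?V > 0" by (intro sum_pos) (auto intro: saddle_var_pos p \<tau>)
  have W: "saddle_var (p ?k) (\<tau> ?k) > 0" by (rule saddle_var_pos[OF p \<tau>])
  from Suc obtain B where B: "\<forall>\<^sub>F N in sequentially. \<forall>x. \<bar>C j N x\<bar> \<le> B" by blast
  obtain D where D: "\<forall>\<^sub>F N in sequentially. \<forall>x. profile (p ?k) (\<tau> ?k) (b ?k) N x \<le> D * exp (- 1 * \<bar>x\<bar>)"
    using profile_dominated[OF p[of ?k] \<tau>[of ?k], of 1 "b ?k"] by auto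
  have Gb: "\<forall>\<^sub>F N in sequentially. \<forall>x. \<bar>profile (p ?k) (\<tau> ?k) (b ?k) N x\<bar> \<le> D * exp (- \<bar>x\<bar>)"
    using D by eventually_elim (use profile_nonneg[OF p \<tau>] in auto)
  have meas: "C j N \<in> borel_measurable borel" for j N
    unfolding C_def by (rule conv_iter_measurable) auto
  from Suc have cc: "continuously_converges (C j) (normal_density 0 (sqrt ?V))" by blast
  note cv = convolution_continuously_converges[OF meas profile_measurable cc profile_pointwise[OF p[of ?k] \<tau>[of ?k]] B Gb]
  have Ceq: "C ?k = (\<lambda>N x. \<integral>y. profile (p ?k) (\<tau> ?k) (b ?k) N y * C j N (x - y) \<partial>lborel)"
    by (simp add: C_def)
  have cc': "continuously_converges (C ?k) (normal_density 0 (sqrt (\<Sum>k\<le>?k. saddle_var (p k) (\<tau> k))))"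
    using cv(1) unfolding Ceq by (simp add: normal_density_convolution[OF V W])
  obtain B' where B': "\<forall>\<^sub>F N in sequentially. \<forall>x. \<bar>C ?k N x\<bar> \<le> B'"
  proof
    show "\<forall>\<^sub>F N in sequentially. \<forall>x. \<bar>C ?k N x\<bar> \<le> (\<integral>y. D * exp (- \<bar>y\<bar>) * B \<partial>lborel)"
      using cv(2) unfolding Ceq by eventually_elim blast
  qed
  obtain D' where D': "\<forall>\<^sub>F N in sequentially. \<forall>x. profile (p (Suc ?k)) (\<tau> (Suc ?k)) (b (Suc ?k)) N x \<le> D' * exp (- 1 * \<bar>x\<bar>)"
    using profile_dominated[OF p[of "Suc ?k"] \<tau>[of "Suc ?k"], of 1 "b (Suc ?k)"] by auto
  have Gb': "\<forall>\<^sub>F N in sequentially. \<forall>x. \<bar>profile (p (Suc ?k)) (\<tau> (Suc ?k)) (b (Suc ?k)) N x\<bar> \<le> D' * exp (- \<bar>x\<bar>)"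
    using D' by eventually_elim (use profile_nonneg[OF p \<tau>] in auto)
  have "\<forall>\<^sub>F N in sequentially. \<forall>x. integrable lborel (\<lambda>y. profile (p (Suc ?k)) (\<tau> (Suc ?k)) (b (Suc ?k)) N y * C ?k N (x - y))"
    using convolution_continuously_converges(2)[OF meas profile_measurable cc' profile_pointwise[OF p[of "Suc ?k"] \<tau>[of "Suc ?k"]] B' Gb']
    by eventually_elim auto
  with cc' B' show ?case by blast
qed

text \<open>With s = r^2 one has 2 dr / r = ds / s, so for y > 0 this is the multiplicative
  convolution of \<open>B 1\<close>, ..., \<open>B j\<close> and \<phi> at y. Extended nonnegative
  values allow Tonelli without integrability.\<close>

definition iter_integral :: "(nat \<Rightarrow> real \<Rightarrow> real) \<Rightarrow> (real \<Rightarrow> real) \<Rightarrow> nat \<Rightarrow> real \<Rightarrow> ennreal" where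
  "iter_integral B \<phi> j y = (\<integral>\<^sup>+ r. (\<Prod>k\<in>{1..<Suc j}. ennreal (indicator {0<..} (r k) * (2 * B k ((r k)\<^sup>2) / r k))) *
      ennreal (\<phi> (y / (\<Prod>k\<in>{1..<Suc j}. (r k)\<^sup>2))) \<partial>PiM {1..<Suc j} (\<lambda>_. lborel))"

lemma iter_integral_0: "iter_integral B \<phi> 0 y = ennreal (\<phi> y)"
  unfolding iter_integral_def by (simp add: PiM_empty nn_integral_count_space_finite)

lemma prod_fun_upd_Suc:
  "(\<Prod>k\<in>{1..<Suc j}. h k ((r(Suc j := q)) k)) = (\<Prod>k\<in>{1..<Suc j}. h k (r k))"
  by (rule prod.cong) auto

lemma iter_integral_Suc:
  assumes [measurable]: "\<And>k. B k \<in> borel_measurable borel" "\<phi> \<in> borel_measurable borel"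
  shows "iter_integral B \<phi> (Suc j) y =
    (\<integral>\<^sup>+ q. ennreal (indicator {0<..} q * (2 * B (Suc j) (q\<^sup>2) / q)) * iter_integral B \<phi> j (y / q\<^sup>2) \<partial>lborel)"
proof -
  interpret product_sigma_finite "\<lambda>_::nat. lborel :: real measure"
    by standard
  have I: "{1..<Suc (Suc j)} = insert (Suc j) {1..<Suc j}" by auto
  have "iter_integral B \<phi> (Suc j) y = (\<integral>\<^sup>+ q. (\<integral>\<^sup>+ r. ennreal (indicator {0<..} q * (2 * B (Suc j) (q\<^sup>2) / q)) *
      ((\<Prod>k\<in>{1..<Suc j}. ennreal (indicator {0<..} (r k) * (2 * B k ((r k)\<^sup>2) / r k))) *
      ennreal (\<phi> (y / q\<^sup>2 / (\<Prod>k\<in>{1..<Suc j}. (r k)\<^sup>2)))) \<partial>PiM {1..<Suc j} (\<lambda>_. lborel)) \<partial>lborel)"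
    unfolding iter_integral_def I
    apply (subst product_nn_integral_insert_rev)
       apply (simp, simp, measurable)
    apply (intro nn_integral_cong)
    apply (simp add: prod_fun_upd_Suc[where h="\<lambda>k x. x\<^sup>2"] prod_fun_upd_Suc[where h="\<lambda>k x. ennreal (indicator {0<..} x * (2 * B k (x\<^sup>2) / x))"] mult.assoc
        del: fun_upd_apply)
    apply (simp add: mult_ac divide_simps)
    done
  also have "\<dots> = (\<integral>\<^sup>+ q. ennreal (indicator {0<..} q * (2 * B (Suc j) (q\<^sup>2) / q)) * iter_integral B \<phi> j (y / q\<^sup>2) \<partial>lborel)"
    unfolding iter_integral_def
    by (intro nn_integral_cong nn_integral_cmult) measurable
  finally show ?thesis .
qed

text \<open>In the coordinate a ln s a multiplicative convolution becomes an ordinary one. The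
  factor s^(-c), with one exponent common to all functions, is multiplicative and leaves the
  integral as y^(-c). Each integration contributes 1 / a, since ds / s = dx / a.\<close>

lemma iter_integral_conv_iter:
  fixes B g :: "nat \<Rightarrow> real \<Rightarrow> real"
  assumes [measurable]: "\<And>k. B k \<in> borel_measurable borel" "\<phi> \<in> borel_measurable borel"
      "\<And>k. g k \<in> borel_measurable borel" "f \<in> borel_measurable borel"
    and nonneg: "\<And>k x. g k x \<ge> 0" "\<And>x. f x \<ge> 0" "\<And>k. \<kappa> k > 0" "\<kappa>f > 0"
    and S: "\<And>k. S k > 0" "Sf > 0" and a: "a > 0"
    and B: "\<And>k s. s > 0 \<Longrightarrow> B k s = \<kappa> k * s powr (- c) * g k (a * ln (s / S k))"
    and \<phi>: "\<And>s. s > 0 \<Longrightarrow> \<phi> s = \<kappa>f * s powr (- c) * f (a * ln (s / Sf))"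
    and int: "\<And>i x. i < j \<Longrightarrow> integrable lborel (\<lambda>y. g (Suc i) y * conv_iter g f i (x - y))"
    and y: "y > 0"
  shows "iter_integral B \<phi> j y = ennreal ((1 / a) ^ j * (\<kappa>f * (\<Prod>k\<in>{1..<Suc j}. \<kappa> k)) * y powr (- c) *
           conv_iter g f j (a * ln (y / (Sf * (\<Prod>k\<in>{1..<Suc j}. S k)))))"
  using int y
proof (induction j arbitrary: y)
  case 0
  then show ?case by (simp add: iter_integral_0 \<phi>)
next
  case (Suc j)
  let ?k = "Suc j"
  define C Y where "C = (1 / a) ^ j * (\<kappa>f * (\<Prod>k\<in>{1..<Suc j}. \<kappa> k))" and "Y = Sf * (\<Prod>k\<in>{1..<Suc j}. S k)"
  define X where "X = a * ln (y / (Y * S ?k))"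
  have C: "C > 0" unfolding C_def using nonneg a by (intro mult_pos_pos prod_pos) auto
  have Y: "Y > 0" unfolding Y_def using S by (intro mult_pos_pos prod_pos) auto
  have nn: "conv_iter g f j x \<ge> 0" for x by (rule conv_iter_nonneg) (use nonneg in auto)
  have [measurable]: "conv_iter g f j \<in> borel_measurable borel" by (rule conv_iter_measurable) auto
  have IH: "iter_integral B \<phi> j y' = ennreal (C * y' powr (- c) * conv_iter g f j (a * ln (y' / Y)))" if "y' > 0" for y'
    unfolding C_def Y_def by (rule Suc.IH) (use Suc.prems that in auto)
  have "iter_integral B \<phi> ?k y =
      (\<integral>\<^sup>+ q. ennreal (2 * B ?k (q\<^sup>2) / q * (C * (y / q\<^sup>2) powr (- c) * conv_iter g f j (a * ln (y / q\<^sup>2 / Y)))) * indicator {0<..} q \<partial>lborel)"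
    unfolding iter_integral_Suc[OF assms(1,2)]
  proof (rule nn_integral_cong)
    fix q :: real
    show "ennreal (indicator {0<..} q * (2 * B ?k (q\<^sup>2) / q)) * iter_integral B \<phi> j (y / q\<^sup>2) =
      ennreal (2 * B ?k (q\<^sup>2) / q * (C * (y / q\<^sup>2) powr (- c) * conv_iter g f j (a * ln (y / q\<^sup>2 / Y)))) * indicator {0<..} q"
    proof (cases "q > 0")
      case True
      have "B ?k (q\<^sup>2) \<ge> 0" using True B[of "q\<^sup>2" ?k] nonneg by (simp add: less_imp_le)
      then have "2 * B ?k (q\<^sup>2) / q \<ge> 0" using True by simp
      moreover have "C * (y / q\<^sup>2) powr (- c) * conv_iter g f j (a * ln (y / q\<^sup>2 / Y)) \<ge> 0"
        using C nn by simp
      ultimately have "ennreal (2 * B ?k (q\<^sup>2) / q) * ennreal (C * (y / q\<^sup>2) powr (- c) * conv_iter g f j (a * ln (y / q\<^sup>2 / Y)))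
          = ennreal (2 * B ?k (q\<^sup>2) / q * (C * (y / q\<^sup>2) powr (- c) * conv_iter g f j (a * ln (y / q\<^sup>2 / Y))))"
        by (rule ennreal_mult[symmetric])
      then show ?thesis
        using True Suc.prems(2) by (subst IH) auto
    qed auto
  qed
  also have "\<dots> = (\<integral>\<^sup>+ x. ennreal (C * \<kappa> ?k / a * y powr (- c) * (g ?k x * conv_iter g f j (X - x))) \<partial>lborel)"
  \<comment> \<open>The integration variable q is a radius, not its square: with these constants q^2
    = S exp(x / a), that is, x = a ln(q^2 / S).\<close>
  proof (subst nn_integral_exp_substitution[where A = "sqrt (S ?k)" and c = "1 / (2 * a)"])
    show "(\<integral>\<^sup>+ x. ennreal (2 * B ?k ((sqrt (S ?k) * exp (1 / (2 * a) * x))\<^sup>2) / (sqrt (S ?k) * exp (1 / (2 * a) * x)) *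
          (C * (y / (sqrt (S ?k) * exp (1 / (2 * a) * x))\<^sup>2) powr - c *
           conv_iter g f j (a * ln (y / (sqrt (S ?k) * exp (1 / (2 * a) * x))\<^sup>2 / Y)))) *
          ennreal (sqrt (S ?k) * (1 / (2 * a) * exp (1 / (2 * a) * x))) \<partial>lborel) =
        (\<integral>\<^sup>+ x. ennreal (C * \<kappa> ?k / a * y powr (- c) * (g ?k x * conv_iter g f j (X - x))) \<partial>lborel)"
    proof (rule nn_integral_cong)
      fix x :: real
      define q where "q = sqrt (S ?k) * exp (1 / (2 * a) * x)"
      have q: "q > 0" using S by (simp add: q_def)
      have q2: "q\<^sup>2 = S ?k * exp (x / a)"
        using S(1)[of ?k] by (simp add: q_def power_mult_distrib exp_double[symmetric] less_imp_le)
      have l1: "a * ln (q\<^sup>2 / S ?k) = x" using S(1)[of ?k] a by (simp add: q2)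
      have l2: "a * ln (y / q\<^sup>2 / Y) = X - x"
        using S(1)[of ?k] a Y Suc.prems(2) by (simp add: q2 X_def ln_div ln_mult field_simps)
      have Bq: "B ?k (q\<^sup>2) = \<kappa> ?k * (q\<^sup>2) powr (- c) * g ?k x"
        using B[of "q\<^sup>2" ?k] q l1 by simp
      have pw: "(q\<^sup>2) powr (- c) * (y / q\<^sup>2) powr (- c) = y powr (- c)"
        using q Suc.prems(2) by (subst powr_mult[symmetric]) auto
      have "2 * B ?k (q\<^sup>2) / q * (C * (y / q\<^sup>2) powr - c * conv_iter g f j (X - x)) * (q / (2 * a)) =
          C * \<kappa> ?k / a * ((q\<^sup>2) powr (- c) * (y / q\<^sup>2) powr (- c)) * (g ?k x * conv_iter g f j (X - x))"
        unfolding Bq using q a by (simp add: field_simps)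
      also have "\<dots> = C * \<kappa> ?k / a * y powr (- c) * (g ?k x * conv_iter g f j (X - x))" by (simp only: pw)
      finally have "2 * B ?k (q\<^sup>2) / q * (C * (y / q\<^sup>2) powr - c * conv_iter g f j (X - x)) * (q / (2 * a)) =
          C * \<kappa> ?k / a * y powr (- c) * (g ?k x * conv_iter g f j (X - x))" .
      moreover have "2 * B ?k (q\<^sup>2) / q * (C * (y / q\<^sup>2) powr - c * conv_iter g f j (X - x)) \<ge> 0"
        unfolding Bq using q C nn nonneg by (simp add: less_imp_le)
      ultimately show "ennreal (2 * B ?k ((sqrt (S ?k) * exp (1 / (2 * a) * x))\<^sup>2) / (sqrt (S ?k) * exp (1 / (2 * a) * x)) *
          (C * (y / (sqrt (S ?k) * exp (1 / (2 * a) * x))\<^sup>2) powr - c *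
           conv_iter g f j (a * ln (y / (sqrt (S ?k) * exp (1 / (2 * a) * x))\<^sup>2 / Y)))) *
          ennreal (sqrt (S ?k) * (1 / (2 * a) * exp (1 / (2 * a) * x))) =
          ennreal (C * \<kappa> ?k / a * y powr (- c) * (g ?k x * conv_iter g f j (X - x)))"
        unfolding q_def[symmetric] l2
        using q a by (subst ennreal_mult[symmetric]) (auto simp: q_def mult_ac)
    qed
  qed (use S a in auto)
  also have "\<dots> = ennreal (C * \<kappa> ?k / a * y powr (- c) * conv_iter g f ?k X)"
  proof -
    have "integrable lborel (\<lambda>x. C * \<kappa> ?k / a * y powr (- c) * (g ?k x * conv_iter g f j (X - x)))"
      using Suc.prems(1)[of j X] by (intro integrable_mult_right) auto
    moreover have "0 \<le> C * \<kappa> ?k / a * y powr (- c) * (g ?k x * conv_iter g f j (X - x))" for x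
      using C nonneg a nn by (simp add: less_imp_le)
    ultimately show ?thesis
      by (subst nn_integral_eq_integral) auto
  qed
  also have "C * \<kappa> ?k / a * y powr (- c) * conv_iter g f ?k X =
      (1 / a) ^ ?k * (\<kappa>f * (\<Prod>k\<in>{1..<Suc ?k}. \<kappa> k)) * y powr (- c) * conv_iter g f ?k X"
    by (simp add: C_def mult_ac)
  also have "X = a * ln (y / (Sf * (\<Prod>k\<in>{1..<Suc ?k}. S k)))"
    by (simp add: X_def Y_def mult_ac)
  finally show ?case .
qed

text \<open>Positivity of s and of 1 - s is required explicitly because \<open>powr\<close> does not
  vanish at a negative base.\<close>

definition beta_weight :: "real \<Rightarrow> real \<Rightarrow> real \<Rightarrow> real" where
  "beta_weight \<alpha> \<beta> s = (if 0 < s \<and> s < 1 then s powr \<alpha> * (1 - s) powr \<beta> else 0)"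

lemma beta_weight_measurable [measurable]: "beta_weight \<alpha> \<beta> \<in> borel_measurable borel"
  unfolding beta_weight_def by measurable

lemma beta_weight_nonneg: "beta_weight \<alpha> \<beta> s \<ge> 0"
  by (simp add: beta_weight_def)

text \<open>The tilt: s^(\<sigma> N + b) = s^(-tN) s^((\<sigma> + t) N + b). The exponent of the
  first factor involves neither \<sigma> nor b, so it is common to all factors of the weight and can
  be moved out of the convolution.\<close>

lemma beta_weight_eq_profile:
  fixes \<sigma> t \<tau> b :: real
  assumes p: "\<sigma> + t > 0" and \<tau>: "\<tau> > 0" and N: "N > 0" and s: "s > 0"
  shows "beta_weight (\<sigma> * real N + b) (\<tau> * N) s = profile_const (\<sigma> + t) \<tau> b N * s powr (- (t * N)) *
    profile (\<sigma> + t) \<tau> b N (sqrt N * ln (s / saddle_pt (\<sigma> + t) \<tau>))"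
proof -
  have pt: "saddle_pt (\<sigma> + t) \<tau> > 0" by (rule saddle_pt_bounds[OF p \<tau>])
  have w: "s = saddle_pt (\<sigma> + t) \<tau> * exp (sqrt N * ln (s / saddle_pt (\<sigma> + t) \<tau>) / sqrt N)"
    using pt s N by simp
  have "s powr (\<sigma> * real N + b) = s powr (- (t * N)) * s powr ((\<sigma> + t) * N + b)"
    by (simp add: powr_add[symmetric] algebra_simps)
  then have "beta_weight (\<sigma> * real N + b) (\<tau> * N) s =
      s powr (- (t * N)) * (if s < 1 then s powr ((\<sigma> + t) * N + b) * (1 - s) powr (\<tau> * N) else 0)"
    using s by (simp add: beta_weight_def)
  then show ?thesis unfolding beta_density_eq_profile[OF p \<tau> N w] by simp
qed

lemma power2_powr: "x > 0 \<Longrightarrow> (x\<^sup>2) powr a = x powr (2 * a)" for x a :: real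
  by (simp add: powr_def ln_realpow)

text \<open>The integrand shows only the differences of \<sigma> and b at k and m, because the m-th
  squared radius is |z|^2 / P with P the product of the other squared radii. Splitting |z|^2 =
  (|z|^2 / P) P, the power P^(\<sigma>_m N + b_m) restores the full exponents; the exponent -1 in
  \<open>amplitude_q\<close> and the power of 2 make up the measures 2 dr / r. The point has to be
  extensional in order to belong to the function space \<open>PiE\<close>.\<close>

lemma weight_integrand_eq_beta_weight:
  fixes m N :: nat and \<sigma> \<tau> b :: "nat \<Rightarrow> real"
  assumes z: "z \<noteq> 0" and r: "r \<in> extensional {1..<m}"
  shows "ennreal (2 ^ (m - 1) * cmod z powr (2 * \<sigma> m * real N + 2 * b m) *
      (indicator (PiE {1..<m} (\<lambda>_. {0..1})) r * weight_integrand m \<sigma> \<tau> b N z r)) =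
    (\<Prod>k\<in>{1..<m}. ennreal (indicator {0<..} (r k) * (2 * beta_weight (\<sigma> k * N + b k) (\<tau> k * N) ((r k)\<^sup>2) / r k))) *
      ennreal (beta_weight (\<sigma> m * N + b m) (\<tau> m * N) ((cmod z)\<^sup>2 / (\<Prod>k\<in>{1..<m}. (r k)\<^sup>2)))"
    (is "?L = (\<Prod>k\<in>?I. ennreal (?f k)) * ennreal ?g")
proof (cases "\<forall>k\<in>?I. 0 < r k \<and> r k < 1")
  case False
  then obtain k where k: "k \<in> ?I" "\<not> (0 < r k \<and> r k < 1)" by blast
  have sq: "1 \<le> (r k)\<^sup>2" if "0 < r k" using k that by (simp add: one_le_power)
  have "\<not> ((\<forall>k\<in>{1..<m}. 0 < r k \<and> 0 < 1 - (r k)\<^sup>2) \<and>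
      0 < 1 - (cmod z)\<^sup>2 / (\<Prod>k\<in>{1..<m}. (r k)\<^sup>2))"
    using k(1) sq by (auto dest!: bspec[of _ _ k])
  then have wi: "weight_integrand m \<sigma> \<tau> b N z r = 0"
    unfolding weight_integrand_def by (simp only: if_False)
  have "?f k = 0"
    using sq by (cases "0 < r k") (simp_all add: beta_weight_def)
  then have "ennreal (?f k) = 0" by (simp only: ennreal_0)
  then have "\<exists>k\<in>?I. ennreal (?f k) = 0" using k(1) by blast
  then have "(\<Prod>k\<in>?I. ennreal (?f k)) = 0"
    by (intro prod_zero) simp_all
  then show ?thesis using wi by simp
next
  case True
  define P where "P = (\<Prod>k\<in>?I. (r k)\<^sup>2)"
  define y where "y = (cmod z)\<^sup>2"
  have rp: "0 < r k" "r k < 1" if "k \<in> ?I" for k using True that by blast+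
  have P: "P > 0" unfolding P_def by (intro prod_pos zero_less_power rp)
  have y: "y > 0" using z by (simp add: y_def)
  have A: "r \<in> PiE {1..<m} (\<lambda>_. {0..1})"
    using r rp by (auto simp: PiE_def intro!: less_imp_le)
  have sq: "0 < 1 - (r k)\<^sup>2" if "k \<in> ?I" for k
    using rp[OF that] by (simp add: power_less_one_iff less_imp_le)
  show ?thesis
  proof (cases "y / P < 1")
    case False
    show ?thesis
    proof -
      have "?g = 0" using False unfolding P_def[symmetric] y_def[symmetric] by (simp add: beta_weight_def)
      moreover have "weight_integrand m \<sigma> \<tau> b N z r = 0"
        unfolding weight_integrand_def P_def[symmetric] y_def[symmetric] using False by simp
      ultimately show ?thesis by simp
    qed
  next
    case True': True
    have wi: "weight_integrand m \<sigma> \<tau> b N z r = exp (- real N * phase_p m \<sigma> \<tau> z r) * amplitude_q m b r"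
      unfolding weight_integrand_def P_def[symmetric] y_def[symmetric]
      using rp(1) sq True' by auto
    have "- real N * phase_p m \<sigma> \<tau> z r =
        (\<Sum>k\<in>?I. 2 * real N * (\<sigma> k - \<sigma> m) * ln (r k) + \<tau> k * N * ln (1 - (r k)\<^sup>2)) + \<tau> m * N * ln (1 - y / P)"
    proof -
      have eq: "- n * (- A - B * L) = n * A + B * n * L" for n A B L :: real
        by (simp add: algebra_simps)
      show ?thesis
        unfolding phase_p_def P_def[symmetric] y_def[symmetric] eq sum_distrib_left
        by (intro arg_cong2[where f = "(+)"] sum.cong) (auto simp: algebra_simps)
    qed
    then have "exp (- real N * phase_p m \<sigma> \<tau> z r) =
        (\<Prod>k\<in>?I. r k powr (2 * real N * (\<sigma> k - \<sigma> m)) * (1 - (r k)\<^sup>2) powr (\<tau> k * N)) * (1 - y / P) powr (\<tau> m * N)"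
      unfolding \<open>- real N * phase_p m \<sigma> \<tau> z r = _\<close> exp_add exp_sum[OF finite_atLeastLessThan]
      using True' rp sq by (intro arg_cong2[where f="(*)"] prod.cong) (auto simp: powr_def exp_add less_imp_neq[symmetric])
    then have wi2: "weight_integrand m \<sigma> \<tau> b N z r =
        (\<Prod>k\<in>?I. r k powr (2 * real N * (\<sigma> k - \<sigma> m)) * (1 - (r k)\<^sup>2) powr (\<tau> k * N) * r k powr (2 * (b k - b m) - 1)) * (1 - y / P) powr (\<tau> m * N)"
      unfolding wi \<open>exp _ = _\<close> amplitude_q_def by (simp add: prod.distrib mult_ac)
    define \<alpha> where "\<alpha> k = \<sigma> k * N + b k" for k
    have zy: "cmod z powr (2 * \<sigma> m * real N + 2 * b m) = y powr \<alpha> m"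
    proof -
      have "2 * \<sigma> m * real N + 2 * b m = 2 * \<alpha> m" by (simp add: \<alpha>_def)
      then show ?thesis using z by (simp add: y_def power2_powr)
    qed
    have "P powr \<alpha> m = (\<Prod>k\<in>?I. r k powr (2 * \<alpha> m))"
    proof -
      have "P powr \<alpha> m = (\<Prod>k\<in>?I. (r k)\<^sup>2 powr \<alpha> m)"
        unfolding P_def by (rule prod_powr_distrib)
      also have "\<dots> = (\<Prod>k\<in>?I. r k powr (2 * \<alpha> m))"
      proof (rule prod.cong)
        fix k assume "k \<in> ?I"
        then show "(r k)\<^sup>2 powr \<alpha> m = r k powr (2 * \<alpha> m)" using rp by (simp add: power2_powr)
      qed simp
      finally show ?thesis .
    qed
    then have g: "?g = y powr \<alpha> m * (1 - y / P) powr (\<tau> m * N) / (\<Prod>k\<in>?I. r k powr (2 * \<alpha> m))"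
      using True' y P unfolding P_def[symmetric] y_def[symmetric] by (simp add: beta_weight_def powr_divide \<alpha>_def)
    have f: "?f k = 2 * (r k powr (2 * real N * (\<sigma> k - \<sigma> m)) * (1 - (r k)\<^sup>2) powr (\<tau> k * N) * r k powr (2 * (b k - b m) - 1)) * r k powr (2 * \<alpha> m)"
      if k: "k \<in> ?I" for k
    proof -
      have rk: "0 < r k" "(r k)\<^sup>2 < 1" using rp[OF k] sq[OF k] by auto
      have "r k powr (2 * real N * (\<sigma> k - \<sigma> m)) * r k powr (2 * (b k - b m) - 1) * r k powr (2 * \<alpha> m)
          = r k powr (2 * \<alpha> k - 1)"
        unfolding powr_add[symmetric] by (simp add: \<alpha>_def algebra_simps)
      moreover have "?f k = 2 * ((r k)\<^sup>2 powr \<alpha> k / r k) * (1 - (r k)\<^sup>2) powr (\<tau> k * N)"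
        using rk by (simp add: beta_weight_def \<alpha>_def)
      moreover have "(r k)\<^sup>2 powr \<alpha> k / r k = r k powr (2 * \<alpha> k - 1)"
        using rk(1) by (simp add: power2_powr powr_diff)
      ultimately show ?thesis by (simp add: mult_ac)
    qed
    have Pp: "(\<Prod>k\<in>?I. r k powr (2 * \<alpha> m)) > 0" by (intro prod_pos) (metis rp(1) powr_gt_zero less_irrefl)
    have "(\<Prod>k\<in>?I. ennreal (?f k)) * ennreal ?g = ennreal ((\<Prod>k\<in>?I. ?f k) * ?g)"
    proof -
      have nn: "?f k \<ge> 0" for k
        using beta_weight_nonneg[of "\<sigma> k * N + b k" "\<tau> k * N" "(r k)\<^sup>2"] by (cases "r k > 0") auto
      show ?thesis
        unfolding prod_ennreal[OF nn] by (rule ennreal_mult[symmetric], rule prod_nonneg, rule nn, rule beta_weight_nonneg)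
    qed
    also have "(\<Prod>k\<in>?I. ?f k) * ?g = 2 ^ (m - 1) * cmod z powr (2 * \<sigma> m * real N + 2 * b m) * (indicator (PiE {1..<m} (\<lambda>_. {0..1})) r * weight_integrand m \<sigma> \<tau> b N z r)"
    proof -
      have "(\<Prod>k\<in>?I. ?f k) = 2 ^ (m - 1) * (\<Prod>k\<in>?I. r k powr (2 * real N * (\<sigma> k - \<sigma> m)) * (1 - (r k)\<^sup>2) powr (\<tau> k * N) * r k powr (2 * (b k - b m) - 1)) * (\<Prod>k\<in>?I. r k powr (2 * \<alpha> m))"
        by (subst prod.cong[OF refl f], assumption, subst prod.distrib, subst prod.distrib) simp
      moreover have "X * H * Q * (Y * Z / Q) = X * Y * (1 * (H * Z))" if "Q > 0" for X Y Z H Q :: real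
        using that by simp
      ultimately show ?thesis
        unfolding g wi2 zy indicator_simps(1)[OF A] using Pp by (simp only:)
    qed
    finally show ?thesis by simp
  qed
qed

text \<open>Established first for the nonnegative integral, where no integrability of the weight has
  to be known; the Bochner integral of a nonnegative measurable function then has the same value.
  The m-th Beta density is the starting function of the iteration.\<close>

lemma weight_integral_eq_conv_iter:
  fixes m N :: nat and \<sigma> \<tau> b :: "nat \<Rightarrow> real"
  assumes z: "z \<noteq> 0" and m: "m = Suc j" and N: "N > 0"
    and p: "\<And>k. \<sigma> k + t > 0" and \<tau>: "\<And>k. \<tau> k > 0"
  defines "g \<equiv> (\<lambda>k. profile (\<sigma> k + t) (\<tau> k) (b k) N)"
  assumes int: "\<And>i x. i < j \<Longrightarrow> integrable lborel (\<lambda>y. g (Suc i) y * conv_iter g (g m) i (x - y))"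
  shows "2 ^ (m - 1) * cmod z powr (2 * \<sigma> m * real N + 2 * b m) *
     (LINT r : PiE {1..<m} (\<lambda>_. {0..1}) | PiM {1..<m} (\<lambda>_. lborel). weight_integrand m \<sigma> \<tau> b N z r) =
     (1 / sqrt N) ^ j * (\<Prod>k\<in>{1..m}. profile_const (\<sigma> k + t) (\<tau> k) (b k) N) * (cmod z)\<^sup>2 powr (- (t * N)) *
       conv_iter g (g m) j (sqrt N * ln ((cmod z)\<^sup>2 / (\<Prod>k\<in>{1..m}. saddle_pt (\<sigma> k + t) (\<tau> k))))"
    (is "?c1 * ?c2 * _ = ?R")
proof -
  let ?M = "PiM {1..<m} (\<lambda>_. lborel :: real measure)"
  let ?W = "\<lambda>r. indicator (PiE {1..<m} (\<lambda>_. {0..1})) r * weight_integrand m \<sigma> \<tau> b N z r"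
  have [measurable]: "?W \<in> borel_measurable ?M"
  proof -
    have [measurable]: "PiE {1..<m} (\<lambda>_. {0..1::real}) \<in> sets ?M" by (rule sets_PiM_I_finite) auto
    show ?thesis unfolding weight_integrand_def phase_p_def amplitude_q_def by measurable
  qed
  have Wnn: "?c1 * ?c2 * ?W r \<ge> 0" for r
    by (auto simp: weight_integrand_def amplitude_q_def indicator_def intro!: mult_nonneg_nonneg prod_nonneg)
  have pc: "profile_const (\<sigma> k + t) (\<tau> k) (b k) N > 0" for k by (rule profile_const_pos[OF p \<tau>])
  have sp: "saddle_pt (\<sigma> k + t) (\<tau> k) > 0" for k by (rule saddle_pt_bounds[OF p \<tau>])
  have gm[measurable]: "g k \<in> borel_measurable borel" for k by (simp add: g_def)
  have gn: "g k x \<ge> 0" for k x unfolding g_def by (rule profile_nonneg[OF p \<tau>])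
  have split: "(\<Prod>k\<in>{1..m}. h k) = h m * (\<Prod>k\<in>{1..<Suc j}. h k)" for h :: "nat \<Rightarrow> real"
  proof -
    have "{1..m} = insert m {1..<Suc j}" using m by auto
    then show ?thesis using m by simp
  qed
  have R: "?R \<ge> 0"
    by (intro mult_nonneg_nonneg prod_nonneg conv_iter_nonneg) (auto intro: less_imp_le pc gn)
  have "(\<integral>\<^sup>+ r. ennreal (?c1 * ?c2 * ?W r) \<partial>?M) =
      iter_integral (\<lambda>k. beta_weight (\<sigma> k * N + b k) (\<tau> k * N)) (beta_weight (\<sigma> m * N + b m) (\<tau> m * N)) j ((cmod z)\<^sup>2)"
    unfolding iter_integral_def
    unfolding m[symmetric] by (rule nn_integral_cong, rule weight_integrand_eq_beta_weight[OF z])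
      (simp add: space_PiM PiE_def)
  also have "\<dots> = ennreal ?R"
    unfolding split
    by (subst iter_integral_conv_iter[where g = g and f = "g m" and a = "sqrt N" and c = "t * N"
        and \<kappa> = "\<lambda>k. profile_const (\<sigma> k + t) (\<tau> k) (b k) N" and \<kappa>f = "profile_const (\<sigma> m + t) (\<tau> m) (b m) N"
        and S = "\<lambda>k. saddle_pt (\<sigma> k + t) (\<tau> k)" and Sf = "saddle_pt (\<sigma> m + t) (\<tau> m)"])
       (use z N gn pc sp int beta_weight_eq_profile[OF p \<tau> N] in \<open>auto simp: g_def\<close>)
  finally have nn: "(\<integral>\<^sup>+ r. ennreal (?c1 * ?c2 * ?W r) \<partial>?M) = ennreal ?R" .
  have "(\<integral>r. ?c1 * ?c2 * ?W r \<partial>?M) = enn2real (\<integral>\<^sup>+ r. ennreal (?c1 * ?c2 * ?W r) \<partial>?M)"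
    by (rule integral_eq_nn_integral[OF _ AE_I2[OF Wnn]]) measurable
  also have "\<dots> = ?R" unfolding nn by (rule enn2real_ennreal[OF R])
  finally have eq: "(\<integral>r. ?c1 * ?c2 * ?W r \<partial>?M) = ?R" .
  have "(LINT r : PiE {1..<m} (\<lambda>_. {0..1}) | ?M. weight_integrand m \<sigma> \<tau> b N z r) = (\<integral>r. ?W r \<partial>?M)"
    unfolding set_lebesgue_integral_def by (simp only: real_scaleR_def)
  then show ?thesis unfolding eq[symmetric] by (simp only: integral_mult_right_zero)
qed

section \<open>Sums over a mesh and the error function\<close>

text \<open>The limiting range of y = (l - tN) / sqrt N for 0 \<le> l < N. The endpoint 0 is kept
  for t = 0 and dropped for t = 1, as the floor function dictates, so that the step functions below
  converge at every point.\<close>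

definition saddle_region :: "real \<Rightarrow> real set" where
  "saddle_region t = {y. (t = 0 \<longrightarrow> 0 \<le> y) \<and> (t = 1 \<longrightarrow> y < 0)}"

lemma saddle_region_measurable [measurable]: "saddle_region t \<in> sets borel"
proof -
  have "saddle_region t = (if t = 0 then {0..} else if t = 1 then {..<0} else UNIV)"
    by (auto simp: saddle_region_def)
  then show ?thesis by simp
qed

lemma floor_mesh_tendsto:
  fixes t y :: real
  shows "(\<lambda>N. (of_int \<lfloor>real N * t + sqrt N * y\<rfloor> - real N * t) / sqrt N) \<longlonglongrightarrow> y"
proof (rule tendsto_sandwich)
  let ?i = "\<lambda>N. \<lfloor>real N * t + sqrt N * y\<rfloor>"
  show "\<forall>\<^sub>F N in sequentially. y - 1 / sqrt N \<le> (of_int (?i N) - real N * t) / sqrt N"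
    using eventually_gt_at_top[of 0]
  proof eventually_elim
    case (elim N)
    have "sqrt N * y - 1 \<le> of_int (?i N) - real N * t" by linarith
    then have "(sqrt N * y - 1) / sqrt N \<le> (of_int (?i N) - real N * t) / sqrt N"
      by (rule divide_right_mono) simp
    then show ?case using elim by (simp add: diff_divide_distrib)
  qed
  show "\<forall>\<^sub>F N in sequentially. (of_int (?i N) - real N * t) / sqrt N \<le> y"
    using eventually_gt_at_top[of 0]
  proof eventually_elim
    case (elim N)
    have "of_int (?i N) - real N * t \<le> sqrt N * y" by linarith
    then show ?case using elim by (simp add: pos_divide_le_eq mult.commute)
  qed
  show "(\<lambda>N. y - 1 / sqrt (real N)) \<longlonglongrightarrow> y" by real_asymp
qed simp

text \<open>At a bound that t does not attain, N t or N (1 - t) outgrows sqrt N y; at a bound that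
  it attains, the sign of y decides.\<close>

lemma saddle_region_eventually:
  fixes t y :: real
  assumes t: "0 \<le> t" "t \<le> 1"
  shows "\<forall>\<^sub>F N in sequentially. (0 \<le> \<lfloor>real N * t + sqrt N * y\<rfloor> \<and> \<lfloor>real N * t + sqrt N * y\<rfloor> < int N) \<longleftrightarrow> y \<in> saddle_region t"
proof -
  have lower: "\<forall>\<^sub>F N in sequentially. 0 \<le> real N * t + sqrt N * y" if "t > 0"
    using that by real_asymp
  have upper: "\<forall>\<^sub>F N in sequentially. real N * t + sqrt N * y < real N" if "t < 1"
    using that by real_asymp
  have *: "\<lfloor>real N * t + sqrt N * y\<rfloor> < int N \<longleftrightarrow> real N * t + sqrt N * y < real N" for N :: nat
    by linarith
  consider "t = 0" | "t = 1" | "0 < t" "t < 1" using t by linarith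
  then show ?thesis
  proof cases
    case 1
    then have "\<forall>\<^sub>F N in sequentially. real N * t + sqrt N * y < real N" by (intro upper) simp
    then show ?thesis using eventually_gt_at_top[of "0::nat"]
    proof eventually_elim
      case (elim N)
      then have "\<lfloor>real N * t + sqrt N * y\<rfloor> < int N" by (simp only: *)
      moreover have "0 \<le> \<lfloor>real N * t + sqrt N * y\<rfloor> \<longleftrightarrow> 0 \<le> y"
        using 1 elim(2) by (simp add: zero_le_mult_iff)
      ultimately show ?case using 1 by (simp add: saddle_region_def)
    qed
  next
    case 2
    then have "\<forall>\<^sub>F N in sequentially. 0 \<le> real N * t + sqrt N * y" by (intro lower) simp
    then show ?thesis using eventually_gt_at_top[of "0::nat"]
    proof eventually_elim
      case (elim N)
      have "\<lfloor>real N * t + sqrt N * y\<rfloor> < int N \<longleftrightarrow> y < 0"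
        unfolding * using 2 elim(2) by (simp add: mult_less_0_iff)
      moreover have "0 \<le> \<lfloor>real N * t + sqrt N * y\<rfloor>" using elim(1) by (simp only: zero_le_floor)
      ultimately show ?case using 2 by (simp only: saddle_region_def mem_Collect_eq) simp
    qed
  next
    case 3
    from lower[OF 3(1)] upper[OF 3(2)] show ?thesis
      by eventually_elim (use 3 in \<open>simp only: saddle_region_def * mem_Collect_eq zero_le_floor\<close>, simp)
  qed
qed

text \<open>The sum divided by sqrt N is the integral of a step function with cells of length 1 /
  sqrt N. Inside the range of summation its value at y is that of h N at the mesh point to the left
  of y; this point tends to y but varies with N, so continuous convergence of h is what the
  pointwise limit requires.\<close>

lemma saddle_sum_tendsto_integral:
  fixes h :: "nat \<Rightarrow> real \<Rightarrow> complex" and t :: real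
  assumes t: "0 \<le> t" "t \<le> 1" and h: "continuously_converges h H"
    and bound: "\<forall>\<^sub>F N in sequentially. \<forall>l<N. norm (h N ((real l - real N * t) / sqrt N)) \<le> D * exp (- \<bar>(real l - real N * t) / sqrt N\<bar>)"
  shows "integrable lborel (\<lambda>y. indicator (saddle_region t) y *\<^sub>R H y)"
    and "(\<lambda>N. (\<Sum>l<N. h N ((real l - real N * t) / sqrt N)) / complex_of_real (sqrt N))
      \<longlonglongrightarrow> (\<integral>y. indicator (saddle_region t) y *\<^sub>R H y \<partial>lborel)"
proof -
  define J where "J N l = {(real l - real N * t) / sqrt N ..< (real (Suc l) - real N * t) / sqrt N}" for N l :: nat
  define E where "E N y = (\<Sum>l<N. indicator (J N l) y *\<^sub>R h N ((real l - real N * t) / sqrt N))" for N y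
  have J: "y \<in> J N l \<longleftrightarrow> int l = \<lfloor>real N * t + sqrt N * y\<rfloor>" if "N > 0" for N l y
  proof -
    have "y \<in> J N l \<longleftrightarrow> real l \<le> real N * t + sqrt N * y \<and> real N * t + sqrt N * y < real l + 1"
      using that by (auto simp: J_def pos_divide_le_eq pos_less_divide_eq algebra_simps)
    also have "\<dots> \<longleftrightarrow> int l = \<lfloor>real N * t + sqrt N * y\<rfloor>" by linarith
    finally show ?thesis .
  qed
  have E_in: "E N y = h N ((of_int \<lfloor>real N * t + sqrt N * y\<rfloor> - real N * t) / sqrt N)"
    if N: "N > 0" and i: "0 \<le> \<lfloor>real N * t + sqrt N * y\<rfloor>" "\<lfloor>real N * t + sqrt N * y\<rfloor> < int N" for N y
  proof -
    define l where "l = nat \<lfloor>real N * t + sqrt N * y\<rfloor>"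
    have l: "l < N" "int l = \<lfloor>real N * t + sqrt N * y\<rfloor>" using i unfolding l_def by linarith+
    have "E N y = (\<Sum>k\<in>{l}. indicator (J N k) y *\<^sub>R h N ((real k - real N * t) / sqrt N))"
      unfolding E_def using l by (intro sum.mono_neutral_right) (auto simp: J[OF N] indicator_def)
    also have "\<dots> = h N ((real l - real N * t) / sqrt N)"
      using l by (simp add: J[OF N] indicator_def)
    also have "real l = of_int \<lfloor>real N * t + sqrt N * y\<rfloor>" using l(2) by (metis of_int_of_nat_eq)
    finally show ?thesis .
  qed
  have E_out: "E N y = 0"
    if N: "N > 0" and i: "\<not> (0 \<le> \<lfloor>real N * t + sqrt N * y\<rfloor> \<and> \<lfloor>real N * t + sqrt N * y\<rfloor> < int N)" for N y
    unfolding E_def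
  proof (rule sum.neutral, rule ballI)
    fix l assume "l \<in> {..<N}"
    then have "y \<notin> J N l" unfolding J[OF N] using i by (metis lessThan_iff of_nat_0_le_iff of_nat_less_iff)
    then show "indicator (J N l) y *\<^sub>R h N ((real l - real N * t) / sqrt N) = 0" by simp
  qed
  have lim: "(\<lambda>N. E N y) \<longlonglongrightarrow> indicator (saddle_region t) y *\<^sub>R H y" for y
  proof (cases "y \<in> saddle_region t")
    case True
    have "(\<lambda>N. h N ((of_int \<lfloor>real N * t + sqrt N * y\<rfloor> - real N * t) / sqrt N)) \<longlonglongrightarrow> H y"
      by (rule continuously_convergesD[OF h floor_mesh_tendsto])
    moreover have "\<forall>\<^sub>F N in sequentially. h N ((of_int \<lfloor>real N * t + sqrt N * y\<rfloor> - real N * t) / sqrt N) = E N y"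
      using saddle_region_eventually[OF t, of y] eventually_gt_at_top[of 0]
      by eventually_elim (use True in \<open>simp add: E_in\<close>)
    ultimately show ?thesis using True by (simp add: Lim_transform_eventually)
  next
    case False
    have "\<forall>\<^sub>F N in sequentially. E N y = 0"
      using saddle_region_eventually[OF t, of y] eventually_gt_at_top[of 0]
      by eventually_elim (use False in \<open>simp add: E_out\<close>)
    then show ?thesis using False by (simp add: tendsto_eventually)
  qed
  have meas: "E N \<in> borel_measurable lborel" for N
    unfolding E_def J_def by measurable
  \<comment> \<open>The factor e pays for passing from the mesh point to y, a distance of at most
    1.\<close>
  have w: "integrable lborel (\<lambda>y. \<bar>D\<bar> * exp 1 * exp (- 1 * \<bar>y\<bar>))"
    by (intro integrable_mult_right integrable_exp_abs) simp
  have b: "\<forall>\<^sub>F N in sequentially. \<forall>y. norm (E N y) \<le> \<bar>D\<bar> * exp 1 * exp (- 1 * \<bar>y\<bar>)"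
    using bound eventually_gt_at_top[of 0]
  proof eventually_elim
    case (elim N)
    show ?case
    proof
      fix y
      let ?i = "\<lfloor>real N * t + sqrt N * y\<rfloor>"
      show "norm (E N y) \<le> \<bar>D\<bar> * exp 1 * exp (- 1 * \<bar>y\<bar>)"
      proof (cases "0 \<le> ?i \<and> ?i < int N")
        case False
        then show ?thesis using E_out[OF elim(2)] by simp
      next
        case True
        define l where "l = nat ?i"
        have l: "l < N" "real l = of_int ?i" using True unfolding l_def by (linarith, simp)
        define q where "q = (real l - real N * t) / sqrt N"
        have "\<bar>q - y\<bar> \<le> 1"
        proof -
          have "sqrt N * (q - y) = of_int ?i - (real N * t + sqrt N * y)"
            using elim(2) l by (simp add: q_def field_simps)
          then have "\<bar>sqrt N * (q - y)\<bar> \<le> 1" by linarith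
          then have "sqrt N * \<bar>q - y\<bar> \<le> 1" by (simp add: abs_mult)
          moreover have "\<bar>q - y\<bar> \<le> sqrt N * \<bar>q - y\<bar>"
            using elim(2) by (intro mult_le_cancel_right1[THEN iffD2]) auto
          ultimately show ?thesis by linarith
        qed
        then have "exp (- \<bar>q\<bar>) \<le> exp (1 + - 1 * \<bar>y\<bar>)" by simp
        have "norm (E N y) \<le> D * exp (- \<bar>q\<bar>)"
        proof -
          have "E N y = h N q" unfolding q_def l(2) using True by (intro E_in elim(2)) auto
          then show ?thesis using elim(1) l(1) unfolding q_def by metis
        qed
        also have "\<dots> \<le> \<bar>D\<bar> * exp (1 + - 1 * \<bar>y\<bar>)"
          using \<open>exp (- \<bar>q\<bar>) \<le> _\<close> by (intro mult_mono) auto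
        finally show ?thesis by (simp only: exp_add mult.assoc)
      qed
    qed
  qed
  show "integrable lborel (\<lambda>y. indicator (saddle_region t) y *\<^sub>R H y)"
    by (rule dominated_convergence_eventually(1)[OF meas w lim b])
  have "(\<lambda>N. integral\<^sup>L lborel (E N)) \<longlonglongrightarrow> (\<integral>y. indicator (saddle_region t) y *\<^sub>R H y \<partial>lborel)"
    by (rule dominated_convergence_eventually(2)[OF meas w lim b])
  moreover have "\<forall>\<^sub>F N in sequentially. integral\<^sup>L lborel (E N) =
      (\<Sum>l<N. h N ((real l - real N * t) / sqrt N)) / complex_of_real (sqrt N)"
    using eventually_gt_at_top[of 0]
  proof eventually_elim
    case (elim N)
    have "integral\<^sup>L lborel (E N) = (\<Sum>l<N. measure lborel (J N l) *\<^sub>R h N ((real l - real N * t) / sqrt N))"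
    proof -
      have int: "integrable lborel (indicator (J N l) :: real \<Rightarrow> real)" for l
        unfolding J_def by (rule integrable_real_indicator) (simp, rule emeasure_bounded_finite[OF bounded_Ico])
      have "integral\<^sup>L lborel (E N) = (\<Sum>l<N. \<integral>y. indicator (J N l) y *\<^sub>R h N ((real l - real N * t) / sqrt N) \<partial>lborel)"
        unfolding E_def by (rule Bochner_Integration.integral_sum) (intro integrable_scaleR_left int)
      also have "\<dots> = (\<Sum>l<N. measure lborel (J N l) *\<^sub>R h N ((real l - real N * t) / sqrt N))"
        by (subst integral_scaleR_left) (simp_all add: int)
      finally show ?thesis .
    qed
    also have "\<dots> = (\<Sum>l<N. (1 / sqrt N) *\<^sub>R h N ((real l - real N * t) / sqrt N))"
    proof (rule sum.cong)
      fix l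
      have "measure lborel (J N l) = (real (Suc l) - real N * t) / sqrt N - (real l - real N * t) / sqrt N"
        unfolding J_def using elim by (intro measure_lborel_Ico divide_right_mono) auto
      also have "\<dots> = 1 / sqrt N" by (simp add: diff_divide_distrib[symmetric])
      finally show "measure lborel (J N l) *\<^sub>R h N ((real l - real N * t) / sqrt N) = (1 / sqrt N) *\<^sub>R h N ((real l - real N * t) / sqrt N)"
        by simp
    qed simp
    also have "\<dots> = (\<Sum>l<N. h N ((real l - real N * t) / sqrt N)) / complex_of_real (sqrt N)"
      unfolding scaleR_sum_right[symmetric] by (simp add: scaleR_conv_of_real)
    finally show ?case .
  qed
  ultimately show "(\<lambda>N. (\<Sum>l<N. h N ((real l - real N * t) / sqrt N)) / complex_of_real (sqrt N))
      \<longlonglongrightarrow> (\<integral>y. indicator (saddle_region t) y *\<^sub>R H y \<partial>lborel)"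
    by (rule Lim_transform_eventually)
qed

section \<open>The complex error function\<close>

lemma cerf_has_field_derivative:
  "(cerf has_field_derivative complex_of_real (2 / sqrt pi) * exp (- z\<^sup>2)) (at z)"
proof -
  have "(\<lambda>z::complex. exp (- z\<^sup>2)) holomorphic_on UNIV" by (intro holomorphic_intros)
  \<comment> \<open>A global primitive of the entire integrand turns the contour integral into a
    difference of endpoint values.\<close>
  then obtain g where g: "\<And>z::complex. (g has_field_derivative exp (- z\<^sup>2)) (at z)"
    using holomorphic_convex_primitive'[OF convex_UNIV open_UNIV] by (metis UNIV_I)
  have "cerf z = complex_of_real (2 / sqrt pi) * (g z - g 0)" for z
  proof -
    have "((\<lambda>t. exp (- t\<^sup>2)) has_contour_integral (g (pathfinish (linepath 0 z)) - g (pathstart (linepath 0 z)))) (linepath 0 z)"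
      by (rule contour_integral_primitive[of UNIV, OF _ valid_path_linepath subset_UNIV]) (use g in simp)
    then show ?thesis unfolding cerf_def by (simp add: contour_integral_unique)
  qed
  then have "cerf = (\<lambda>z. complex_of_real (2 / sqrt pi) * (g z - g 0))" by (rule ext)
  moreover have "((\<lambda>z. complex_of_real (2 / sqrt pi) * (g z - g 0)) has_field_derivative
      complex_of_real (2 / sqrt pi) * (exp (- z\<^sup>2) - 0)) (at z)"
    by (intro DERIV_cmult DERIV_diff g DERIV_const)
  ultimately show ?thesis by simp
qed

lemma cerf_0 [simp]: "cerf 0 = 0"
  by (simp add: cerf_def)

text \<open>The derivatives of cerf(-z) and cerf(z) cancel. Oddness gives cerfc(-w) + cerfc(w) = 2,
  from which the bulk constant arises.\<close>

lemma cerf_minus: "cerf (- z) = - cerf z"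
proof -
  have "\<exists>c. \<forall>z\<in>UNIV. cerf (- z) + cerf z = c"
  proof (rule has_field_derivative_zero_constant)
    fix z :: complex
    have "((\<lambda>z. cerf (- z)) has_field_derivative complex_of_real (2 / sqrt pi) * exp (- (- z)\<^sup>2) * (- 1)) (at z)"
      by (rule DERIV_chain2[OF cerf_has_field_derivative]) (auto intro!: derivative_eq_intros)
    from DERIV_add[OF this cerf_has_field_derivative[of z]]
    show "((\<lambda>z. cerf (- z) + cerf z) has_field_derivative 0) (at z within UNIV)" by simp
  qed simp
  then obtain c where "\<And>z. cerf (- z) + cerf z = c" by auto
  from this[of z] this[of 0] show ?thesis by (simp add: eq_neg_iff_add_eq_0)
qed

lemma has_vector_derivative_cerf_affine:
  fixes \<kappa> :: real and w :: complex
  shows "((\<lambda>x. cerf (of_real (\<kappa> * x) + w)) has_vector_derivative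
      of_real (2 * \<kappa> / sqrt pi) * exp (- (of_real (\<kappa> * x) + w)\<^sup>2)) (at x within A)"
proof -
  have "((\<lambda>x. of_real (\<kappa> * x) + w) has_vector_derivative of_real \<kappa>) (at x)"
    by (auto intro!: derivative_eq_intros)
  from field_vector_diff_chain_at[OF this cerf_has_field_derivative]
  have "((\<lambda>x. cerf (of_real (\<kappa> * x) + w)) has_vector_derivative
      of_real \<kappa> * (of_real (2 / sqrt pi) * exp (- (of_real (\<kappa> * x) + w)\<^sup>2))) (at x)"
    by (simp add: o_def)
  then show ?thesis by (simp add: has_vector_derivative_at_within mult_ac)
qed

lemma cerf_of_real_tendsto:
  assumes \<kappa>: "\<kappa> > 0"
  shows "(\<lambda>n. cerf (of_real (\<kappa> * real n))) \<longlonglongrightarrow> 1"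
proof -
  have fin: "has_bochner_integral lborel (\<lambda>x. indicator {0..\<kappa> * real n} x *\<^sub>R (complex_of_real (2 / sqrt pi) * exp (- (complex_of_real x)\<^sup>2)))
      (cerf (of_real (\<kappa> * real n)) - cerf (of_real 0))" for n
  proof (rule has_bochner_integral_FTC_Icc)
    fix x :: real
    show "((\<lambda>x. cerf (of_real x)) has_vector_derivative complex_of_real (2 / sqrt pi) * exp (- (complex_of_real x)\<^sup>2)) (at x within {0..\<kappa> * real n})"
      using has_vector_derivative_cerf_affine[of 1 0 x] by simp
  qed (use \<kappa> in \<open>auto intro!: continuous_intros\<close>)
  have eq: "cerf (of_real (\<kappa> * real n)) = (\<integral>x. indicator {0..\<kappa> * real n} x *\<^sub>R (complex_of_real (2 / sqrt pi) * exp (- (complex_of_real x)\<^sup>2)) \<partial>lborel)" for n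
    using has_bochner_integral_integral_eq[OF fin[of n]] by simp
  have ex: "indicator A x *\<^sub>R (complex_of_real (2 / sqrt pi) * exp (- (complex_of_real x)\<^sup>2)) =
      complex_of_real (2 / sqrt pi * (indicator A x * exp (- x\<^sup>2)))" for A :: "real set" and x
  proof -
    have "exp (- (complex_of_real x)\<^sup>2) = complex_of_real (exp (- x\<^sup>2))" by (simp add: exp_of_real[symmetric])
    then show ?thesis by (simp add: scaleR_conv_of_real)
  qed
  have G: "has_bochner_integral lborel (\<lambda>x::real. indicator {0..} x * exp (- x\<^sup>2)) (sqrt pi / 2)"
    using gaussian_moment_0 by simp
  have "(\<lambda>n. \<integral>x. indicator {0..\<kappa> * real n} x * exp (- x\<^sup>2) \<partial>lborel) \<longlonglongrightarrow> (\<integral>x. indicator {0..} x * exp (- (x::real)\<^sup>2) \<partial>lborel)"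
  proof (rule dominated_convergence_eventually(2)[where w = "\<lambda>x::real. indicator {0..} x * exp (- x\<^sup>2)"])
    show "integrable lborel (\<lambda>x::real. indicator {0..} x * exp (- x\<^sup>2))" using G by (rule integrable.intros)
    show "(\<lambda>n. indicator {0..\<kappa> * real n} x * exp (- x\<^sup>2)) \<longlonglongrightarrow> indicator {0..} x * exp (- x\<^sup>2)" for x :: real
    proof (rule tendsto_eventually)
      have "\<forall>\<^sub>F n in sequentially. x \<le> \<kappa> * real n" using \<kappa> by real_asymp
      then show "\<forall>\<^sub>F n in sequentially. indicator {0..\<kappa> * real n} x * exp (- x\<^sup>2) = indicator {0..} x * exp (- x\<^sup>2)"
        by eventually_elim (auto simp: indicator_def)
    qed
  qed (auto simp: indicator_def)
  then have "(\<lambda>n. \<integral>x. indicator {0..\<kappa> * real n} x * exp (- x\<^sup>2) \<partial>lborel) \<longlonglongrightarrow> sqrt pi / 2"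
    using has_bochner_integral_integral_eq[OF G] by simp
  then have "(\<lambda>n. complex_of_real (2 / sqrt pi * (\<integral>x. indicator {0..\<kappa> * real n} x * exp (- x\<^sup>2) \<partial>lborel))) \<longlonglongrightarrow> complex_of_real (2 / sqrt pi * (sqrt pi / 2))"
    by (intro tendsto_intros)
  moreover have "2 / sqrt pi * (sqrt pi / 2) = 1" by simp
  moreover have "cerf (of_real (\<kappa> * real n)) = complex_of_real (2 / sqrt pi * (\<integral>x. indicator {0..\<kappa> * real n} x * exp (- x\<^sup>2) \<partial>lborel))" for n
    unfolding eq ex integral_complex_of_real integral_mult_right_zero ..
  ultimately show ?thesis by (simp only: of_real_1)
qed

text \<open>Mean value bound on the disc of radius |w| around x, where Re(z^2) \<ge> (x - |w|)^2 -
  |w|^2 makes the derivative of \<open>cerf\<close> exponentially small for large x. It carries the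
  limit at infinity from the real axis to a horizontal line through w.\<close>

lemma cerf_shift_bound:
  assumes "cmod w \<le> x"
  shows "cmod (cerf (of_real x + w) - cerf (of_real x))
    \<le> 2 / sqrt pi * exp ((cmod w)\<^sup>2 - (x - cmod w)\<^sup>2) * cmod w"
proof -
  let ?B = "2 / sqrt pi * exp ((cmod w)\<^sup>2 - (x - cmod w)\<^sup>2)"
  have "cmod (cerf (of_real x + w) - cerf (of_real x)) \<le> ?B * cmod (of_real x + w - of_real x)"
  proof (rule field_differentiable_bound[where S = "cball (of_real x) (cmod w)"])
    fix z :: complex assume z: "z \<in> cball (of_real x) (cmod w)"
    show "(cerf has_field_derivative complex_of_real (2 / sqrt pi) * exp (- z\<^sup>2)) (at z within cball (of_real x) (cmod w))"
      by (rule has_field_derivative_at_within[OF cerf_has_field_derivative])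
    have zx: "cmod (z - of_real x) \<le> cmod w" using z by (simp add: dist_norm norm_minus_commute)
    have "\<bar>Re z - x\<bar> \<le> cmod w" "\<bar>Im z\<bar> \<le> cmod w"
      using abs_Re_le_cmod[of "z - of_real x"] abs_Im_le_cmod[of "z - of_real x"] zx by auto
    then have "(x - cmod w)\<^sup>2 \<le> (Re z)\<^sup>2" "(Im z)\<^sup>2 \<le> (cmod w)\<^sup>2"
      using assms by (auto intro!: power_mono simp: abs_le_square_iff[symmetric])
    then have "- Re (z\<^sup>2) \<le> (cmod w)\<^sup>2 - (x - cmod w)\<^sup>2"
      by (simp add: power2_eq_square)
    then show "cmod (complex_of_real (2 / sqrt pi) * exp (- z\<^sup>2)) \<le> ?B"
      by (simp add: norm_mult norm_divide divide_right_mono)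
  qed (auto simp: dist_norm)
  then show ?thesis by simp
qed

lemma cerf_shift_tendsto:
  fixes \<kappa> :: real
  assumes \<kappa>: "\<kappa> > 0"
  shows "(\<lambda>n. cerf (of_real (\<kappa> * real n) + w)) \<longlonglongrightarrow> 1"
proof -
  have "(\<lambda>n. cerf (of_real (\<kappa> * real n) + w) - cerf (of_real (\<kappa> * real n))) \<longlonglongrightarrow> 0"
  proof (rule Lim_null_comparison)
    have "\<forall>\<^sub>F n in sequentially. cmod w \<le> \<kappa> * real n" using \<kappa> by real_asymp
    then show "\<forall>\<^sub>F n in sequentially. cmod (cerf (of_real (\<kappa> * real n) + w) - cerf (of_real (\<kappa> * real n)))
        \<le> 2 / sqrt pi * exp ((cmod w)\<^sup>2 - (\<kappa> * real n - cmod w)\<^sup>2) * cmod w"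
      by eventually_elim (rule cerf_shift_bound)
    show "(\<lambda>n. 2 / sqrt pi * exp ((cmod w)\<^sup>2 - (\<kappa> * real n - cmod w)\<^sup>2) * cmod w) \<longlonglongrightarrow> 0"
      using \<kappa> by real_asymp
  qed
  from tendsto_add[OF this cerf_of_real_tendsto[OF \<kappa>]] show ?thesis by simp
qed

text \<open>Completing the square shows that \<open>?C * cerf (of_real (\<kappa> * y) + ?w)\<close>
  is a primitive of the integrand. The upper limit runs through the integers, where the shifted
  error function tends to 1.\<close>

lemma integral_gaussian_half_line:
  fixes \<kappa> :: real and c :: complex
  assumes \<kappa>: "\<kappa> > 0"
    and int: "integrable lborel (\<lambda>y. indicator {0..} y *\<^sub>R exp (- complex_of_real (\<kappa>\<^sup>2 * y\<^sup>2) + c * of_real y))"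
  shows "(\<integral>y. indicator {0..} y *\<^sub>R exp (- complex_of_real (\<kappa>\<^sup>2 * y\<^sup>2) + c * of_real y) \<partial>lborel)
    = of_real (sqrt pi / (2 * \<kappa>)) * exp (c\<^sup>2 / of_real (4 * \<kappa>\<^sup>2)) * cerfc (- (c / of_real (2 * \<kappa>)))"
    (is "?I = ?C * cerfc ?w")
proof -
  let ?H = "\<lambda>y. exp (- complex_of_real (\<kappa>\<^sup>2 * y\<^sup>2) + c * of_real y)"
  have fin: "has_bochner_integral lborel (\<lambda>y. indicator {0..real n} y *\<^sub>R ?H y)
      (?C * cerf (of_real (\<kappa> * real n) + ?w) - ?C * cerf (of_real (\<kappa> * 0) + ?w))" for n
  proof (rule has_bochner_integral_FTC_Icc)
    fix y :: real
    have "((\<lambda>x. ?C * cerf (of_real (\<kappa> * x) + ?w)) has_vector_derivative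
       ?C * (of_real (2 * \<kappa> / sqrt pi) * exp (- (of_real (\<kappa> * y) + ?w)\<^sup>2))) (at y within {0..real n})"
      by (intro has_vector_derivative_mult_right has_vector_derivative_cerf_affine)
    moreover have "?C * (of_real (2 * \<kappa> / sqrt pi) * exp (- (of_real (\<kappa> * y) + ?w)\<^sup>2)) = ?H y"
    proof -
      have "of_real (sqrt pi / (2 * \<kappa>)) * of_real (2 * \<kappa> / sqrt pi) = (1::complex)"
        using \<kappa> by (simp flip: of_real_mult)
      moreover have "exp (c\<^sup>2 / of_real (4 * \<kappa>\<^sup>2)) * exp (- (of_real (\<kappa> * y) + ?w)\<^sup>2) = ?H y"
        unfolding exp_add[symmetric] using \<kappa> by (intro arg_cong[of _ _ exp]) (simp add: field_simps power2_eq_square)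
      moreover have "A * B * (D * E) = (A * D) * (B * E)" for A B D E :: complex by simp
      ultimately show ?thesis by (simp only: mult_1)
    qed
    ultimately show "((\<lambda>x. ?C * cerf (of_real (\<kappa> * x) + ?w)) has_vector_derivative ?H y) (at y within {0..real n})"
      by simp
  qed (auto intro!: continuous_intros)
  have "(\<lambda>n. \<integral>y. indicator {0..real n} y *\<^sub>R ?H y \<partial>lborel) \<longlonglongrightarrow> ?I"
  proof (rule dominated_convergence_eventually(2)[where w = "\<lambda>y. norm (indicator {0..} y *\<^sub>R ?H y)"])
    show "integrable lborel (\<lambda>y. norm (indicator {0..} y *\<^sub>R ?H y))" using int by (rule integrable_norm)
    show "(\<lambda>n. indicator {0..real n} y *\<^sub>R ?H y) \<longlonglongrightarrow> indicator {0..} y *\<^sub>R ?H y" for y :: real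
    proof (rule tendsto_eventually)
      have "\<forall>\<^sub>F n in sequentially. y \<le> real n" by real_asymp
      then show "\<forall>\<^sub>F n in sequentially. indicator {0..real n} y *\<^sub>R ?H y = indicator {0..} y *\<^sub>R ?H y"
        by eventually_elim (auto simp: indicator_def)
    qed
    show "(\<lambda>y. indicator {0..real n} y *\<^sub>R ?H y) \<in> borel_measurable lborel" for n
      using fin[of n] by (rule borel_measurable_has_bochner_integral)
  qed (auto simp: indicator_def)
  moreover have "(\<integral>y. indicator {0..real n} y *\<^sub>R ?H y \<partial>lborel) =
      ?C * cerf (of_real (\<kappa> * real n) + ?w) - ?C * cerf ?w" for n
    using has_bochner_integral_integral_eq[OF fin[of n]] by simp
  moreover have "(\<lambda>n. ?C * cerf (of_real (\<kappa> * real n) + ?w) - ?C * cerf ?w) \<longlonglongrightarrow> ?C * 1 - ?C * cerf ?w"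
    by (intro tendsto_intros cerf_shift_tendsto \<kappa>)
  ultimately have "?I = ?C * 1 - ?C * cerf ?w" by (simp only: LIMSEQ_unique)
  then show ?thesis by (simp only: cerfc_def right_diff_distrib)
qed

lemma integrable_complex_gaussian:
  fixes S :: real and c :: complex
  assumes S: "S > 0"
  shows "integrable lborel (\<lambda>y. exp (- complex_of_real (S * y\<^sup>2 / 2) + c * of_real y))"
proof -
  \<comment> \<open>The modulus of the integrand is a multiple of the normal density with this mean
    and variance 1 / S.\<close>
  define \<mu> where "\<mu> = Re c / S"
  have i: "integrable lborel (\<lambda>y. sqrt (2 * pi / S) * exp (S * \<mu>\<^sup>2 / 2) * normal_density \<mu> (sqrt (1 / S)) y)"
    using S by (intro integrable_mult_right integrable_normal_density) simp
  show ?thesis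
  proof (rule Bochner_Integration.integrable_bound[OF i])
    show "AE y in lborel. norm (exp (- complex_of_real (S * y\<^sup>2 / 2) + c * of_real y))
        \<le> norm (sqrt (2 * pi / S) * exp (S * \<mu>\<^sup>2 / 2) * normal_density \<mu> (sqrt (1 / S)) y)"
    proof (rule AE_I2)
      fix y :: real
      have "- (S * y\<^sup>2 / 2) + Re c * y = S * \<mu>\<^sup>2 / 2 + - (y - \<mu>)\<^sup>2 / (2 * (1 / S))"
        using S by (simp add: \<mu>_def field_simps power2_eq_square)
      then have "exp (- (S * y\<^sup>2 / 2) + Re c * y) = exp (S * \<mu>\<^sup>2 / 2) * exp (- (y - \<mu>)\<^sup>2 / (2 * (1 / S)))"
        by (simp only: exp_add[symmetric])
      then have "norm (exp (- complex_of_real (S * y\<^sup>2 / 2) + c * of_real y)) =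
          sqrt (2 * pi / S) * exp (S * \<mu>\<^sup>2 / 2) * normal_density \<mu> (sqrt (1 / S)) y"
        using S by (simp add: normal_density_def)
      then show "norm (exp (- complex_of_real (S * y\<^sup>2 / 2) + c * of_real y))
        \<le> norm (sqrt (2 * pi / S) * exp (S * \<mu>\<^sup>2 / 2) * normal_density \<mu> (sqrt (1 / S)) y)" by simp
    qed
  qed measurable
qed

text \<open>The three ranges reduce to one half line: the reflection y -> -y changes the sign of c,
  and the whole line is the sum of the two halves.\<close>

lemma integral_gaussian_saddle_region:
  fixes S :: real and c :: complex
  assumes S: "S > 0"
  shows "(\<integral>y. indicator (saddle_region t) y *\<^sub>R exp (- complex_of_real (S * y\<^sup>2 / 2) + c * of_real y) \<partial>lborel)
    = of_real (sqrt (pi / (2 * S))) * exp (c\<^sup>2 / of_real (2 * S)) *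
      (if t = 0 then cerfc (- (c / of_real (sqrt (2 * S)))) else if t = 1 then cerfc (c / of_real (sqrt (2 * S))) else 2)"
proof -
  define \<kappa> where "\<kappa> = sqrt (S / 2)"
  have \<kappa>: "\<kappa> > 0" "\<kappa>\<^sup>2 = S / 2" using S by (auto simp: \<kappa>_def)
  have c1: "2 * \<kappa> = sqrt (2 * S)"
    using \<kappa> S by (intro real_sqrt_unique[symmetric]) (auto simp: power_mult_distrib)
  have c2: "sqrt pi / (2 * \<kappa>) = sqrt (pi / (2 * S))" unfolding c1 by (simp add: real_sqrt_divide)
  have c3: "4 * \<kappa>\<^sup>2 = 2 * S" using \<kappa> by simp
  let ?H = "\<lambda>c y. exp (- complex_of_real (S * y\<^sup>2 / 2) + c * of_real y)"
  let ?C = "of_real (sqrt (pi / (2 * S))) * exp (c\<^sup>2 / of_real (2 * S))"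
  have i: "integrable lborel (\<lambda>y. indicator A y *\<^sub>R ?H c y)" if "A \<in> sets borel" for A c
    using integrable_mult_indicator[OF _ integrable_complex_gaussian[OF S], of A c] that by simp
  have half: "(\<integral>y. indicator {0..} y *\<^sub>R ?H c y \<partial>lborel) =
      of_real (sqrt (pi / (2 * S))) * exp (c\<^sup>2 / of_real (2 * S)) * cerfc (- (c / of_real (sqrt (2 * S))))" for c
  proof -
    have e: "\<kappa>\<^sup>2 * y\<^sup>2 = S * y\<^sup>2 / 2" for y :: real using \<kappa>(2) by simp
    show ?thesis
      using integral_gaussian_half_line[OF \<kappa>(1), of c] i[of "{0..}" c, OF atLeast_borel] unfolding c2 c3 e unfolding c1 by blast
  qed
  have neg: "(\<integral>y. indicator {..<0} y *\<^sub>R ?H c y \<partial>lborel) = ?C * cerfc (c / of_real (sqrt (2 * S)))"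
  proof -
    have "(\<integral>y. indicator {..<0} y *\<^sub>R ?H c y \<partial>lborel) = (\<integral>y. indicator {..<0} (- y) *\<^sub>R ?H c (- y) \<partial>lborel)"
      using lborel_integral_real_affine[of "-1" "\<lambda>y. indicator {..<0} y *\<^sub>R ?H c y" 0] by simp
    also have "\<dots> = (\<integral>y. indicator {0..} y *\<^sub>R ?H (- c) y \<partial>lborel)"
    proof (rule integral_cong_AE)
      have "AE y in lborel. y \<noteq> (0::real)" by (rule AE_lborel_singleton)
      then show "AE y in lborel. indicator {..<0} (- y) *\<^sub>R ?H c (- y) = indicator {0..} y *\<^sub>R ?H (- c) y"
        by eventually_elim (auto simp: indicator_def)
    qed measurable
    finally show ?thesis unfolding half by simp
  qed
  consider "t = 0" | "t = 1" | "t \<noteq> 0" "t \<noteq> 1" by blast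
  then show ?thesis
  proof cases
    case 1
    then have "saddle_region t = {0..}" by (auto simp: saddle_region_def)
    then show ?thesis using 1 half by simp
  next
    case 2
    then have "saddle_region t = {..<0}" by (auto simp: saddle_region_def)
    then show ?thesis using 2 neg by simp
  next
    case 3
    then have "saddle_region t = UNIV" by (auto simp: saddle_region_def)
    moreover have "(\<integral>y. ?H c y \<partial>lborel) = (\<integral>y. indicator {0..} y *\<^sub>R ?H c y + indicator {..<0} y *\<^sub>R ?H c y \<partial>lborel)"
      by (intro Bochner_Integration.integral_cong) (auto simp: indicator_def)
    moreover have "\<dots> = ?C * (cerfc (- (c / of_real (sqrt (2 * S)))) + cerfc (c / of_real (sqrt (2 * S))))"
      unfolding distrib_left half[symmetric] neg[symmetric]
      by (rule Bochner_Integration.integral_add; rule i; simp)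
    moreover have "cerfc (- w) + cerfc w = 2" for w by (simp add: cerfc_def cerf_minus)
    ultimately show ?thesis using 3 by simp
  qed
qed

section \<open>Uniform limits and determinants\<close>

text \<open>If uniformity fails, some fixed e is violated at points of K for infinitely many n. By
  compactness a subsequence of these points converges, which contradicts \<open>conv\<close> and
  continuity of f.\<close>

lemma uniform_limit_if_continuously_converges:
  fixes F :: "nat \<Rightarrow> 'a::metric_space \<Rightarrow> 'b::metric_space"
  assumes K: "compact K" and f: "continuous_on K f"
    and conv: "\<And>X x. (\<And>n. X n \<in> K) \<Longrightarrow> x \<in> K \<Longrightarrow> X \<longlonglongrightarrow> x \<Longrightarrow> (\<lambda>n. F n (X n)) \<longlonglongrightarrow> f x"
  shows "uniform_limit K F f sequentially"
proof (rule ccontr)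
  assume "\<not> uniform_limit K F f sequentially"
  then obtain e where e: "e > 0" "\<And>n0. \<exists>n\<ge>n0. \<exists>x\<in>K. e \<le> dist (F n x) (f x)"
    by (fastforce simp: uniform_limit_sequentially_iff not_less)
  define P where "P n \<longleftrightarrow> (\<exists>x\<in>K. e \<le> dist (F n x) (f x))" for n
  have "infinite {n. P n}"
    unfolding infinite_nat_iff_unbounded_le using e(2) by (auto simp: P_def)
  then obtain r :: "nat \<Rightarrow> nat" where r: "strict_mono r" "\<And>i. P (r i)"
    using infinite_enumerate[of "{n. P n}"] unfolding mem_Collect_eq by blast
  then obtain x where x: "\<And>i. x i \<in> K" "\<And>i. e \<le> dist (F (r i) (x i)) (f (x i))"
    unfolding P_def by metis
  obtain l s where s: "l \<in> K" "strict_mono s" "(x \<circ> s) \<longlonglongrightarrow> l"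
    using K x(1) unfolding compact_def by metis
  define q where "q = r \<circ> s"
  have q: "strict_mono q" unfolding q_def by (rule strict_mono_o[OF r(1) s(2)])
  \<comment> \<open>Indices off the subsequence are filled with the limit l, since
    \<open>conv\<close> speaks of full sequences.\<close>
  define X where "X n = (if n \<in> range q then x (s (inv q n)) else l)" for n
  have Xq: "X (q i) = x (s i)" for i
    using strict_mono_imp_inj_on[OF q] by (simp add: X_def)
  have "X \<longlonglongrightarrow> l"
  proof (rule metric_LIMSEQ_I)
    fix \<epsilon> :: real assume \<epsilon>: "\<epsilon> > 0"
    obtain i0 where i0: "\<And>i. i \<ge> i0 \<Longrightarrow> dist (x (s i)) l < \<epsilon>"
      using s(3) \<epsilon> unfolding lim_sequentially by (auto simp: o_def)
    show "\<exists>n0. \<forall>n\<ge>n0. dist (X n) l < \<epsilon>"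
    proof (intro exI[of _ "q i0"] allI impI)
      fix n assume n: "q i0 \<le> n"
      show "dist (X n) l < \<epsilon>"
      proof (cases "n \<in> range q")
        case True
        then obtain i where i: "n = q i" by blast
        then have "i0 \<le> i" using n strict_mono_less_eq[OF q] by simp
        then show ?thesis using i0 i Xq by simp
      qed (use \<epsilon> in \<open>simp add: X_def\<close>)
    qed
  qed
  moreover have "X n \<in> K" for n using x(1) s(1) by (simp add: X_def)
  ultimately have "(\<lambda>n. F n (X n)) \<longlonglongrightarrow> f l" using conv s(1) by blast
  then have 1: "(\<lambda>i. F (q i) (x (s i))) \<longlonglongrightarrow> f l"
    using LIMSEQ_subseq_LIMSEQ[of "\<lambda>n. F n (X n)", OF _ q] by (simp only: o_def Xq)
  have 2: "(\<lambda>i. f ((x \<circ> s) i)) \<longlonglongrightarrow> f l"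
    using continuous_on_tendsto_compose[OF f s(3) s(1)] x(1) by simp
  then have "(\<lambda>i. dist (F (q i) (x (s i))) (f (x (s i)))) \<longlonglongrightarrow> dist (f l) (f l)"
    using tendsto_dist[OF 1 2] by (simp only: o_def)
  then have "\<forall>\<^sub>F i in sequentially. dist (F (q i) (x (s i))) (f (x (s i))) < e"
    using e(1) by (intro order_tendstoD) auto
  then show False using x(2) unfolding q_def by (auto simp: eventually_sequentially not_le[symmetric])
qed

lemma det_tendsto:
  fixes A :: "'a \<Rightarrow> 'n::finite \<Rightarrow> 'n \<Rightarrow> complex"
  assumes "\<And>i j. ((\<lambda>x. A x i j) \<longlongrightarrow> B i j) F"
  shows "((\<lambda>x. det (\<chi> i j. A x i j)) \<longlongrightarrow> det (\<chi> i j. B i j)) F"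
  unfolding det_def by (auto intro!: tendsto_intros assms)

lemma det_scale:
  fixes A :: "'n::finite \<Rightarrow> 'n \<Rightarrow> complex"
  shows "det (\<chi> i j. k * A i j) = k ^ CARD('n) * det (\<chi> i j. A i j)"
  unfolding det_def by (simp add: prod.distrib sum_distrib_left mult_ac)

text \<open>Each Leibniz term acquires the product of all \<open>c i\<close> divided by the product
  of all \<open>c (p i)\<close>, which is 1 because p permutes the indices.\<close>

lemma det_diagonal_conjugation:
  fixes A :: "'n::finite \<Rightarrow> 'n \<Rightarrow> complex"
  assumes c: "\<And>i. c i \<noteq> 0"
  shows "det (\<chi> i j. c i * A i j / c j) = det (\<chi> i j. A i j)"
  unfolding det_def
proof (rule sum.cong)
  fix p :: "'n \<Rightarrow> 'n" assume "p \<in> {p. p permutes UNIV}"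
  then have p: "p permutes UNIV" by simp
  have "(\<Prod>i\<in>UNIV. c (p i)) = (\<Prod>i\<in>UNIV. c i)"
    using prod.permute[OF p, of c] by (simp add: o_def)
  moreover have "(\<Prod>i\<in>UNIV. c i) \<noteq> 0" using c by simp
  ultimately show "of_int (sign p) * (\<Prod>i\<in>UNIV. (\<chi> i j. c i * A i j / c j) $ i $ p i) =
      of_int (sign p) * (\<Prod>i\<in>UNIV. (\<chi> i j. A i j) $ i $ p i)"
    by (simp add: prod.distrib prod_dividef)
qed simp

section \<open>The rescaled kernel\<close>

text \<open>Converts an additive displacement 1 + q / sqrt N into exp(a / sqrt N) with a -> c. The
  quotient Ln(1 + h) / h is extended by 1 to h = 0, so that indices with q N = 0 are
  covered.\<close>

lemma sqrt_mult_Ln_tendsto: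
  fixes q :: "nat \<Rightarrow> complex"
  assumes q: "q \<longlonglongrightarrow> c"
  shows "(\<lambda>N. of_real (sqrt (real N)) * Ln (1 + q N / of_real (sqrt (real N)))) \<longlonglongrightarrow> c"
    and "(\<lambda>N. q N / of_real (sqrt (real N))) \<longlonglongrightarrow> 0"
proof -
  define g where "g h = (if h = 0 then 1 else Ln (1 + h) / h)" for h :: complex
  define h where "h N = q N / of_real (sqrt (real N))" for N
  have "(Ln has_field_derivative inverse 1) (at (1::complex))"
    by (rule has_field_derivative_Ln) simp
  then have "(\<lambda>h. Ln (1 + h) / h) \<midarrow>0\<rightarrow> (1::complex)"
    by (simp add: DERIV_def)
  then have "(g \<longlongrightarrow> 1) (at 0)"
    by (rule Lim_transform_eventually) (auto simp: eventually_at g_def intro: exI[of _ 1])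
  then have g: "isCont g 0" by (simp add: isCont_def g_def)
  have "(\<lambda>N. of_real (1 / sqrt (real N))) \<longlonglongrightarrow> (of_real 0 :: complex)"
    by (intro tendsto_of_real) real_asymp
  from tendsto_mult[OF q this] show h0: "(\<lambda>N. q N / of_real (sqrt (real N))) \<longlonglongrightarrow> 0"
    by simp
  have "(\<lambda>N. q N * g (h N)) \<longlonglongrightarrow> c * g 0"
    by (intro tendsto_mult q isCont_tendsto_compose[OF g]) (use h0 in \<open>simp add: h_def[abs_def]\<close>)
  moreover have "\<forall>\<^sub>F N in sequentially. q N * g (h N) =
      of_real (sqrt (real N)) * Ln (1 + q N / of_real (sqrt (real N)))"
    using eventually_gt_at_top[of 0]
  proof eventually_elim
    case (elim N)
    then show ?case by (cases "q N = 0") (simp_all add: g_def h_def)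
  qed
  ultimately have "(\<lambda>N. of_real (sqrt (real N)) * Ln (1 + q N / of_real (sqrt (real N)))) \<longlonglongrightarrow> c * g 0"
    by (rule Lim_transform_eventually)
  then show "(\<lambda>N. of_real (sqrt (real N)) * Ln (1 + q N / of_real (sqrt (real N)))) \<longlonglongrightarrow> c"
    by (simp add: g_def)
qed

text \<open>Between the edges the value 2 is the sum of the two edge values. Thus one formula serves
  all three regimes, with 1 / (2 pi) turning into 1 / pi in the bulk.\<close>

definition boundary_erfc :: "real \<Rightarrow> complex \<Rightarrow> complex" where
  "boundary_erfc t w = (if t = 0 then cerfc (- w) else if t = 1 then cerfc w else 2)"

text \<open>The parameter e stands for the direction u / |u|.\<close>

definition edge_kernel :: "real \<Rightarrow> complex \<Rightarrow> complex \<Rightarrow> complex \<Rightarrow> complex" where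
  "edge_kernel t e v w = of_real (1 / (2 * pi)) * gauss_factor v w *
     boundary_erfc t ((e * cnj w + v * cnj e) / of_real (sqrt 2))"

text \<open>
  The parameters carry a copy of index \<open>m\<close> at index \<open>0\<close>, because the factor of index \<open>m\<close> is the
  starting point of the iterated convolution.
\<close>

locale saddle_data =
  fixes m j :: nat and \<sigma> \<tau> b :: "nat \<Rightarrow> real" and u :: complex and t :: real
  assumes m: "m = Suc j" and t: "0 \<le> t" "t \<le> 1"
    and p: "\<And>k. \<sigma> k + t > 0" and \<tau>: "\<And>k. \<tau> k > 0" and u: "u \<noteq> 0"
    and zero: "\<sigma> 0 = \<sigma> m" "\<tau> 0 = \<tau> m" "b 0 = b m"
    and saddle: "(\<Prod>k\<in>{1..m}. \<sigma> k + t) = (cmod u)\<^sup>2 * (\<Prod>k\<in>{1..m}. \<sigma> k + \<tau> k + t)"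
    and \<alpha>: "\<forall>\<^sub>F N :: nat in sequentially. \<forall>k\<in>{1..m}. \<sigma> k * real N + b k > -1"
begin

definition total_var :: real where
  "total_var = (\<Sum>k\<in>{1..m}. saddle_var (\<sigma> k + t) (\<tau> k))"

text \<open>Apart from explicit factors, the weight as a function of sqrt N ln(|z|^2 /
  |u|^2).\<close>

definition radial_density :: "nat \<Rightarrow> real \<Rightarrow> real" where
  "radial_density N = conv_iter (\<lambda>k. profile (\<sigma> k + t) (\<tau> k) (b k) N) (profile (\<sigma> m + t) (\<tau> m) (b m) N) j"

definition mgf_prod :: "nat \<Rightarrow> real \<Rightarrow> real" where
  "mgf_prod N l = (\<Prod>k\<in>{1..m}. profile_mgf (\<sigma> k + t) (\<tau> k) (b k) N l)"

text \<open>The l-th term of the kernel sum at y = (l - tN) / sqrt N, stripped of explicit factors;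
  the shift by 1 / sqrt N is the Jacobian shift in \<open>profile_moment_Beta\<close>.\<close>

definition summand :: "nat \<Rightarrow> complex \<Rightarrow> real \<Rightarrow> complex" where
  "summand N c y = exp (c * of_real y) / of_real (mgf_prod N (y + 1 / sqrt N))"

text \<open>Gathers what holds only for large N, so that the identities below can be stated exactly
  for a single N.\<close>

definition regular :: "nat \<Rightarrow> bool" where
  "regular N \<longleftrightarrow> N > 0 \<and> (\<forall>k\<in>{1..m}. \<sigma> k * real N + b k > -1) \<and>
     (\<forall>i\<in>{..<j}. \<forall>x. integrable lborel (\<lambda>y. profile (\<sigma> (Suc i) + t) (\<tau> (Suc i)) (b (Suc i)) N y *
        conv_iter (\<lambda>k. profile (\<sigma> k + t) (\<tau> k) (b k) N) (profile (\<sigma> m + t) (\<tau> m) (b m) N) i (x - y)))"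

lemma total_var_pos: "total_var > 0"
  unfolding total_var_def using m by (intro sum_pos saddle_var_pos p \<tau>) auto

lemma radial_density_converges: "continuously_converges radial_density (normal_density 0 (sqrt total_var))"
proof -
  let ?v = "\<lambda>k. saddle_var (\<sigma> k + t) (\<tau> k)"
  have I: "{..j} = insert 0 {1..j}" "{1..m} = insert m {1..j}" using m by auto
  have "(\<Sum>k\<le>j. ?v k) = ?v 0 + (\<Sum>k\<in>{1..j}. ?v k)" unfolding I(1) by simp
  also have "\<dots> = total_var" unfolding total_var_def I(2) using m by (simp add: zero)
  finally have "(\<Sum>k\<le>j. saddle_var (\<sigma> k + t) (\<tau> k)) = total_var" .
  moreover have "radial_density = (\<lambda>N. conv_iter (\<lambda>k. profile (\<sigma> k + t) (\<tau> k) (b k) N) (profile (\<sigma> 0 + t) (\<tau> 0) (b 0) N) j)"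
    by (simp add: radial_density_def fun_eq_iff zero)
  ultimately show ?thesis
    using conv_iter_profile_asymptotics[of "\<lambda>k. \<sigma> k + t" \<tau> b j] p \<tau> by simp
qed

lemma eventually_regular: "\<forall>\<^sub>F N in sequentially. regular N"
proof -
  have "\<forall>\<^sub>F N in sequentially. \<forall>i\<in>{..<j}. \<forall>x. integrable lborel (\<lambda>y. profile (\<sigma> (Suc i) + t) (\<tau> (Suc i)) (b (Suc i)) N y *
        conv_iter (\<lambda>k. profile (\<sigma> k + t) (\<tau> k) (b k) N) (profile (\<sigma> 0 + t) (\<tau> 0) (b 0) N) i (x - y))"
    using conv_iter_profile_asymptotics[of "\<lambda>k. \<sigma> k + t" \<tau> b] p \<tau>
    by (intro eventually_ball_finite) auto
  with \<alpha> eventually_gt_at_top[of 0] show ?thesis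
    by eventually_elim (simp add: regular_def zero)
qed

text \<open>The saddle equation in terms of the peaks: it centres the combined weight at |z| = |u|
  and lets powers of the individual peaks combine to powers of |u|.\<close>

lemma prod_saddle_pt: "(\<Prod>k\<in>{1..m}. saddle_pt (\<sigma> k + t) (\<tau> k)) = (cmod u)\<^sup>2"
proof -
  have "(\<Prod>k\<in>{1..m}. \<sigma> k + \<tau> k + t) \<noteq> 0"
  proof -
    have "\<sigma> k + \<tau> k + t \<noteq> 0" for k using p[of k] \<tau>[of k] by linarith
    then show ?thesis by simp
  qed
  moreover have "(\<Prod>k\<in>{1..m}. saddle_pt (\<sigma> k + t) (\<tau> k)) = (\<Prod>k\<in>{1..m}. \<sigma> k + t) / (\<Prod>k\<in>{1..m}. \<sigma> k + \<tau> k + t)"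
    unfolding saddle_pt_def prod_dividef by (simp add: add_ac)
  ultimately show ?thesis unfolding saddle by simp
qed

lemma mesh_identity:
  assumes "N > 0"
  shows "sqrt N * ((real l - real N * t) / sqrt N) = real l - t * real N"
  using assms by simp

lemma regular_integrable:
  assumes N: "regular N" and k: "k \<in> {1..m}"
  shows "integrable lborel (\<lambda>x. profile (\<sigma> k + t) (\<tau> k) (b k) N x * exp (((real l - real N * t) / sqrt N + 1 / sqrt N) * x))"
    and "profile_mgf (\<sigma> k + t) (\<tau> k) (b k) N ((real l - real N * t) / sqrt N + 1 / sqrt N) > 0"
    and "1 / Beta (\<sigma> k * N + b k + real l + 1) (\<tau> k * N + 1) =
      sqrt N / (profile_const (\<sigma> k + t) (\<tau> k) (b k) N * saddle_pt (\<sigma> k + t) (\<tau> k) powr (real l - t * N + 1))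
      / profile_mgf (\<sigma> k + t) (\<tau> k) (b k) N ((real l - real N * t) / sqrt N + 1 / sqrt N)"
proof -
  have N0: "N > 0" using N by (simp add: regular_def)
  \<comment> \<open>With y = (l - tN) / sqrt N the tilt cancels: the moment of order l - tN of the
    tilted density is the l-th moment of the original one.\<close>
  have e: "(\<sigma> k + t) * N + b k + sqrt N * ((real l - real N * t) / sqrt N) + 1 = \<sigma> k * N + b k + real l + 1"
    unfolding mesh_identity[OF N0] by (simp add: algebra_simps)
  have pos: "0 < (\<sigma> k + t) * N + b k + sqrt N * ((real l - real N * t) / sqrt N) + 1"
    unfolding e using N k by (auto simp: regular_def intro: add_pos_nonneg dest!: bspec[of _ _ k])
  note M = profile_moment_Beta[OF p \<tau> N0 pos]
  show "integrable lborel (\<lambda>x. profile (\<sigma> k + t) (\<tau> k) (b k) N x * exp (((real l - real N * t) / sqrt N + 1 / sqrt N) * x))"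
    by (rule M)
  show "profile_mgf (\<sigma> k + t) (\<tau> k) (b k) N ((real l - real N * t) / sqrt N + 1 / sqrt N) > 0"
    by (rule M)
  have "Beta (\<sigma> k * N + b k + real l + 1) (\<tau> k * N + 1) = profile_const (\<sigma> k + t) (\<tau> k) (b k) N * saddle_pt (\<sigma> k + t) (\<tau> k) powr (real l - t * N + 1)
      / sqrt N * profile_mgf (\<sigma> k + t) (\<tau> k) (b k) N ((real l - real N * t) / sqrt N + 1 / sqrt N)"
    using M(2) unfolding e unfolding mesh_identity[OF N0] .
  then show "1 / Beta (\<sigma> k * N + b k + real l + 1) (\<tau> k * N + 1) =
      sqrt N / (profile_const (\<sigma> k + t) (\<tau> k) (b k) N * saddle_pt (\<sigma> k + t) (\<tau> k) powr (real l - t * N + 1))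
      / profile_mgf (\<sigma> k + t) (\<tau> k) (b k) N ((real l - real N * t) / sqrt N + 1 / sqrt N)"
    by simp
qed

lemma mgf_prod_pos:
  assumes "regular N"
  shows "mgf_prod N ((real l - real N * t) / sqrt N + 1 / sqrt N) > 0"
  unfolding mgf_prod_def by (intro prod_pos regular_integrable(2)[OF assms])

lemma prod_inverse_Beta:
  assumes N: "regular N"
  shows "(\<Prod>k\<in>{1..m}. 1 / Beta (\<sigma> k * N + b k + real l + 1) (\<tau> k * N + 1)) =
    sqrt N ^ m / ((\<Prod>k\<in>{1..m}. profile_const (\<sigma> k + t) (\<tau> k) (b k) N) * (cmod u)\<^sup>2 powr (real l - t * N + 1))
      / mgf_prod N ((real l - real N * t) / sqrt N + 1 / sqrt N)"
proof -
  have "(\<Prod>k\<in>{1..m}. saddle_pt (\<sigma> k + t) (\<tau> k) powr (real l - t * N + 1)) = (cmod u)\<^sup>2 powr (real l - t * N + 1)"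
    unfolding prod_saddle_pt[symmetric] by (rule prod_powr_distrib[symmetric])
  moreover have "(\<Prod>k\<in>{1..m}. 1 / Beta (\<sigma> k * N + b k + real l + 1) (\<tau> k * N + 1)) =
      (\<Prod>k\<in>{1..m}. sqrt N / (profile_const (\<sigma> k + t) (\<tau> k) (b k) N * saddle_pt (\<sigma> k + t) (\<tau> k) powr (real l - t * N + 1))
      / profile_mgf (\<sigma> k + t) (\<tau> k) (b k) N ((real l - real N * t) / sqrt N + 1 / sqrt N))"
    by (intro prod.cong refl regular_integrable(3) N)
  ultimately show ?thesis
    by (simp only: prod_dividef prod.distrib mgf_prod_def prod_constant card_atLeastAtMost) simp
qed

text \<open>The normalisation \<open>G\<close> of the weight stands twice under the square root,
  hence once in the kernel. Together with the prefactor \<open>G'\<close> and the Gamma quotients of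
  \<open>kernel_T\<close> it leaves exactly one reciprocal Beta value for each k and l.\<close>

lemma kernel_K_as_beta_sum:
  assumes N: "regular N"
  defines "P \<equiv> (\<lambda>z. 2 ^ (m - 1) * cmod z powr (2 * \<sigma> m * real N + 2 * b m) *
     (LINT r : PiE {1..<m} (\<lambda>_. {0..1}) | PiM {1..<m} (\<lambda>_. lborel). weight_integrand m \<sigma> \<tau> b N z r))"
  shows "kernel_K m \<sigma> \<tau> b N z z' = of_real (sqrt (P z * P (cnj z')) / pi) *
    (\<Sum>l<N. of_real (\<Prod>k\<in>{1..m}. 1 / Beta (\<sigma> k * N + b k + real l + 1) (\<tau> k * N + 1)) * (z * cnj z') ^ l)"
proof -
  define G where "G = (\<Prod>k\<in>{1..m}. Gamma ((\<sigma> k + \<tau> k) * real N + b k + 2) /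
        (Gamma (\<sigma> k * real N + b k + 1) * Gamma (\<tau> k * real N + 1)))"
  define G' where "G' = (\<Prod>k\<in>{1..m}. Gamma (\<sigma> k * real N + b k + 1) / Gamma ((\<sigma> k + \<tau> k) * real N + b k + 2))"
  have a: "\<sigma> k * real N + b k + 1 > 0" if "k \<in> {1..m}" for k
    using N that by (auto simp: regular_def dest!: bspec[of _ _ k])
  have tN: "\<tau> k * real N \<ge> 0" for k using \<tau>[of k] by simp
  have c: "(\<sigma> k + \<tau> k) * real N + b k + 2 > 0" if "k \<in> {1..m}" for k
    using a[OF that] tN[of k] by (simp add: distrib_right)
  have Gam: "Gamma (\<sigma> k * real N + b k + 1) > 0" "Gamma (\<tau> k * real N + 1) > 0" "Gamma ((\<sigma> k + \<tau> k) * real N + b k + 2) > 0"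
    if "k \<in> {1..m}" for k
    using a[OF that] c[OF that] tN[of k] by (auto intro!: Gamma_real_pos)
  have G: "G > 0" unfolding G_def by (intro prod_pos divide_pos_pos mult_pos_pos Gam)
  have GG: "G * G' * (\<Prod>k\<in>{1..m}. Gamma ((\<sigma> k + \<tau> k) * real N + b k + real l + 2) / Gamma (\<sigma> k * real N + b k + real l + 1)) =
      (\<Prod>k\<in>{1..m}. 1 / Beta (\<sigma> k * N + b k + real l + 1) (\<tau> k * N + 1))" for l
    unfolding G_def G'_def prod.distrib[symmetric]
  proof (rule prod.cong)
    fix k assume k: "k \<in> {1..m}"
    have e: "(\<sigma> k * N + b k + real l + 1) + (\<tau> k * N + 1) = (\<sigma> k + \<tau> k) * real N + b k + real l + 2"
      by (simp add: algebra_simps)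
    show "Gamma ((\<sigma> k + \<tau> k) * real N + b k + 2) / (Gamma (\<sigma> k * real N + b k + 1) * Gamma (\<tau> k * real N + 1)) *
        (Gamma (\<sigma> k * real N + b k + 1) / Gamma ((\<sigma> k + \<tau> k) * real N + b k + 2)) *
        (Gamma ((\<sigma> k + \<tau> k) * real N + b k + real l + 2) / Gamma (\<sigma> k * real N + b k + real l + 1)) =
        1 / Beta (\<sigma> k * real N + b k + real l + 1) (\<tau> k * real N + 1)"
      unfolding Beta_def e using Gam[OF k] by (simp add: divide_simps)
  qed simp
  have W: "weight_w m \<sigma> \<tau> b N w = G / pi * P w" for w
    unfolding weight_w_def G_def[symmetric] P_def by simp
  have "G / pi * P z * (G / pi * P (cnj z')) = (G / pi)\<^sup>2 * (P z * P (cnj z'))"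
    by (simp add: power2_eq_square)
  then have sq: "sqrt (weight_w m \<sigma> \<tau> b N z * weight_w m \<sigma> \<tau> b N (cnj z')) = G * (sqrt (P z * P (cnj z')) / pi)"
    unfolding W using G by (simp add: real_sqrt_mult)
  have "kernel_K m \<sigma> \<tau> b N z z' = of_real (sqrt (P z * P (cnj z')) / pi) *
      (\<Sum>l<N. of_real (G * G' * (\<Prod>k\<in>{1..m}. Gamma ((\<sigma> k + \<tau> k) * real N + b k + real l + 2) / Gamma (\<sigma> k * real N + b k + real l + 1))) * (z * cnj z') ^ l)"
    unfolding kernel_K_def kernel_T_def sq G'_def[symmetric] of_real_mult
    by (simp only: sum_distrib_left mult_ac)
  then show ?thesis unfolding GG .
qed

text \<open>Since |z|^2 = |u|^2 exp(2x / sqrt N), the density is evaluated at 2x. The x-dependent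
  part of |z|^(-2tN), left by the tilt, is written as a square in view of the square root in the
  kernel.\<close>

lemma weight_at_scaled_point:
  assumes N: "regular N" and z: "cmod z = cmod u * exp (x / sqrt N)"
  shows "2 ^ (m - 1) * cmod z powr (2 * \<sigma> m * real N + 2 * b m) *
     (LINT r : PiE {1..<m} (\<lambda>_. {0..1}) | PiM {1..<m} (\<lambda>_. lborel). weight_integrand m \<sigma> \<tau> b N z r) =
     (1 / sqrt N) ^ j * (\<Prod>k\<in>{1..m}. profile_const (\<sigma> k + t) (\<tau> k) (b k) N) *
       (cmod u)\<^sup>2 powr (- (t * N)) * radial_density N (2 * x) * (exp (- (t * sqrt N * x)))\<^sup>2"
proof -
  have N0: "N > 0" using N by (simp add: regular_def)
  have z0: "z \<noteq> 0" using z u by auto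
  have int: "integrable lborel (\<lambda>y. profile (\<sigma> (Suc i) + t) (\<tau> (Suc i)) (b (Suc i)) N y *
        conv_iter (\<lambda>k. profile (\<sigma> k + t) (\<tau> k) (b k) N) (profile (\<sigma> m + t) (\<tau> m) (b m) N) i (x - y))" if "i < j" for i x
    using N that by (simp add: regular_def)
  have z2: "(cmod z)\<^sup>2 = (cmod u)\<^sup>2 * exp (2 * x / sqrt N)"
    unfolding z power_mult_distrib by (simp add: exp_double[symmetric])
  have l: "sqrt N * ln ((cmod z)\<^sup>2 / (\<Prod>k\<in>{1..m}. saddle_pt (\<sigma> k + t) (\<tau> k))) = 2 * x"
    unfolding prod_saddle_pt z2 using u N0 by simp
  have "2 * x / sqrt N * - (t * N) = 2 * - (t * sqrt N * x)"
  proof -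
    have "real N / sqrt N = sqrt N" by (rule real_div_sqrt) simp
    then have "2 * x * t * (real N / sqrt N) = 2 * x * t * sqrt N" by simp
    then show ?thesis by (simp add: mult_ac)
  qed
  then have "exp (2 * x / sqrt N) powr (- (t * N)) = exp (2 * - (t * sqrt N * x))"
    by (simp only: exp_powr_real)
  also have "\<dots> = (exp (- (t * sqrt N * x)))\<^sup>2" by (rule exp_double)
  finally have pw: "(cmod z)\<^sup>2 powr (- (t * N)) = (cmod u)\<^sup>2 powr (- (t * N)) * (exp (- (t * sqrt N * x)))\<^sup>2"
    unfolding z2 by (subst powr_mult) auto
  show ?thesis
    using weight_integral_eq_conv_iter[of z m j N \<sigma> t \<tau> b, OF z0 m N0 p \<tau> int]
    unfolding l pw radial_density_def by (simp only: mult_ac)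
qed

lemma radial_density_nonneg: "radial_density N x \<ge> 0"
  unfolding radial_density_def by (intro conv_iter_nonneg profile_nonneg p \<tau>)

text \<open>The two weights contribute exp(- t sqrt N (Re a + Re a')), and the l-th power
  contributes exp(t sqrt N (a + cnj a')) besides the factor kept in \<open>summand\<close>. The
  product of these exponentials is unimodular and splits into a phase in a divided by a phase in
  a'.\<close>

lemma kernel_K_at_scaled_points:
  assumes N: "regular N" and z: "z = u * exp (a / of_real (sqrt N))" and z': "z' = u * exp (a' / of_real (sqrt N))"
  shows "kernel_K m \<sigma> \<tau> b N z z' = of_real (real N / (pi * (cmod u)\<^sup>2)) *
    (exp (\<i> * of_real (t * sqrt N * Im a)) *
      (of_real (sqrt (radial_density N (2 * Re a) * radial_density N (2 * Re a'))) *
        ((\<Sum>l<N. summand N (a + cnj a') ((real l - real N * t) / sqrt N)) / of_real (sqrt N)))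
    / exp (\<i> * of_real (t * sqrt N * Im a')))"
proof -
  have N0: "N > 0" using N by (simp add: regular_def)
  define s where "s = sqrt (real N)"
  have s: "s > 0" "s * s = real N" using N0 by (auto simp: s_def)
  define K where "K = (\<Prod>k\<in>{1..m}. profile_const (\<sigma> k + t) (\<tau> k) (b k) N)"
  have K: "K > 0" unfolding K_def by (intro prod_pos profile_const_pos p \<tau>)
  define U where "U = (cmod u)\<^sup>2"
  have U: "U > 0" using u by (simp add: U_def)
  define C where "C = (1 / s) ^ j * K * U powr (- (t * N))"
  have C: "C > 0" unfolding C_def using s K U by simp
  define f f' where "f = radial_density N (2 * Re a)" and "f' = radial_density N (2 * Re a')"
  have ff: "f \<ge> 0" "f' \<ge> 0" by (auto simp: f_def f'_def radial_density_nonneg)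
  define E E' where "E = exp (- (t * s * Re a))" and "E' = exp (- (t * s * Re a'))"
  have cz: "cmod z = cmod u * exp (Re a / sqrt N)" "cmod (cnj z') = cmod u * exp (Re a' / sqrt N)"
    by (simp_all add: z z' norm_mult)
  have "sqrt (C * f * E\<^sup>2 * (C * f' * E'\<^sup>2)) = C * (E * E') * sqrt (f * f')"
  proof -
    have "C * f * E\<^sup>2 * (C * f' * E'\<^sup>2) = (C * (E * E'))\<^sup>2 * (f * f')"
      by (simp add: power2_eq_square mult_ac)
    moreover have "C * (E * E') \<ge> 0" using C by (simp add: E_def E'_def)
    ultimately show ?thesis by (simp only: real_sqrt_mult real_sqrt_abs abs_of_nonneg)
  qed
  then have K1: "kernel_K m \<sigma> \<tau> b N z z' = of_real (C * (E * E') * sqrt (f * f') / pi) *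
    (\<Sum>l<N. of_real (s ^ m / (K * U powr (real l - t * N + 1)) / mgf_prod N ((real l - real N * t) / s + 1 / s)) * (z * cnj z') ^ l)"
    unfolding kernel_K_as_beta_sum[OF N] weight_at_scaled_point[OF N cz(1)] weight_at_scaled_point[OF N cz(2)]
      prod_inverse_Beta[OF N] s_def[symmetric] K_def[symmetric] U_def[symmetric] C_def[symmetric]
      f_def[symmetric] f'_def[symmetric] E_def[symmetric] E'_def[symmetric]
    by simp
  define ph where "ph = exp (\<i> * of_real (t * s * Im a)) / exp (\<i> * of_real (t * s * Im a'))"
  have summand_eq: "of_real (C * (E * E')) *
      (of_real (s ^ m / (K * U powr (real l - t * N + 1)) / mgf_prod N ((real l - real N * t) / s + 1 / s)) * (z * cnj z') ^ l)
      = of_real (s / U) * ph * summand N (a + cnj a') ((real l - real N * t) / s)" for l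
  proof -
    define y where "y = (real l - real N * t) / s"
    define c where "c = a + cnj a'"
    have ly: "real l / s = y + t * s" using s N0 by (simp add: y_def field_simps)
    have uu: "u * cnj u = of_real U" unfolding U_def by (rule complex_norm_square[symmetric])
    have zz: "z * cnj z' = (u * cnj u) * exp (c / of_real s)"
      unfolding z z' s_def[symmetric] c_def by (simp add: exp_cnj exp_add add_divide_distrib mult_ac)
    have "(z * cnj z') ^ l = of_real (U ^ l) * exp (of_real (real l) * (c / of_real s))"
    proof -
      have "exp (of_real (real l) * w) = exp w ^ l" for w :: complex by (simp add: exp_of_nat_mult)
      then show ?thesis unfolding zz uu by (simp only: power_mult_distrib of_real_power)
    qed
    also have "of_real (real l) * (c / of_real s) = c * of_real (real l / s)" by simp
    also have "exp (c * of_real (real l / s)) = exp (c * of_real y) * exp (of_real (t * s) * c)"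
      unfolding ly by (simp add: distrib_left exp_add mult_ac)
    finally have zl: "(z * cnj z') ^ l = of_real (U ^ l) * (exp (c * of_real y) * exp (of_real (t * s) * c))" .
    have "of_real (E * E') * exp (of_real (t * s) * c) = ph"
    proof -
      have "of_real (E * E') = exp (of_real (- (t * s * Re a)) + of_real (- (t * s * Re a')) :: complex)"
        by (simp only: E_def E'_def of_real_mult exp_add exp_of_real)
      then have "of_real (E * E') * exp (of_real (t * s) * c) =
          exp (of_real (- (t * s * Re a)) + of_real (- (t * s * Re a')) + of_real (t * s) * c)"
        by (simp only: exp_add)
      also have "of_real (- (t * s * Re a)) + of_real (- (t * s * Re a')) + of_real (t * s) * c =
          \<i> * of_real (t * s * Im a) - \<i> * of_real (t * s * Im a')"
        by (simp add: c_def complex_eq_iff algebra_simps)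
      finally show ?thesis by (simp add: ph_def exp_diff)
    qed
    moreover have "C * (s ^ m / (K * U powr (real l - t * N + 1))) * U ^ l = s / U"
    proof -
      have "U powr (real l - t * N + 1) = U powr (- (t * N)) * U ^ l * U"
      proof -
        have "real l - t * N + 1 = - (t * N) + real l + 1" by simp
        then show ?thesis using U by (simp only: powr_add powr_realpow powr_one)
      qed
      \<comment> \<open>One power of s survives because there are m = j + 1 moments but j
        integrations. The second s in N = s s compensates the division of the sum by sqrt N.\<close>
      moreover have "(1 / s) ^ j * s ^ m = s" using s unfolding m by (simp add: power_divide)
      ultimately show ?thesis
        unfolding C_def using K U s by (simp add: field_simps)
    qed
    ultimately have main: "of_real (C * (s ^ m / (K * U powr (real l - t * N + 1))) * U ^ l) *
        (of_real (E * E') * exp (of_real (t * s) * c)) * (exp (c * of_real y) / of_real (mgf_prod N (y + 1 / s))) =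
        of_real (s / U) * ph * (exp (c * of_real y) / of_real (mgf_prod N (y + 1 / s)))"
      by (simp only:)
    have sm: "summand N c y = exp (c * of_real y) / of_real (mgf_prod N (y + 1 / s))"
      by (simp add: summand_def s_def)
    show ?thesis
      unfolding y_def[symmetric] c_def[symmetric] sm main[symmetric] zl by simp
  qed
  have "kernel_K m \<sigma> \<tau> b N z z' = of_real (sqrt (f * f') / pi) * (\<Sum>l<N. of_real (C * (E * E')) *
      (of_real (s ^ m / (K * U powr (real l - t * N + 1)) / mgf_prod N ((real l - real N * t) / s + 1 / s)) * (z * cnj z') ^ l))"
    unfolding K1 sum_distrib_left[symmetric] by simp
  also have "\<dots> = of_real (sqrt (f * f') / pi) * (of_real (s / U) * ph * (\<Sum>l<N. summand N (a + cnj a') ((real l - real N * t) / s)))"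
    unfolding summand_eq sum_distrib_left ..
  finally have fin: "kernel_K m \<sigma> \<tau> b N z z' = of_real (sqrt (f * f') / pi) * (of_real (s / U) * ph * (\<Sum>l<N. summand N (a + cnj a') ((real l - real N * t) / s)))" .
  have "real N / (pi * U) = s / (pi * U) * s" using s by simp
  then have NU: "complex_of_real (real N / (pi * U)) = of_real (s / (pi * U)) * of_real s" by (simp only: of_real_mult)
  show ?thesis
    unfolding fin U_def[symmetric] s_def[symmetric] f_def[symmetric] f'_def[symmetric] NU ph_def
    using s(1) U by (simp add: field_simps)
qed

section \<open>Limit of the sum over l\<close>

lemma summand_dominated:
  assumes A: "A \<ge> 0"
  shows "\<exists>D. \<forall>\<^sub>F N in sequentially. \<forall>c l. cmod c \<le> A \<longrightarrow>
    cmod (summand N c ((real l - real N * t) / sqrt N)) \<le> D * exp (- \<bar>(real l - real N * t) / sqrt N\<bar>)"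
proof -
  \<comment> \<open>One more than A: up to constants the numerator is at most exp(A |y|) and the
    denominator at least exp(R |y|), and the surplus is the decay exp(- |y|).\<close>
  define R where "R = A + 1"
  have R: "R \<ge> 0" using A by (simp add: R_def)
  have "\<exists>C. \<forall>k. C k > 0 \<and> (\<forall>\<^sub>F N in sequentially. \<forall>l. integrable lborel (\<lambda>x. profile (\<sigma> k + t) (\<tau> k) (b k) N x * exp (l * x)) \<longrightarrow>
           C k * exp (R * \<bar>l\<bar>) \<le> profile_mgf (\<sigma> k + t) (\<tau> k) (b k) N l)"
    using profile_mgf_lower[OF p \<tau> R] by (intro choice) blast
  then obtain C where C: "\<And>k. C k > 0" and ev: "\<And>k. \<forall>\<^sub>F N in sequentially. \<forall>l. integrable lborel (\<lambda>x. profile (\<sigma> k + t) (\<tau> k) (b k) N x * exp (l * x)) \<longrightarrow>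
           C k * exp (R * \<bar>l\<bar>) \<le> profile_mgf (\<sigma> k + t) (\<tau> k) (b k) N l" by blast
  define P where "P = (\<Prod>k\<in>{1..m}. C k)"
  have P: "P > 0" unfolding P_def by (intro prod_pos C)
  have "\<forall>\<^sub>F N in sequentially. \<forall>k\<in>{1..m}. \<forall>l. integrable lborel (\<lambda>x. profile (\<sigma> k + t) (\<tau> k) (b k) N x * exp (l * x)) \<longrightarrow>
           C k * exp (R * \<bar>l\<bar>) \<le> profile_mgf (\<sigma> k + t) (\<tau> k) (b k) N l"
    by (intro eventually_ball_finite ballI ev) simp
  with eventually_regular have "\<forall>\<^sub>F N in sequentially. \<forall>c l. cmod c \<le> A \<longrightarrow>
    cmod (summand N c ((real l - real N * t) / sqrt N)) \<le> exp R / P * exp (- \<bar>(real l - real N * t) / sqrt N\<bar>)"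
  proof eventually_elim
    case (elim N)
    show ?case
    proof (intro allI impI)
      fix c :: complex and l :: nat assume c: "cmod c \<le> A"
      define y where "y = (real l - real N * t) / sqrt N"
      define z where "z = y + 1 / sqrt N"
      have N: "N > 0" using elim(1) by (simp add: regular_def)
      have mp: "mgf_prod N z > 0" using mgf_prod_pos[OF elim(1), of l] by (simp add: z_def y_def)
      \<comment> \<open>Apart from its constant each of the m factors is at least 1, so a single one
        already yields the decay.\<close>
      have "P * exp (R * \<bar>z\<bar>) \<le> P * exp (R * \<bar>z\<bar>) ^ m"
        using P R m by (intro mult_left_mono self_le_power) auto
      also have "\<dots> = (\<Prod>k\<in>{1..m}. C k * exp (R * \<bar>z\<bar>))"
        by (simp add: P_def prod.distrib)
      also have "\<dots> \<le> mgf_prod N z"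
        unfolding mgf_prod_def
      proof (intro prod_mono conjI)
        fix k assume k: "k \<in> {1..m}"
        show "0 \<le> C k * exp (R * \<bar>z\<bar>)" using C[of k] by simp
        show "C k * exp (R * \<bar>z\<bar>) \<le> profile_mgf (\<sigma> k + t) (\<tau> k) (b k) N z"
          using elim(2) k regular_integrable(1)[OF elim(1) k, of l] unfolding z_def y_def by blast
      qed
      finally have lower: "P * exp (R * \<bar>z\<bar>) \<le> mgf_prod N z" .
      have zy: "\<bar>y\<bar> - 1 \<le> \<bar>z\<bar>"
      proof -
        have "1 / sqrt N \<le> 1" "1 / sqrt N \<ge> 0" using N by (auto simp: divide_le_eq)
        then show ?thesis unfolding z_def by linarith
      qed
      have "Re c * y \<le> A * \<bar>y\<bar>"
      proof -
        have "Re c * y \<le> \<bar>Re c\<bar> * \<bar>y\<bar>" using abs_ge_self[of "Re c * y"] by (simp add: abs_mult)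
        also have "\<dots> \<le> A * \<bar>y\<bar>" using abs_Re_le_cmod[of c] c by (intro mult_right_mono) auto
        finally show ?thesis .
      qed
      moreover have "R * (\<bar>y\<bar> - 1) \<le> R * \<bar>z\<bar>" using zy R by (intro mult_left_mono)
      ultimately have ex: "Re c * y \<le> R - \<bar>y\<bar> + R * \<bar>z\<bar>" by (simp add: R_def algebra_simps)
      have "cmod (summand N c y) = exp (Re c * y) / mgf_prod N z"
        using mp by (simp add: summand_def norm_divide z_def[symmetric])
      also have "\<dots> \<le> exp (R - \<bar>y\<bar> + R * \<bar>z\<bar>) / (P * exp (R * \<bar>z\<bar>))"
        using ex lower P by (intro frac_le) auto
      also have "\<dots> = exp R / P * exp (- \<bar>y\<bar>)"
        by (simp add: exp_add exp_diff exp_minus field_simps)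
      finally show "cmod (summand N c ((real l - real N * t) / sqrt N)) \<le> exp R / P * exp (- \<bar>(real l - real N * t) / sqrt N\<bar>)"
        unfolding y_def .
    qed
  qed
  then show ?thesis by blast
qed

lemma summand_continuously_converges:
  assumes c: "c \<longlonglongrightarrow> c0"
  shows "continuously_converges (\<lambda>N. summand N (c N)) (\<lambda>y. exp (- complex_of_real (total_var * y\<^sup>2 / 2) + c0 * of_real y))"
  unfolding continuously_converges_def
proof (intro allI impI)
  fix Y :: "nat \<Rightarrow> real" and y assume Y: "Y \<longlonglongrightarrow> y"
  have "(\<lambda>N. 1 / sqrt (real N)) \<longlonglongrightarrow> 0" by real_asymp
  from tendsto_add[OF Y this] have Y': "(\<lambda>N. Y N + 1 / sqrt (real N)) \<longlonglongrightarrow> y" by simp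
  have mp: "(\<lambda>N. mgf_prod N (Y N + 1 / sqrt (real N))) \<longlonglongrightarrow> (\<Prod>k\<in>{1..m}. exp (saddle_var (\<sigma> k + t) (\<tau> k) * y\<^sup>2 / 2))"
    unfolding mgf_prod_def
    by (intro tendsto_prod continuously_convergesD[OF profile_mgf_continuously_converges Y'] p \<tau>)
  have eq: "(\<Prod>k\<in>{1..m}. exp (saddle_var (\<sigma> k + t) (\<tau> k) * y\<^sup>2 / 2)) = exp (total_var * y\<^sup>2 / 2)"
    by (simp add: exp_sum[symmetric] total_var_def sum_distrib_right sum_divide_distrib)
  have "(\<lambda>N. summand N (c N) (Y N)) \<longlonglongrightarrow> exp (c0 * of_real y) / of_real (exp (total_var * y\<^sup>2 / 2))"
    unfolding summand_def by (intro tendsto_intros c Y mp[unfolded eq]) simp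
  also have "exp (c0 * of_real y) / of_real (exp (total_var * y\<^sup>2 / 2)) =
      exp (- complex_of_real (total_var * y\<^sup>2 / 2) + c0 * of_real y)"
    unfolding exp_add exp_minus exp_of_real by (simp add: field_simps)
  finally show "(\<lambda>N. summand N (c N) (Y N)) \<longlonglongrightarrow> exp (- complex_of_real (total_var * y\<^sup>2 / 2) + c0 * of_real y)" .
qed

lemma summand_sum_tendsto:
  assumes c: "c \<longlonglongrightarrow> c0"
  shows "(\<lambda>N. (\<Sum>l<N. summand N (c N) ((real l - real N * t) / sqrt N)) / of_real (sqrt N)) \<longlonglongrightarrow>
    of_real (sqrt (pi / (2 * total_var))) * exp (c0\<^sup>2 / of_real (2 * total_var)) * boundary_erfc t (c0 / of_real (sqrt (2 * total_var)))"
proof -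
  have "(\<lambda>N. cmod (c N)) \<longlonglongrightarrow> cmod c0" using c by (rule tendsto_norm)
  then have ev: "\<forall>\<^sub>F N in sequentially. cmod (c N) < cmod c0 + 1" by (rule order_tendstoD) simp
  obtain D where "\<forall>\<^sub>F N in sequentially. \<forall>c l. cmod c \<le> cmod c0 + 1 \<longrightarrow>
    cmod (summand N c ((real l - real N * t) / sqrt N)) \<le> D * exp (- \<bar>(real l - real N * t) / sqrt N\<bar>)"
    using summand_dominated[of "cmod c0 + 1"] by auto
  with ev have "\<forall>\<^sub>F N in sequentially. \<forall>l<N. norm (summand N (c N) ((real l - real N * t) / sqrt N)) \<le> D * exp (- \<bar>(real l - real N * t) / sqrt N\<bar>)"
    by eventually_elim auto
  from saddle_sum_tendsto_integral(2)[OF t summand_continuously_converges[OF c] this]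
  show ?thesis
    unfolding integral_gaussian_saddle_region[OF total_var_pos] boundary_erfc_def .
qed

section \<open>Identification of the limit kernel\<close>

lemma sqrt_normal_density_product:
  assumes V: "V > 0"
  shows "sqrt (normal_density 0 (sqrt V) (2 * (sqrt V * x)) * normal_density 0 (sqrt V) (2 * (sqrt V * y)))
    = 1 / sqrt (2 * pi * V) * exp (- x\<^sup>2 - y\<^sup>2)"
proof -
  have nd: "normal_density 0 (sqrt V) (2 * (sqrt V * x)) = 1 / sqrt (2 * pi * V) * (exp (- x\<^sup>2))\<^sup>2" for x
    using V by (simp add: normal_density_def power_mult_distrib exp_double[symmetric])
  have "normal_density 0 (sqrt V) (2 * (sqrt V * x)) * normal_density 0 (sqrt V) (2 * (sqrt V * y)) =
      (1 / sqrt (2 * pi * V) * (exp (- x\<^sup>2) * exp (- y\<^sup>2)))\<^sup>2"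
    unfolding nd by (simp add: power2_eq_square)
  also have "sqrt \<dots> = 1 / sqrt (2 * pi * V) * (exp (- x\<^sup>2) * exp (- y\<^sup>2))"
    unfolding real_sqrt_abs using V by (intro abs_of_nonneg) simp
  finally show ?thesis by (simp add: exp_add[symmetric])
qed

text \<open>The constants multiply to 1 / (2 pi). In the exponent, x^2 / 2 - (Re x)^2 = - |x|^2 / 2
  + i Re x Im x, with the conjugate identity for y; the cross term x cnj y completes the Gaussian
  factor, and the imaginary parts become phases.\<close>

lemma limit_kernel_eq:
  fixes x y :: complex
  assumes V: "V > 0"
  shows "of_real (V / pi) * (of_real (sqrt (normal_density 0 (sqrt V) (2 * Re (of_real (sqrt V) * x)) * normal_density 0 (sqrt V) (2 * Re (of_real (sqrt V) * y)))) *
      (of_real (sqrt (pi / (2 * V))) * exp ((of_real (sqrt V) * x + cnj (of_real (sqrt V) * y))\<^sup>2 / of_real (2 * V)) *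
        boundary_erfc t ((of_real (sqrt V) * x + cnj (of_real (sqrt V) * y)) / of_real (sqrt (2 * V)))))
    = exp (\<i> * of_real (Re x * Im x)) * (of_real (1 / (2 * pi)) * gauss_factor x y * boundary_erfc t ((x + cnj y) / of_real (sqrt 2))) / exp (\<i> * of_real (Re y * Im y))"
proof -
  have s: "of_real (sqrt V) * x + cnj (of_real (sqrt V) * y) = of_real (sqrt V) * (x + cnj y)"
    by (simp add: distrib_left)
  have e1: "of_real (sqrt V) * (x + cnj y) / of_real (sqrt (2 * V)) = (x + cnj y) / of_real (sqrt 2)"
    using V by (simp add: real_sqrt_mult)
  have e2: "(of_real (sqrt V) * (x + cnj y))\<^sup>2 / of_real (2 * V) = (x + cnj y)\<^sup>2 / 2"
  proof -
    have "(complex_of_real (sqrt V))\<^sup>2 = of_real V" using V by (simp flip: of_real_power)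
    then show ?thesis using V by (simp add: power_mult_distrib)
  qed
  have e3: "V / pi * (1 / sqrt (2 * pi * V)) * sqrt (pi / (2 * V)) = 1 / (2 * pi)"
  proof -
    have "1 / sqrt (2 * pi * V) * sqrt (pi / (2 * V)) = sqrt (1 / (2 * V)\<^sup>2)"
      using V by (simp add: real_sqrt_divide[symmetric] real_sqrt_mult[symmetric] power2_eq_square)
    also have "\<dots> = 1 / (2 * V)" unfolding real_sqrt_divide real_sqrt_one real_sqrt_abs using V by simp
    finally show ?thesis using V by (simp add: field_simps)
  qed
  have e4: "complex_of_real (exp (- (Re x)\<^sup>2 - (Re y)\<^sup>2)) * exp ((x + cnj y)\<^sup>2 / 2) =
      exp (\<i> * of_real (Re x * Im x)) * gauss_factor x y / exp (\<i> * of_real (Re y * Im y))"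
    unfolding gauss_factor_def exp_of_real[symmetric] exp_add[symmetric] exp_diff[symmetric]
    by (rule arg_cong[where f = exp])
       (simp add: complex_eq_iff cmod_power2, simp add: power2_eq_square field_simps)
  have re: "Re (of_real (sqrt V) * x) = sqrt V * Re x" for x by simp
  have "of_real A * (of_real (B * E) * (of_real F * G * H)) = of_real (A * B * F) * (of_real E * G) * H"
    for A B E F :: real and G H :: complex by simp
  then show ?thesis
    unfolding s e1 e2 re sqrt_normal_density_product[OF V] e3[symmetric] by (simp only: e4) simp
qed

text \<open>The variables reach the limit multiplied by the conjugate direction of u; the Gaussian
  factor is invariant under this rotation, unlike the argument of erfc.\<close>

lemma gauss_factor_rotate:
  assumes "cmod e = 1"
  shows "gauss_factor (v * e) (w * e) = gauss_factor v w"
proof -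
  have "(v * e) * cnj (w * e) = v * cnj w * (e * cnj e)" by simp
  also have "e * cnj e = 1" using assms by (simp add: complex_norm_square[symmetric])
  finally have "2 * (v * e) * cnj (w * e) = 2 * v * cnj w" by (simp only: mult.assoc mult_1_right)
  moreover have "cmod (v * e) = cmod v" "cmod (w * e) = cmod w" using assms by (simp_all add: norm_mult)
  ultimately show ?thesis unfolding gauss_factor_def by (simp only:)
qed

lemma rescaled_corr_tendsto:
  fixes X :: "nat \<Rightarrow> complex ^ 'n"
  assumes rho: "rho_scale m \<sigma> \<tau> u = 1 / (cmod u * sqrt total_var)" and X: "X \<longlonglongrightarrow> v"
  shows "(\<lambda>N. rescaled_corr m \<sigma> \<tau> b u N (X N)) \<longlonglongrightarrow>
    det (\<chi> k j. edge_kernel t (u / of_real (cmod u)) (v $ k) (v $ j))"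
proof -
  define V where "V = total_var"
  have V: "V > 0" by (simp add: V_def total_var_pos)
  define \<rho> where "\<rho> = rho_scale m \<sigma> \<tau> u"
  have \<rho>: "\<rho> > 0" unfolding \<rho>_def rho using u total_var_pos by simp
  have \<rho>2: "real N / (pi * (cmod u)\<^sup>2) / (real N * \<rho>\<^sup>2) = V / pi" if "N > 0" for N
    using that u V unfolding \<rho>_def rho V_def[symmetric] by (simp add: power_mult_distrib power_divide field_simps)
  \<comment> \<open>The conjugate direction of u: the relative displacement (z - u) / u is the
    variable rotated by e and scaled by sqrt(V / N).\<close>
  define e where "e = cnj (u / of_real (cmod u))"
  have e: "cmod e = 1" using u by (simp add: e_def norm_divide)
  have ue: "1 / (u * of_real \<rho>) = of_real (sqrt V) * e"
  proof -
    have "u * cnj u = of_real ((cmod u)\<^sup>2)" by (rule complex_norm_square[symmetric])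
    then have "u * e = of_real (cmod u)" using u by (simp add: e_def power2_eq_square)
    then have "u * of_real \<rho> * (of_real (sqrt V) * e) = of_real (cmod u * \<rho> * sqrt V)" by simp
    also have "\<dots> = 1" using u V unfolding \<rho>_def rho V_def[symmetric] by simp
    finally show ?thesis using u \<rho> by (simp add: field_simps)
  qed
  define q where "q k N = X N $ k / (u * of_real \<rho>)" for k N
  define a where "a k N = of_real (sqrt (real N)) * Ln (1 + q k N / of_real (sqrt (real N)))" for k N
  have q: "q k \<longlonglongrightarrow> of_real (sqrt V) * (v $ k * e)" for k
  proof -
    have qk: "q k = (\<lambda>N. X N $ k * (1 / (u * of_real \<rho>)))" by (simp add: q_def fun_eq_iff)
    have "q k \<longlonglongrightarrow> v $ k * (of_real (sqrt V) * e)"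
      unfolding qk ue by (intro tendsto_intros X)
    then show ?thesis by (simp only: mult.left_commute)
  qed
  have a: "a k \<longlonglongrightarrow> of_real (sqrt V) * (v $ k * e)" for k
    unfolding a_def by (rule sqrt_mult_Ln_tendsto(1)[OF q])
  \<comment> \<open>Keeps 1 + q / sqrt N away from 0, where \<open>exp (Ln w) = w\<close>
    fails.\<close>
  have small: "\<forall>\<^sub>F N in sequentially. \<forall>k\<in>UNIV. cmod (q k N / of_real (sqrt (real N))) < 1"
  proof (intro eventually_ball_finite ballI)
    fix k
    have "(\<lambda>N. cmod (q k N / of_real (sqrt (real N)))) \<longlonglongrightarrow> cmod 0"
      by (intro tendsto_norm sqrt_mult_Ln_tendsto(2)[OF q])
    then show "\<forall>\<^sub>F N in sequentially. cmod (q k N / of_real (sqrt (real N))) < 1"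
      by (intro order_tendstoD) auto
  qed simp
  define z where "z N k = u + X N $ k / of_real (\<rho> * sqrt (real N))" for N k
  \<comment> \<open>The rescaled kernel with the phases depending on sqrt N removed; those need not
    converge.\<close>
  define M where "M N i k = of_real (V / pi) * (of_real (sqrt (radial_density N (2 * Re (a i N)) * radial_density N (2 * Re (a k N)))) *
      ((\<Sum>l<N. summand N (a i N + cnj (a k N)) ((real l - real N * t) / sqrt N)) / of_real (sqrt N)))" for N i k
  have corr: "\<forall>\<^sub>F N in sequentially. det (\<chi> i k. M N i k) = rescaled_corr m \<sigma> \<tau> b u N (X N)"
    using eventually_regular small
  proof eventually_elim
    case (elim N)
    have N0: "N > 0" using elim(1) by (simp add: regular_def)
    have zexp: "z N k = u * exp (a k N / of_real (sqrt (real N)))" for k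
    proof -
      have "1 + q k N / of_real (sqrt (real N)) \<noteq> 0"
      proof
        assume "1 + q k N / of_real (sqrt (real N)) = 0"
        then have "q k N / of_real (sqrt (real N)) = - 1" by (simp add: add_eq_0_iff)
        then show False using elim(2) by (metis UNIV_I norm_minus_cancel norm_one less_irrefl)
      qed
      then have "exp (a k N / of_real (sqrt (real N))) = 1 + q k N / of_real (sqrt (real N))"
        using N0 by (simp add: a_def)
      then show ?thesis using u \<rho> by (simp add: z_def q_def distrib_left)
    qed
    define ph where "ph k = exp (\<i> * of_real (t * sqrt N * Im (a k N)))" for k
    have entry: "kernel_K m \<sigma> \<tau> b N (z N i) (z N k) / of_real (real N * \<rho>\<^sup>2) = ph i * M N i k / ph k" for i k
    proof -
      have "complex_of_real (real N / (pi * (cmod u)\<^sup>2)) / of_real (real N * \<rho>\<^sup>2) = of_real (V / pi)"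
        unfolding of_real_divide[symmetric] \<rho>2[OF N0] ..
      moreover have "A * (P * Y / Q) / B = P * (A / B * Y) / Q" for A B P Q Y :: complex by (simp add: mult_ac)
      ultimately show ?thesis
        unfolding kernel_K_at_scaled_points[OF elim(1) zexp zexp] M_def ph_def by (simp only:)
    qed
    have "rescaled_corr m \<sigma> \<tau> b u N (X N) =
        det (\<chi> i k. kernel_K m \<sigma> \<tau> b N (z N i) (z N k)) / of_real (real N * \<rho>\<^sup>2) ^ CARD('n)"
      unfolding rescaled_corr_def corr_R_def \<rho>_def[symmetric]
      by (simp add: z_def power_mult_distrib power_mult)
    also have "\<dots> = det (\<chi> i k. kernel_K m \<sigma> \<tau> b N (z N i) (z N k) / of_real (real N * \<rho>\<^sup>2))"
      using det_scale[of "1 / of_real (real N * \<rho>\<^sup>2)" "\<lambda>i k. kernel_K m \<sigma> \<tau> b N (z N i) (z N k)"]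
      by (simp add: power_divide)
    also have "\<dots> = det (\<chi> i k. M N i k)"
      unfolding entry by (rule det_diagonal_conjugation) (simp add: ph_def)
    finally show ?case by simp
  qed
  define L where "L i k = edge_kernel t (u / of_real (cmod u)) (v $ i) (v $ k)" for i k
  \<comment> \<open>The phases that remain in the limit; a second diagonal conjugation removes
    them.\<close>
  define d where "d k = exp (\<i> * of_real (Re (v $ k * e) * Im (v $ k * e)))" for k
  have M: "(\<lambda>N. M N i k) \<longlonglongrightarrow> d i * L i k / d k" for i k
  proof -
    let ?x = "of_real (sqrt V) * (v $ i * e)" and ?y = "of_real (sqrt V) * (v $ k * e)"
    have rd: "(\<lambda>N. radial_density N (2 * Re (a k N))) \<longlonglongrightarrow> normal_density 0 (sqrt V) (2 * Re (of_real (sqrt V) * (v $ k * e)))" for k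
      unfolding V_def by (intro continuously_convergesD[OF radial_density_converges] tendsto_intros a[unfolded V_def])
    let ?E = "of_real (V / pi) * (of_real (sqrt (normal_density 0 (sqrt V) (2 * Re ?x) * normal_density 0 (sqrt V) (2 * Re ?y))) *
      (of_real (sqrt (pi / (2 * V))) * exp ((?x + cnj ?y)\<^sup>2 / of_real (2 * V)) * boundary_erfc t ((?x + cnj ?y) / of_real (sqrt (2 * V)))))"
    have "(\<lambda>N. M N i k) \<longlonglongrightarrow> ?E"
      unfolding M_def
      by (intro tendsto_mult tendsto_const tendsto_of_real tendsto_real_sqrt rd
            summand_sum_tendsto[folded V_def] tendsto_add tendsto_cnj a)
    also have "?E = d i * L i k / d k"
      unfolding limit_kernel_eq[OF V] gauss_factor_rotate[OF e] d_def L_def edge_kernel_def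
      by (simp add: e_def add.commute mult.commute)
    finally show ?thesis .
  qed
  have "(\<lambda>N. det (\<chi> i k. M N i k)) \<longlonglongrightarrow> det (\<chi> i k. d i * L i k / d k)"
    by (intro det_tendsto M)
  also have "det (\<chi> i k. d i * L i k / d k) = det (\<chi> i k. L i k)"
    by (rule det_diagonal_conjugation) (simp add: d_def)
  finally have "(\<lambda>N. rescaled_corr m \<sigma> \<tau> b u N (X N)) \<longlonglongrightarrow> det (\<chi> i k. L i k)"
    using corr by (rule Lim_transform_eventually)
  then show ?thesis unfolding L_def .
qed

end

section \<open>The saddle point and the three regimes\<close>

text \<open>With x |u|^2 = \<sigma>_m + s the algebraic equation becomes the saddle equation in s.
  For s \<ge> t all factors are positive and each quotient (\<sigma>_k + s) / (\<sigma>_k + \<tau>_k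
  + s) increases strictly, so no root lies beyond t and \<open>GREATEST\<close> is attained
  there.\<close>

lemma zeta_root_eq:
  fixes \<sigma> \<tau> :: "nat \<Rightarrow> real"
  assumes m: "m \<ge> 1" and u: "u \<noteq> 0" and p: "\<forall>k\<in>{1..m}. \<sigma> k + t > 0" and \<tau>: "\<forall>k\<in>{1..m}. \<tau> k > 0"
    and saddle: "(\<Prod>k\<in>{1..m}. \<sigma> k + t) = (cmod u)\<^sup>2 * (\<Prod>k\<in>{1..m}. \<sigma> k + \<tau> k + t)"
  shows "(cmod u)\<^sup>2 * zeta_root m \<sigma> \<tau> u = \<sigma> m + t"
proof -
  define U where "U = (cmod u)\<^sup>2"
  have U: "U > 0" using u by (simp add: U_def)
  have "zeta_root m \<sigma> \<tau> u = (\<sigma> m + t) / U"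
    unfolding zeta_root_def U_def[symmetric]
  proof (rule Greatest_equality)
    have e: "\<sigma> k - \<sigma> m + \<tau> k + (\<sigma> m + t) / U * U = \<sigma> k + \<tau> k + t" "\<sigma> k - \<sigma> m + (\<sigma> m + t) / U * U = \<sigma> k + t" for k
      using U by auto
    show "U * (\<Prod>k\<in>{1..m}. \<sigma> k - \<sigma> m + \<tau> k + (\<sigma> m + t) / U * U) - (\<Prod>k\<in>{1..m}. \<sigma> k - \<sigma> m + (\<sigma> m + t) / U * U) = 0"
      unfolding e saddle U_def[symmetric] by (rule diff_self)
  next
    fix x assume x: "U * (\<Prod>k\<in>{1..m}. \<sigma> k - \<sigma> m + \<tau> k + x * U) - (\<Prod>k\<in>{1..m}. \<sigma> k - \<sigma> m + x * U) = 0"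
    show "x \<le> (\<sigma> m + t) / U"
    proof (rule ccontr)
      assume "\<not> x \<le> (\<sigma> m + t) / U"
      then have s: "t < x * U - \<sigma> m" using U by (simp add: not_le pos_divide_less_eq)
      define s where "s = x * U - \<sigma> m"
      have st: "t < s" using s by (simp add: s_def)
      have e: "\<sigma> k - \<sigma> m + \<tau> k + x * U = \<sigma> k + \<tau> k + s" "\<sigma> k - \<sigma> m + x * U = \<sigma> k + s" for k
        by (simp_all add: s_def)
      have pos: "\<sigma> k + t > 0" "\<tau> k > 0" "\<sigma> k + s > 0" "\<sigma> k + \<tau> k + t > 0" "\<sigma> k + \<tau> k + s > 0" if "k \<in> {1..m}" for k
      proof -
        have "\<sigma> k + t > 0" "\<tau> k > 0" using p \<tau> that by blast+
        then show "\<sigma> k + t > 0" "\<tau> k > 0" "\<sigma> k + s > 0" "\<sigma> k + \<tau> k + t > 0" "\<sigma> k + \<tau> k + s > 0"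
          using st by linarith+
      qed
      have P: "(\<Prod>k\<in>{1..m}. \<sigma> k + \<tau> k + t) > 0" "(\<Prod>k\<in>{1..m}. \<sigma> k + \<tau> k + s) > 0"
        by (intro prod_pos pos; assumption)+
      have less: "(\<sigma> k + t) / (\<sigma> k + \<tau> k + t) < (\<sigma> k + s) / (\<sigma> k + \<tau> k + s)" if k: "k \<in> {1..m}" for k
      proof -
        note q = pos[OF k]
        have "(\<sigma> k + t) * (\<sigma> k + \<tau> k + s) < (\<sigma> k + s) * (\<sigma> k + \<tau> k + t)"
          using mult_strict_right_mono[OF st q(2)] by (simp add: algebra_simps)
        then show ?thesis using q by (simp add: pos_less_divide_eq pos_divide_less_eq mult.commute)
      qed
      have "(\<Prod>k\<in>{1..m}. (\<sigma> k + t) / (\<sigma> k + \<tau> k + t)) < (\<Prod>k\<in>{1..m}. (\<sigma> k + s) / (\<sigma> k + \<tau> k + s))"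
      proof (rule prod_mono_strict[of m])
        show "m \<in> {1..m}" using m by simp
        then show "(\<sigma> m + t) / (\<sigma> m + \<tau> m + t) < (\<sigma> m + s) / (\<sigma> m + \<tau> m + s)" by (rule less)
      next
        fix k assume k: "k \<in> {1..m}"
        show "0 \<le> (\<sigma> k + t) / (\<sigma> k + \<tau> k + t) \<and> (\<sigma> k + t) / (\<sigma> k + \<tau> k + t) \<le> (\<sigma> k + s) / (\<sigma> k + \<tau> k + s)"
          using less[OF k] pos[OF k] by (simp add: less_imp_le)
        show "0 < (\<sigma> k + s) / (\<sigma> k + \<tau> k + s)" using pos[OF k] by simp
      qed simp
      moreover have "(\<Prod>k\<in>{1..m}. (\<sigma> k + t) / (\<sigma> k + \<tau> k + t)) = U"
        unfolding prod_dividef saddle U_def[symmetric] using P(1) by (intro nonzero_mult_div_cancel_right) linarith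
      moreover have "(\<Prod>k\<in>{1..m}. (\<sigma> k + s) / (\<sigma> k + \<tau> k + s)) = U"
      proof -
        have "(\<Prod>k\<in>{1..m}. \<sigma> k + s) = U * (\<Prod>k\<in>{1..m}. \<sigma> k + \<tau> k + s)" using x unfolding e by linarith
        then show ?thesis
          unfolding prod_dividef using P(2) by (simp only:) (intro nonzero_mult_div_cancel_right, linarith)
      qed
      ultimately show False by simp
    qed
  qed
  then show ?thesis using U by (simp add: U_def)
qed

lemma rho_scale_eq:
  fixes \<sigma> \<tau> :: "nat \<Rightarrow> real"
  assumes m: "m \<ge> 1" and u: "u \<noteq> 0" and p: "\<forall>k\<in>{1..m}. \<sigma> k + t > 0" and \<tau>: "\<forall>k\<in>{1..m}. \<tau> k > 0"
    and saddle: "(\<Prod>k\<in>{1..m}. \<sigma> k + t) = (cmod u)\<^sup>2 * (\<Prod>k\<in>{1..m}. \<sigma> k + \<tau> k + t)"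
  shows "rho_scale m \<sigma> \<tau> u = 1 / (cmod u * sqrt (\<Sum>k\<in>{1..m}. saddle_var (\<sigma> k + t) (\<tau> k)))"
proof -
  have "(\<Sum>k\<in>{1..m}. 1 / (\<sigma> k - \<sigma> m + (\<sigma> m + t)) - 1 / (\<sigma> k - \<sigma> m + \<tau> k + (\<sigma> m + t))) =
      (\<Sum>k\<in>{1..m}. saddle_var (\<sigma> k + t) (\<tau> k))"
  proof (rule sum.cong)
    fix k assume "k \<in> {1..m}"
    then have "\<sigma> k + t > 0" "\<sigma> k + t + \<tau> k > 0" using p \<tau> by (force intro: add_pos_pos)+
    then have "1 / (\<sigma> k + t) - 1 / (\<sigma> k + t + \<tau> k) = saddle_var (\<sigma> k + t) (\<tau> k)"
      by (simp add: saddle_var_def divide_simps)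
    then show "1 / (\<sigma> k - \<sigma> m + (\<sigma> m + t)) - 1 / (\<sigma> k - \<sigma> m + \<tau> k + (\<sigma> m + t)) = saddle_var (\<sigma> k + t) (\<tau> k)"
      by (simp add: add_ac)
  qed simp
  then show ?thesis unfolding rho_scale_def zeta_root_eq[OF assms] by simp
qed

text \<open>Lets the parameters be redefined outside {1..m}, where the locale asks for positivity at
  every index and for a copy of index m at 0.\<close>

lemma rescaled_corr_cong:
  assumes m: "m \<ge> 1" and "\<And>k. k \<in> {1..m} \<Longrightarrow> \<sigma>' k = \<sigma> k" "\<And>k. k \<in> {1..m} \<Longrightarrow> \<tau>' k = \<tau> k" "\<And>k. k \<in> {1..m} \<Longrightarrow> b' k = b k"
  shows "rescaled_corr m \<sigma>' \<tau>' b' = rescaled_corr m \<sigma> \<tau> b"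
proof -
  have mm: "m \<in> {1..m}" using m by simp
  have sub: "k \<in> {1..m}" if "k \<in> {1..<m}" for k using that by simp
  note eqs = assms(2-4)[OF mm] assms(2-4)
  have ph: "phase_p m \<sigma>' \<tau>' z r = phase_p m \<sigma> \<tau> z r" for z r
  proof -
    have "(\<Sum>k\<in>{1..<m}. 2 * (\<sigma>' k - \<sigma>' m) * ln (r k) + \<tau>' k * ln (1 - (r k)\<^sup>2)) =
        (\<Sum>k\<in>{1..<m}. 2 * (\<sigma> k - \<sigma> m) * ln (r k) + \<tau> k * ln (1 - (r k)\<^sup>2))"
      by (intro sum.cong refl) (simp add: eqs(1,2) assms(2,3)[OF sub])
    then show ?thesis unfolding phase_p_def eqs(1,2) by simp
  qed
  have am: "amplitude_q m b' r = amplitude_q m b r" for r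
    unfolding amplitude_q_def by (intro prod.cong refl) (simp add: eqs(3) assms(4)[OF sub])
  have wi: "weight_integrand m \<sigma>' \<tau>' b' N z r = weight_integrand m \<sigma> \<tau> b N z r" for N z r
    unfolding weight_integrand_def ph am ..
  have pc: "(\<Prod>k\<in>{1..m}. F (\<sigma>' k) (\<tau>' k) (b' k)) = (\<Prod>k\<in>{1..m}. F (\<sigma> k) (\<tau> k) (b k))"
    for F :: "real \<Rightarrow> real \<Rightarrow> real \<Rightarrow> real"
    by (rule prod.cong) (simp_all only: assms(2-4))
  have w: "weight_w m \<sigma>' \<tau>' b' = weight_w m \<sigma> \<tau> b"
  proof (intro ext)
    fix N z
    show "weight_w m \<sigma>' \<tau>' b' N z = weight_w m \<sigma> \<tau> b N z"
      unfolding weight_w_def wi eqs(1-3)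
        pc[of "\<lambda>s t b. Gamma ((s + t) * real N + b + 2) / (Gamma (s * real N + b + 1) * Gamma (t * real N + 1))"] ..
  qed
  have T: "kernel_T m \<sigma>' \<tau>' b' = kernel_T m \<sigma> \<tau> b"
  proof (intro ext)
    fix N z z'
    show "kernel_T m \<sigma>' \<tau>' b' N z z' = kernel_T m \<sigma> \<tau> b N z z'"
      unfolding kernel_T_def
        pc[of "\<lambda>s t b. Gamma (s * real N + b + 1) / Gamma ((s + t) * real N + b + 2)"]
        pc[of "\<lambda>s t b. Gamma ((s + t) * real N + b + real l + 2) / Gamma (s * real N + b + real l + 1)" for l] ..
  qed
  have zr: "zeta_root m \<sigma>' \<tau>' = zeta_root m \<sigma> \<tau>"
  proof (rule ext)
    fix u
    show "zeta_root m \<sigma>' \<tau>' u = zeta_root m \<sigma> \<tau> u"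
      unfolding zeta_root_def eqs(1)
        pc[of "\<lambda>s t b. s - \<sigma> m + t + x * (cmod u)\<^sup>2" for x] pc[of "\<lambda>s t b. s - \<sigma> m + x * (cmod u)\<^sup>2" for x] ..
  qed
  have "rho_scale m \<sigma>' \<tau>' u = rho_scale m \<sigma> \<tau> u" for u
  proof -
    have "(\<Sum>k\<in>{1..m}. 1 / (\<sigma>' k - \<sigma> m + (cmod u)\<^sup>2 * zeta_root m \<sigma> \<tau> u) - 1 / (\<sigma>' k - \<sigma> m + \<tau>' k + (cmod u)\<^sup>2 * zeta_root m \<sigma> \<tau> u)) =
        (\<Sum>k\<in>{1..m}. 1 / (\<sigma> k - \<sigma> m + (cmod u)\<^sup>2 * zeta_root m \<sigma> \<tau> u) - 1 / (\<sigma> k - \<sigma> m + \<tau> k + (cmod u)\<^sup>2 * zeta_root m \<sigma> \<tau> u))"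
      by (rule sum.cong) (simp_all only: assms(2,3))
    then show ?thesis unfolding rho_scale_def zr eqs(1) by (rule arg_cong)
  qed
  then show ?thesis
    by (simp add: fun_eq_iff rescaled_corr_def corr_R_def kernel_K_def w T)
qed

lemma compact_vec_of_compact:
  fixes C :: "complex set"
  assumes "compact C"
  shows "compact {v :: complex ^ 'n. \<forall>k. v $ k \<in> C}"
proof -
  have "closed {v :: complex ^ 'n. \<forall>k. v $ k \<in> C}"
  proof -
    have "{v :: complex ^ 'n. \<forall>k. v $ k \<in> C} = (\<Inter>k. (\<lambda>v. v $ k) -` C)" by auto
    moreover have "closed ((\<lambda>v :: complex ^ 'n. v $ k) -` C)" for k
      using assms by (intro closed_vimage compact_imp_closed continuous_intros)
    ultimately show ?thesis by auto
  qed
  moreover have "bounded {v :: complex ^ 'n. \<forall>k. v $ k \<in> C}"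
  proof -
    obtain B where B: "\<And>x. x \<in> C \<Longrightarrow> norm x \<le> B"
      using compact_imp_bounded[OF assms] unfolding bounded_iff by blast
    have "norm v \<le> (\<Sum>k\<in>(UNIV :: 'n set). B)" if "\<forall>k. v $ k \<in> C" for v :: "complex ^ 'n"
    proof -
      have "norm v \<le> (\<Sum>k\<in>UNIV. norm (v $ k))" unfolding norm_vec_def by (rule L2_set_le_sum) simp
      also have "\<dots> \<le> (\<Sum>k\<in>(UNIV :: 'n set). B)" using that B by (intro sum_mono) blast
      finally show ?thesis .
    qed
    then show ?thesis unfolding bounded_iff by blast
  qed
  ultimately show ?thesis by (simp add: compact_eq_bounded_closed)
qed

lemma continuous_on_boundary_erfc [continuous_intros]:
  assumes "continuous_on A f"
  shows "continuous_on A (\<lambda>x. boundary_erfc t (f x))"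
proof -
  have "continuous_on UNIV cerf"
    by (intro DERIV_continuous_on[OF has_field_derivative_at_within[OF cerf_has_field_derivative]])
  then have cerf: "continuous_on A (\<lambda>x. cerf (g x))" if "continuous_on A g" for g
    using that by (rule continuous_on_compose2) auto
  have "continuous_on A (\<lambda>x. cerfc (- f x))" "continuous_on A (\<lambda>x. cerfc (f x))"
    unfolding cerfc_def by (intro continuous_intros cerf assms)+
  then show ?thesis by (cases "t = 0"; cases "t = 1") (simp_all add: boundary_erfc_def)
qed

lemma rescaled_corr_uniform_limit:
  fixes \<sigma> \<tau> b :: "nat \<Rightarrow> real"
  assumes m: "m \<ge> 1" and \<alpha>: "\<forall>\<^sub>F N :: nat in sequentially. \<forall>k\<in>{1..m}. \<sigma> k * real N + b k > -1"
    and \<tau>: "\<forall>k\<in>{1..m}. \<tau> k > 0" and u: "u \<noteq> 0" and t: "0 \<le> t" "t \<le> 1"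
    and p: "\<forall>k\<in>{1..m}. \<sigma> k + t > 0"
    and saddle: "(\<Prod>k\<in>{1..m}. \<sigma> k + t) = (cmod u)\<^sup>2 * (\<Prod>k\<in>{1..m}. \<sigma> k + \<tau> k + t)"
    and C: "compact C"
  shows "uniform_limit {v :: complex ^ 'n. \<forall>k. v $ k \<in> C} (\<lambda>N v. rescaled_corr m \<sigma> \<tau> b u N v)
    (\<lambda>v. det (\<chi> k j. edge_kernel t (u / of_real (cmod u)) (v $ k) (v $ j))) sequentially"
proof (rule uniform_limit_if_continuously_converges[OF compact_vec_of_compact[OF C]])
  \<comment> \<open>Repeating the values of index m outside {1..m} provides both positivity at every
    index and the copy at index 0.\<close>
  define \<sigma>' where "\<sigma>' k = (if k \<in> {1..m} then \<sigma> k else \<sigma> m)" for k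
  define \<tau>' where "\<tau>' k = (if k \<in> {1..m} then \<tau> k else \<tau> m)" for k
  define b' where "b' k = (if k \<in> {1..m} then b k else b m)" for k
  have eqs: "\<sigma>' k = \<sigma> k" "\<tau>' k = \<tau> k" "b' k = b k" if "k \<in> {1..m}" for k
    using that by (simp_all add: \<sigma>'_def \<tau>'_def b'_def)
  have mm: "m \<in> {1..m}" using m by simp
  have saddle': "(\<Prod>k\<in>{1..m}. \<sigma>' k + t) = (cmod u)\<^sup>2 * (\<Prod>k\<in>{1..m}. \<sigma>' k + \<tau>' k + t)"
  proof -
    have "(\<Prod>k\<in>{1..m}. \<sigma>' k + t) = (\<Prod>k\<in>{1..m}. \<sigma> k + t)" "(\<Prod>k\<in>{1..m}. \<sigma>' k + \<tau>' k + t) = (\<Prod>k\<in>{1..m}. \<sigma> k + \<tau> k + t)"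
      by (rule prod.cong; simp_all only: eqs)+
    then show ?thesis using saddle by (simp only:)
  qed
  have \<alpha>': "\<forall>\<^sub>F N :: nat in sequentially. \<forall>k\<in>{1..m}. \<sigma>' k * real N + b' k > -1"
    using \<alpha> by eventually_elim (simp add: eqs)
  interpret S: saddle_data m "m - 1" \<sigma>' \<tau>' b' u t
  proof
    show "m = Suc (m - 1)" using m by simp
    show "\<sigma>' k + t > 0" "\<tau>' k > 0" for k using p \<tau> mm by (auto simp: \<sigma>'_def \<tau>'_def)
    show "\<sigma>' 0 = \<sigma>' m" "\<tau>' 0 = \<tau>' m" "b' 0 = b' m" using mm by (auto simp: \<sigma>'_def \<tau>'_def b'_def)
  qed (fact t u saddle' \<alpha>')+
  have rho: "rho_scale m \<sigma>' \<tau>' u = 1 / (cmod u * sqrt S.total_var)"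
    unfolding S.total_var_def by (rule rho_scale_eq[OF m u _ _ saddle']) (use p \<tau> eqs in auto)
  show "continuous_on {v :: complex ^ 'n. \<forall>k. v $ k \<in> C} (\<lambda>v. det (\<chi> k j. edge_kernel t (u / of_real (cmod u)) (v $ k) (v $ j)))"
    unfolding det_def edge_kernel_def gauss_factor_def using u by (auto intro!: continuous_intros)
  fix X :: "nat \<Rightarrow> complex ^ 'n" and v assume "X \<longlonglongrightarrow> v"
  note lim = S.rescaled_corr_tendsto[OF rho this]
  have cong: "rescaled_corr m \<sigma>' \<tau>' b' u N v = rescaled_corr m \<sigma> \<tau> b u N v" for N and v :: "complex ^ 'n"
    by (simp only: rescaled_corr_cong[OF m, of \<sigma>' \<sigma> \<tau>' \<tau> b' b] eqs)
  show "(\<lambda>N. rescaled_corr m \<sigma> \<tau> b u N (X N)) \<longlonglongrightarrow> det (\<chi> k j. edge_kernel t (u / of_real (cmod u)) (v $ k) (v $ j))"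
    using lim unfolding cong .
qed

text \<open>The difference A t - r^2 B t is negative at t = 0 because r exceeds the inner radius and
  positive at t = 1 because r is below the outer one, so the intermediate value theorem places a
  zero strictly inside.\<close>

lemma bulk_saddle_exists:
  fixes \<sigma> \<tau> :: "nat \<Rightarrow> real"
  assumes \<sigma>: "\<forall>k\<in>{1..m}. \<sigma> k \<ge> 0" and \<tau>: "\<forall>k\<in>{1..m}. \<tau> k > 0"
    and r: "r_in m \<sigma> \<tau> < r" "r < r_out m \<sigma> \<tau>"
  shows "\<exists>t. 0 < t \<and> t < 1 \<and> (\<Prod>k\<in>{1..m}. \<sigma> k + t) = r\<^sup>2 * (\<Prod>k\<in>{1..m}. \<sigma> k + \<tau> k + t)"
proof -
  define A B where "A t = (\<Prod>k\<in>{1..m}. \<sigma> k + t)" and "B t = (\<Prod>k\<in>{1..m}. \<sigma> k + \<tau> k + t)" for t :: real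
  have B: "B t > 0" if "t \<ge> 0" for t
    unfolding B_def
  proof (rule prod_pos)
    fix k assume k: "k \<in> {1..m}"
    have "\<sigma> k \<ge> 0" "\<tau> k > 0" using bspec[OF \<sigma> k] bspec[OF \<tau> k] by simp_all
    then show "0 < \<sigma> k + \<tau> k + t" using that by linarith
  qed
  have A: "A t \<ge> 0" if "t \<ge> 0" for t
    unfolding A_def using \<sigma> that by (intro prod_nonneg) auto
  have rin: "r_in m \<sigma> \<tau> = sqrt (A 0 / B 0)" by (simp add: r_in_def A_def B_def)
  have rout: "r_out m \<sigma> \<tau> = sqrt (A 1 / B 1)"
    unfolding r_out_def A_def B_def by (simp add: add.commute add.left_commute)
  have r0: "r > 0"
  proof -
    have "0 \<le> sqrt (A 0 / B 0)" using A[of 0] B[of 0] by simp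
    then show ?thesis using r(1) unfolding rin by linarith
  qed
  have rr: "r = sqrt (r\<^sup>2)" using r0 by simp
  have "A 0 / B 0 < r\<^sup>2" using r(1) unfolding rin by (subst (asm) rr) (simp only: real_sqrt_less_iff)
  then have f0: "A 0 < r\<^sup>2 * B 0" using B[of 0] by (simp add: pos_divide_less_eq)
  have "r\<^sup>2 < A 1 / B 1" using r(2) unfolding rout by (subst (asm) rr) (simp only: real_sqrt_less_iff)
  then have f1: "r\<^sup>2 * B 1 < A 1" using B[of 1] by (simp add: pos_less_divide_eq)
  have "continuous_on {0..1} (\<lambda>t. A t - r\<^sup>2 * B t)" unfolding A_def B_def by (intro continuous_intros)
  then obtain t where t: "0 \<le> t" "t \<le> 1" "A t - r\<^sup>2 * B t = 0"
    using IVT'[of "\<lambda>t. A t - r\<^sup>2 * B t" 0 0 1] f0 f1 by auto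
  then have "t \<noteq> 0" "t \<noteq> 1" using f0 f1 by auto
  then show ?thesis using t by (intro exI[of _ t]) (simp add: A_def B_def)
qed

theorem theorem5p7:
  fixes m :: nat and \<sigma> \<tau> b :: "nat \<Rightarrow> real" and u :: complex
  assumes "m \<ge> 1"
    and "\<forall>\<^sub>F N :: nat in sequentially. \<forall>k\<in>{1..m}. \<sigma> k * real N + b k > -1"
    and "\<forall>k\<in>{1..m}. \<sigma> k \<ge> 0"
    and "\<forall>k\<in>{1..m}. \<tau> k > 0"
    and "0 < cmod u" and "cmod u < 1"
  shows
    "(r_in m \<sigma> \<tau> < cmod u \<and> cmod u < r_out m \<sigma> \<tau> \<longrightarrow>
       (\<forall>C. compact C \<longrightarrow>
         uniform_limit {v :: complex ^ 'n. \<forall>k. v $ k \<in> C}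
           (\<lambda>N v. rescaled_corr m \<sigma> \<tau> b u N v)
           (\<lambda>v. det (\<chi> k j. complex_of_real (1 / pi) * gauss_factor (v $ k) (v $ j)))
           sequentially)) \<and>
     (\<forall>\<phi> :: real. (\<forall>k\<in>{1..m}. \<sigma> k > 0) \<and> 0 \<le> \<phi> \<and> \<phi> < 2 * pi \<and>
         u = complex_of_real (r_in m \<sigma> \<tau>) * cis \<phi> \<longrightarrow>
       (\<forall>C. compact C \<longrightarrow>
         uniform_limit {v :: complex ^ 'n. \<forall>k. v $ k \<in> C}
           (\<lambda>N v. rescaled_corr m \<sigma> \<tau> b u N v)
           (\<lambda>v. det (\<chi> k j. complex_of_real (1 / (2 * pi)) * gauss_factor (v $ k) (v $ j) *
              cerfc (- ((cis \<phi> * cnj (v $ j) + v $ k * cis (- \<phi>)) / complex_of_real (sqrt 2)))))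
           sequentially)) \<and>
     (\<forall>\<phi> :: real. 0 \<le> \<phi> \<and> \<phi> < 2 * pi \<and>
         u = complex_of_real (r_out m \<sigma> \<tau>) * cis \<phi> \<longrightarrow>
       (\<forall>C. compact C \<longrightarrow>
         uniform_limit {v :: complex ^ 'n. \<forall>k. v $ k \<in> C}
           (\<lambda>N v. rescaled_corr m \<sigma> \<tau> b u N v)
           (\<lambda>v. det (\<chi> k j. complex_of_real (1 / (2 * pi)) * gauss_factor (v $ k) (v $ j) *
              cerfc ((cis \<phi> * cnj (v $ j) + v $ k * cis (- \<phi>)) / complex_of_real (sqrt 2))))
           sequentially))"
proof (intro conjI allI impI, goal_cases)
  have u: "u \<noteq> 0" using assms(5) by auto
  note main = rescaled_corr_uniform_limit[OF assms(1,2,4) u]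
  have pos: "(\<Prod>k\<in>{1..m}. \<sigma> k + \<tau> k + t) > 0" if "t \<ge> 0" for t
  proof (rule prod_pos)
    fix k assume k: "k \<in> {1..m}"
    have "\<sigma> k \<ge> 0" "\<tau> k > 0" using bspec[OF assms(3) k] bspec[OF assms(4) k] by simp_all
    then show "0 < \<sigma> k + \<tau> k + t" using that by linarith
  qed
  have nonneg: "(\<Prod>k\<in>{1..m}. \<sigma> k + t) \<ge> 0" if "t \<ge> 0" for t
    using assms(3) that by (intro prod_nonneg) auto
  \<comment> \<open>Both edge radii are instances of one formula, at t = 0 and t = 1, so the edges
    share this computation.\<close>
  have saddle: "(\<Prod>k\<in>{1..m}. \<sigma> k + t) = (cmod u)\<^sup>2 * (\<Prod>k\<in>{1..m}. \<sigma> k + \<tau> k + t)"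
      and direction: "u / of_real (cmod u) = cis \<phi>" "cnj (cis \<phi>) = cis (- \<phi>)"
    if t: "t \<ge> 0" and r: "r = sqrt ((\<Prod>k\<in>{1..m}. \<sigma> k + t) / (\<Prod>k\<in>{1..m}. \<sigma> k + \<tau> k + t))"
      and ur: "u = complex_of_real r * cis \<phi>" for t r \<phi>
  proof -
    have q: "(\<Prod>k\<in>{1..m}. \<sigma> k + t) / (\<Prod>k\<in>{1..m}. \<sigma> k + \<tau> k + t) \<ge> 0"
      by (intro divide_nonneg_pos nonneg pos t)
    then have r0: "r \<ge> 0" unfolding r by (rule real_sqrt_ge_zero)
    then have c: "cmod u = r" unfolding ur by (simp add: norm_mult)
    show "u / of_real (cmod u) = cis \<phi>" unfolding c using u ur by auto
    show "cnj (cis \<phi>) = cis (- \<phi>)" by (rule cis_cnj)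
    have "(cmod u)\<^sup>2 = (\<Prod>k\<in>{1..m}. \<sigma> k + t) / (\<Prod>k\<in>{1..m}. \<sigma> k + \<tau> k + t)"
      unfolding c r by (rule real_sqrt_pow2[OF q])
    then show "(\<Prod>k\<in>{1..m}. \<sigma> k + t) = (cmod u)\<^sup>2 * (\<Prod>k\<in>{1..m}. \<sigma> k + \<tau> k + t)"
      using pos[OF t] by (metis less_irrefl nonzero_eq_divide_eq)
  qed
  {
    case (1 C)
    then obtain t where t: "0 < t" "t < 1" and eq: "(\<Prod>k\<in>{1..m}. \<sigma> k + t) = (cmod u)\<^sup>2 * (\<Prod>k\<in>{1..m}. \<sigma> k + \<tau> k + t)"
      using bulk_saddle_exists[OF assms(3,4)] by blast
    \<comment> \<open>A positive t makes every tilted exponent positive, also where \<sigma>_k =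
      0.\<close>
    have "\<forall>k\<in>{1..m}. \<sigma> k + t > 0" using assms(3) t(1) by (auto intro: add_nonneg_pos)
    from main[OF _ _ this eq 1(2)] t show ?case
      by (simp add: edge_kernel_def boundary_erfc_def)
  next
    case (2 \<phi> C)
    \<comment> \<open>At t = 0 the tilt is trivial, and positivity of the exponents is the extra
      assumption made for the inner edge.\<close>
    then have p: "\<forall>k\<in>{1..m}. \<sigma> k + 0 > 0" and ur: "u = complex_of_real (r_in m \<sigma> \<tau>) * cis \<phi>" by auto
    have r: "r_in m \<sigma> \<tau> = sqrt ((\<Prod>k\<in>{1..m}. \<sigma> k + 0) / (\<Prod>k\<in>{1..m}. \<sigma> k + \<tau> k + 0))"
      by (simp add: r_in_def)
    note s = saddle[OF order_refl r ur] and d = direction[OF order_refl r ur]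
    from main[OF order_refl zero_le_one p s 2(2)] show ?case
      unfolding edge_kernel_def boundary_erfc_def d by simp
  next
    case (3 \<phi> C)
    then have ur: "u = complex_of_real (r_out m \<sigma> \<tau>) * cis \<phi>" by auto
    have p: "\<forall>k\<in>{1..m}. \<sigma> k + 1 > 0" using assms(3) by (auto intro: add_nonneg_pos)
    have r: "r_out m \<sigma> \<tau> = sqrt ((\<Prod>k\<in>{1..m}. \<sigma> k + 1) / (\<Prod>k\<in>{1..m}. \<sigma> k + \<tau> k + 1))"
      unfolding r_out_def by (simp add: add.commute add.left_commute)
    note s = saddle[OF zero_le_one r ur] and d = direction[OF zero_le_one r ur]
    from main[OF zero_le_one order_refl p s 3(2)] show ?case
      unfolding edge_kernel_def boundary_erfc_def d by simp
  }
qed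

end
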